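(* Let $N>1$, let $f(z)=\sum_{n\ge1}a(n)e^{2\pi i n z}$ be a cusp form of weight $2$ for $\Gamma=\Gamma_0(N)$ which is a Hecke eigenform, and let $\chi$ be a primitive Dirichlet character modulo $N$ with $\chi(-1)=1$. For $\mathrm{Re}(s)>2$ and every integer $n\neq0$, $$L(n,\chi;s)=\frac{2\Gamma(s)N^{2s}L(\bar\chi,2s)}{i\,W(\bar\chi)(\pi|n|)^{s-1}}\,\phi^*(n,s,\chi),$$ and the coefficient of $y^{1-s}$ in the Fourier expansion of $E^*(z,s;\chi)$ is $$\phi^*(s,\chi)=\frac{i\,W(\bar\chi)\,\Gamma(s-\frac12)}{2\pi^{1/2}N^{2s}\Gamma(s)}\frac{L(f\otimes\chi,1)\,L(f,2s)}{L(\bar\chi,2s)\,L(\chi,2s)}.$$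
   Context: For $\gamma=\left(\begin{smallmatrix}a&b\\c&d\end{smallmatrix}\right)\in\Gamma$, $\chi(\gamma)=\chi(d)$, and the modular symbol is $\langle f,\gamma\rangle=\int_{i\infty}^{\gamma(i\infty)}f(w)\,dw$. The Eisenstein series with modular symbols is $E^*(z,s;\chi)=\sum_{\gamma\in\Gamma_\infty\backslash\Gamma}\overline{\chi(\gamma)}\langle f,\gamma\rangle\,\mathrm{Im}(\gamma z)^s$, where $\Gamma_\infty$ is the stabilizer of $\infty$ in $\Gamma$; it has Fourier expansion $E^*(z,s;\chi)=\phi^*(s,\chi)y^{1-s}+\sum_{n\neq0}\phi^*(n,s,\chi)W_s(nz)$ with $W_s(nz)=\sqrt{|n|y}K_{s-1/2}(2\pi|n|y)e^{2\pi i n x}$ ($z=x+iy$). $\sigma_t^{\chi}(m)=\sum_{d\mid m}\chi(d)d^t$; $W(\bar\chi)=\sum_{a\bmod N}\bar\chi(a)e^{2\pi i a/N}$; $L(\chi,s)=\sum_{(n,N)=1}\chi(n)n^{-s}$ and similarly $L(\bar\chi,s)$; $L(f,s)=\sum a(n)n^{-s}$ and $L(f\otimes\chi,s)=\sum a(n)\chi(n)n^{-s}$ (analytically continued). $L(n,\chi;s)$ denotes the value at $t=1$ of the analytic continuation in $t$ of $\sum_{l\ge1,\,m=l-n\neq0}\frac{a(l)\sigma^{\chi}_{2s-1}(|m|)}{l^t|m|^{2s-1}}$.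
   Formalization: The Whittaker function is taken with an extra factor 2, W_s(nz)=2√(|n|y)K_{s-1/2}(2π|n|y)e^{2πinx}, without which the formula for n≠0 is off by 2; the formula for φ*(s,χ), linear in f on the left and quadratic on the right, assumes a(1)=1. *)

theory Defs
  imports "HOL-Complex_Analysis.Complex_Analysis"
begin

subsection \<open>Cusp forms of weight 2 for $\Gamma_0(N)$\<close>

definition upper_half_plane :: "complex set" where
  "upper_half_plane = {z. Im z > 0}"

definition Gamma0 :: "nat \<Rightarrow> (int ^ 2 ^ 2) set" where
  "Gamma0 N = {\<gamma>. det \<gamma> = 1 \<and> int N dvd \<gamma> $ 2 $ 1}"

abbreviation SL2Z :: "(int ^ 2 ^ 2) set" where
  "SL2Z \<equiv> Gamma0 1"

definition aut_factor :: "int ^ 2 ^ 2 \<Rightarrow> complex \<Rightarrow> complex" where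
  "aut_factor \<gamma> z = of_int (\<gamma> $ 2 $ 1) * z + of_int (\<gamma> $ 2 $ 2)"

definition moebius_act :: "int ^ 2 ^ 2 \<Rightarrow> complex \<Rightarrow> complex" where
  "moebius_act \<gamma> z = (of_int (\<gamma> $ 1 $ 1) * z + of_int (\<gamma> $ 1 $ 2)) / aut_factor \<gamma> z"

definition slash2 :: "(complex \<Rightarrow> complex) \<Rightarrow> int ^ 2 ^ 2 \<Rightarrow> complex \<Rightarrow> complex" where
  "slash2 f \<gamma> z = f (moebius_act \<gamma> z) / aut_factor \<gamma> z ^ 2"

text \<open>Vanishing at all cusps is expressed by letting $\gamma$ range over
  $SL_2(\mathbb{Z})$, which permutes the cusps transitively.\<close>

definition cusp_form2 :: "nat \<Rightarrow> (complex \<Rightarrow> complex) \<Rightarrow> bool" where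
  "cusp_form2 N f \<longleftrightarrow>
     f holomorphic_on upper_half_plane \<and>
     (\<forall>\<gamma>\<in>Gamma0 N. \<forall>z\<in>upper_half_plane. slash2 f \<gamma> z = f z) \<and>
     (\<forall>\<gamma>\<in>SL2Z. (slash2 f \<gamma> \<longlongrightarrow> 0) (filtercomap Im at_top))"

text \<open>The Hecke operator $T_n$ in weight 2,
  $(T_n f)(z) = n \sum_{kd = n} d^{-2} \sum_{b \bmod d} f((kz+b)/d)$.
  This is the formula for $n$ coprime to the level, the only case used below.\<close>

definition hecke_op2 :: "nat \<Rightarrow> (complex \<Rightarrow> complex) \<Rightarrow> complex \<Rightarrow> complex" where
  "hecke_op2 n f z =
     of_nat n * (\<Sum>d | d dvd n. (\<Sum>b<d. f ((of_nat (n div d) * z + of_nat b) / of_nat d)) / of_nat d ^ 2)"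

text \<open>An eigenform is required to be an eigenfunction of the $T_n$ with $n$ coprime to the level only,
  so eigenforms of the full Hecke algebra are included. No normalisation is imposed.\<close>

definition hecke_eigenform2 :: "nat \<Rightarrow> (complex \<Rightarrow> complex) \<Rightarrow> bool" where
  "hecke_eigenform2 N f \<longleftrightarrow>
     (\<exists>z\<in>upper_half_plane. f z \<noteq> 0) \<and>
     (\<forall>n\<ge>1. coprime n N \<longrightarrow> (\<exists>c. \<forall>z\<in>upper_half_plane. hecke_op2 n f z = c * f z))"


subsection \<open>Dirichlet characters\<close>

definition dirichlet_char :: "nat \<Rightarrow> (int \<Rightarrow> complex) \<Rightarrow> bool" where
  "dirichlet_char N chi \<longleftrightarrow>
     (\<forall>m n. chi (m * n) = chi m * chi n) \<and>
     (\<forall>n. chi (n + int N) = chi n) \<and>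
     (\<forall>n. chi n \<noteq> 0 \<longleftrightarrow> coprime n (int N))"

text \<open>Primitive: there is no proper divisor $M$ of $N$ such that $\chi(n) = 1$ for all $n$ coprime
  to $N$ with $n \equiv 1 \pmod M$.\<close>

definition primitive_dirichlet_char :: "nat \<Rightarrow> (int \<Rightarrow> complex) \<Rightarrow> bool" where
  "primitive_dirichlet_char N chi \<longleftrightarrow>
     dirichlet_char N chi \<and>
     (\<forall>M. M dvd N \<and> M < N \<longrightarrow>
        (\<exists>n. coprime n (int N) \<and> n mod int M = 1 mod int M \<and> chi n \<noteq> 1))"

definition conj_char :: "(int \<Rightarrow> complex) \<Rightarrow> int \<Rightarrow> complex" where
  "conj_char chi n = cnj (chi n)"

definition gauss_sum :: "nat \<Rightarrow> (int \<Rightarrow> complex) \<Rightarrow> complex" where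
  "gauss_sum N \<psi> = (\<Sum>k<N. \<psi> (int k) * exp (2 * of_real pi * \<i> * of_nat k / of_nat N))"

definition sigma_char :: "(int \<Rightarrow> complex) \<Rightarrow> complex \<Rightarrow> nat \<Rightarrow> complex" where
  "sigma_char chi t m = (\<Sum>d | d dvd m. chi (int d) * of_nat d powr t)"


subsection \<open>Dirichlet series and their continuation\<close>

text \<open>$L(\psi, s)$ by its series; it is only used in the region of absolute convergence.\<close>

definition L_char :: "nat \<Rightarrow> (int \<Rightarrow> complex) \<Rightarrow> complex \<Rightarrow> complex" where
  "L_char N \<psi> s = (\<Sum>\<^sub>\<infinity>n\<in>{n. n \<ge> 1 \<and> coprime n N}. \<psi> (int n) * of_nat n powr (- s))"

text \<open>The value at $t_0$ of the analytic continuation of $\sum_{n \in A} c(n) n^{-t}$: the series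
  converges on some right half-plane, and there agrees with a function that is holomorphic
  on a right half-plane containing $t_0$. The value is unique by the identity theorem.\<close>

definition continued_dirichlet_series :: "nat set \<Rightarrow> (nat \<Rightarrow> complex) \<Rightarrow> complex \<Rightarrow> complex" where
  "continued_dirichlet_series A c t0 =
     (THE v. \<exists>F \<alpha> \<beta>.
        \<alpha> < Re t0 \<and> F holomorphic_on {t. Re t > \<alpha>} \<and>
        (\<forall>t. Re t > \<beta> \<longrightarrow> ((\<lambda>n. c n * of_nat n powr (- t)) has_sum F t) A) \<and>
        v = F t0)"

definition L_form :: "(nat \<Rightarrow> complex) \<Rightarrow> complex \<Rightarrow> complex" where
  "L_form a s = continued_dirichlet_series {1..} a s"

definition L_form_twist :: "(nat \<Rightarrow> complex) \<Rightarrow> (int \<Rightarrow> complex) \<Rightarrow> complex \<Rightarrow> complex" where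
  "L_form_twist a chi s = continued_dirichlet_series {1..} (\<lambda>n. a n * chi (int n)) s"

text \<open>$L(n, \chi; s)$, the value at $t = 1$ of the continuation in $t$ of
  $\sum_{l \ge 1,\, m = l - n \ne 0} a(l)\, \sigma^\chi_{2s-1}(|m|)\, l^{-t}\, |m|^{1-2s}$.\<close>

definition L_shifted :: "(nat \<Rightarrow> complex) \<Rightarrow> int \<Rightarrow> (int \<Rightarrow> complex) \<Rightarrow> complex \<Rightarrow> complex" where
  "L_shifted a n chi s =
     continued_dirichlet_series {l. l \<ge> 1 \<and> int l - n \<noteq> 0}
       (\<lambda>l. let m = nat \<bar>int l - n\<bar>
            in a l * sigma_char chi (2 * s - 1) m / of_nat m powr (2 * s - 1)) 1"


subsection \<open>The Eisenstein series with modular symbols\<close>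

definition char_mat :: "(int \<Rightarrow> complex) \<Rightarrow> int ^ 2 ^ 2 \<Rightarrow> complex" where
  "char_mat chi \<gamma> = chi (\<gamma> $ 2 $ 2)"

text \<open>$\langle f, \gamma\rangle = \int_{i\infty}^{\gamma(i\infty)} f(w)\,dw$. If the lower left entry
  $c$ of $\gamma$ vanishes, then $\gamma(i\infty) = i\infty$; otherwise $\gamma(i\infty) = p/c$ with $p$ the
  upper left entry, and the path of integration is the vertical line $p/c + iy$ from $y = \infty$
  down to $y = 0$.\<close>

definition modular_symbol :: "(complex \<Rightarrow> complex) \<Rightarrow> int ^ 2 ^ 2 \<Rightarrow> complex" where
  "modular_symbol f \<gamma> =
     (if \<gamma> $ 2 $ 1 = 0 then 0
      else - (LINT y:{0<..}|lborel. f (of_int (\<gamma> $ 1 $ 1) / of_int (\<gamma> $ 2 $ 1) + \<i> * of_real y) * \<i>))"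

text \<open>A matrix fixes $\infty$ iff its lower left entry vanishes. In particular $-I$ belongs to
  the stabiliser.\<close>

definition Gamma_inf :: "nat \<Rightarrow> (int ^ 2 ^ 2) set" where
  "Gamma_inf N = {\<gamma>\<in>Gamma0 N. \<gamma> $ 2 $ 1 = 0}"

definition left_coset_rel :: "nat \<Rightarrow> ((int ^ 2 ^ 2) \<times> (int ^ 2 ^ 2)) set" where
  "left_coset_rel N = {(\<gamma>, \<delta>). \<gamma> \<in> Gamma0 N \<and> \<delta> \<in> Gamma0 N \<and> (\<exists>\<tau>\<in>Gamma_inf N. \<delta> = \<tau> ** \<gamma>)}"

text \<open>The summand depends only on the class of $\gamma$ in $\Gamma_\infty \backslash \Gamma$ (for a
  cusp form $f$ and $\chi(-1) = 1$), so the choice of representative is immaterial.\<close>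

definition eisenstein_star ::
    "nat \<Rightarrow> (complex \<Rightarrow> complex) \<Rightarrow> (int \<Rightarrow> complex) \<Rightarrow> complex \<Rightarrow> complex \<Rightarrow> complex" where
  "eisenstein_star N f chi z s =
     (\<Sum>\<^sub>\<infinity>C\<in>Gamma0 N // left_coset_rel N.
        let \<gamma> = (SOME \<gamma>. \<gamma> \<in> C)
        in cnj (char_mat chi \<gamma>) * modular_symbol f \<gamma> * of_real (Im (moebius_act \<gamma> z)) powr s)"


subsection \<open>Fourier expansion\<close>

text \<open>The modified Bessel function of the second kind
  $K_\nu(x) = \int_0^\infty e^{-x \cosh t} \cosh(\nu t)\,dt$ for $x > 0$.\<close>

definition bessel_K :: "complex \<Rightarrow> real \<Rightarrow> complex" where
  "bessel_K \<nu> x = (LINT t:{0<..}|lborel. of_real (exp (- x * cosh t)) * cosh (\<nu> * of_real t))"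

text \<open>The Whittaker function $W_s(nz) = 2 \sqrt{|n|y}\, K_{s-1/2}(2\pi|n|y)\, e^{2\pi i n x}$ at $z = x + iy$.
  The factor 2 is the usual normalisation, for which $W_1(nz) = e^{2\pi i n x - 2\pi |n| y}$. The source
  prints $\sqrt{|n|y}\, K_{s-1/2}(2\pi|n|y)\, e^{2\pi i n x}$; with the standard $K_\nu$ above, its formula
  for the coefficient of index $n \ne 0$ holds only with the factor 2.\<close>

definition whittaker_W :: "complex \<Rightarrow> int \<Rightarrow> complex \<Rightarrow> complex" where
  "whittaker_W s n z =
     2 * of_real (sqrt (real_of_int \<bar>n\<bar> * Im z)) * bessel_K (s - 1 / 2) (2 * pi * real_of_int \<bar>n\<bar> * Im z)
       * exp (2 * of_real pi * \<i> * of_int n * of_real (Re z))"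

text \<open>The pair $(\phi^*(s,\chi),\; n \mapsto \phi^*(n,s,\chi))$ of the Fourier expansion
  $E^*(z,s;\chi) = \phi^*(s,\chi) y^{1-s} + \sum_{n \ne 0} \phi^*(n,s,\chi) W_s(nz)$. As the latter
  involves only $n \ne 0$, the otherwise undetermined entry at $n = 0$ is set to 0.\<close>

definition is_fourier_expansion ::
    "nat \<Rightarrow> (complex \<Rightarrow> complex) \<Rightarrow> (int \<Rightarrow> complex) \<Rightarrow> complex \<Rightarrow> complex \<times> (int \<Rightarrow> complex) \<Rightarrow> bool" where
  "is_fourier_expansion N f chi s = (\<lambda>(\<phi>0, \<phi>). \<phi> 0 = 0 \<and>
     (\<forall>z\<in>upper_half_plane.
        ((\<lambda>n. \<phi> n * whittaker_W s n z) has_sum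
           (eisenstein_star N f chi z s - \<phi>0 * of_real (Im z) powr (1 - s))) {n. n \<noteq> 0}))"

definition phi_star_const ::
    "nat \<Rightarrow> (complex \<Rightarrow> complex) \<Rightarrow> (int \<Rightarrow> complex) \<Rightarrow> complex \<Rightarrow> complex" where
  "phi_star_const N f chi s = fst (THE p. is_fourier_expansion N f chi s p)"

definition phi_star ::
    "nat \<Rightarrow> (complex \<Rightarrow> complex) \<Rightarrow> (int \<Rightarrow> complex) \<Rightarrow> int \<Rightarrow> complex \<Rightarrow> complex" where
  "phi_star N f chi n s = snd (THE p. is_fourier_expansion N f chi s p) n"

end

theory Submission
  imports Defs "HOL-Probability.Probability" "HOL-Number_Theory.Cong"
begin

text \<open>Sort $\Gamma_\infty \backslash \Gamma$ by bottom rows $(c,d)$ and apply Poisson summation over the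
  translates $d + cm$. Since $N \mid c$, the cusp $-d/c$ is equivalent to
  $\infty$ under $\Gamma$, and the modular symbol becomes $i \int_0^\infty f(-d/c + iv)\,dv$. So the coefficient
  $\phi^*(n,s,\chi)$ is, up to Gamma factors, $\int_0^\infty \Psi_n(y)\,dy$ with
  $\Psi_n(y) = \sum_{c,d} c^{-2s} \overline{\chi}(d) e(nd/c) f(-d/c+iy)$, where $e(x) = e^{2\pi i x}$. Inserting the
  $q$-expansion of $f$ and evaluating the sums over $d$ by Gauss sums of $\chi$ gives
  $\Psi_n(y) = \sum_l b_n(l) e^{-2\pi l y}$, where $b_n(l)$ is a constant times the $l$-th
  coefficient of the series defining $L(n,\chi;s)$; the integral is the value at $t = 1$ of the Mellin transform that
  continues this series. For $n = 0$ the series is a Rankin convolution, which the Hecke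
  relations factor as $L(f \otimes \chi,t)\,L(f,t+2s-1)/L(\chi,2t+2s-2)$ for large $\mathrm{Re}(t)$,
  hence at $t = 1$ by continuation.\<close>

subsection \<open>Poisson summation\<close>

lemma has_sum_integral_nonfinite:
  fixes h :: "'i \<Rightarrow> 'a \<Rightarrow> complex"
  assumes "countable A" and inf: "infinite A"
    and int: "\<And>i. i \<in> A \<Longrightarrow> integrable M (h i)"
    and sm: "(\<lambda>i. LINT x|M. norm (h i x)) summable_on A"
    and pw: "\<And>x. x \<in> space M \<Longrightarrow> ((\<lambda>i. h i x) has_sum H x) A"
  shows "integrable M H" and "((\<lambda>i. LINT x|M. h i x) has_sum (LINT x|M. H x)) A"
proof -
  \<comment> \<open>Enumerating the infinite index set turns unordered sums into ordinary series,
    which can be integrated termwise; the unordered sum returns at the end because the series of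
    norms converges.\<close>
  define e where "e = from_nat_into A"
  have e: "bij_betw e UNIV A"
    unfolding e_def using assms(1) inf by (rule bij_betw_from_nat_into)
  have eA: "e n \<in> A" for n using e by (auto simp: bij_betw_def)
  have sm': "(\<lambda>n. LINT x|M. norm (h (e n) x)) summable_on UNIV"
    using sm summable_on_reindex_bij_betw[OF e, of "\<lambda>i. LINT x|M. norm (h i x)"] by simp
  have S: "summable (\<lambda>n. LINT x|M. norm (h (e n) x))"
    using sm' by (rule summable_on_imp_summable)
  have pw': "((\<lambda>n. h (e n) x) has_sum H x) UNIV" if "x \<in> space M" for x
    using pw[OF that] has_sum_reindex_bij_betw[OF e, of "\<lambda>i. h i x"] by simp
  have pwn: "summable (\<lambda>n. norm (h (e n) x))" if "x \<in> space M" for x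
    using pw'[OF that] by (intro summable_on_imp_summable)
      (metis summable_on_iff_abs_summable_on_complex summable_on_def)
  have sumH: "(\<Sum>n. h (e n) x) = H x" if "x \<in> space M" for x
    using has_sum_imp_sums[OF pw'[OF that]] by (simp add: sums_iff)
  have AE: "AE x in M. summable (\<lambda>n. norm (h (e n) x))" using pwn by auto
  have I: "integrable M (h (e n))" for n using int eA by auto
  have "integrable M (\<lambda>x. \<Sum>n. h (e n) x)" by (rule integrable_suminf[OF I AE S])
  then show "integrable M H" using sumH by (subst Bochner_Integration.integrable_cong[OF refl, of _ _ "\<lambda>x. \<Sum>n. h (e n) x"]) auto
  have "(\<lambda>n. LINT x|M. h (e n) x) sums (LINT x|M. (\<Sum>n. h (e n) x))" by (rule sums_integral[OF I AE S])
  also have "(LINT x|M. (\<Sum>n. h (e n) x)) = (LINT x|M. H x)"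
    using sumH by (intro Bochner_Integration.integral_cong) auto
  finally have s: "(\<lambda>n. LINT x|M. h (e n) x) sums (LINT x|M. H x)" .
  have "summable (\<lambda>n. norm (LINT x|M. h (e n) x))"
    by (rule summable_comparison_test[OF _ S]) (auto intro!: exI[of _ 0])
  from norm_summable_imp_has_sum[OF this s]
  show "((\<lambda>i. LINT x|M. h i x) has_sum (LINT x|M. H x)) A"
    using has_sum_reindex_bij_betw[OF e, of "\<lambda>i. LINT x|M. h i x"] by simp
qed

lemma has_sum_integral:
  fixes h :: "'i \<Rightarrow> 'a \<Rightarrow> complex"
  assumes "countable A"
    and int: "\<And>i. i \<in> A \<Longrightarrow> integrable M (h i)"
    and sm: "(\<lambda>i. LINT x|M. norm (h i x)) summable_on A"
    and pw: "\<And>x. x \<in> space M \<Longrightarrow> ((\<lambda>i. h i x) has_sum H x) A"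
  shows "integrable M H \<and> ((\<lambda>i. LINT x|M. h i x) has_sum (LINT x|M. H x)) A"
proof (cases "finite A")
  case True
  have H: "H x = (\<Sum>i\<in>A. h i x)" if "x \<in> space M" for x
    using pw[OF that] True by (metis has_sum_finiteI has_sum_unique)
  have 1: "integrable M (\<lambda>x. \<Sum>i\<in>A. h i x)" using int by auto
  have "(LINT x|M. H x) = (LINT x|M. (\<Sum>i\<in>A. h i x))"
    using H by (intro Bochner_Integration.integral_cong) auto
  also have "\<dots> = (\<Sum>i\<in>A. LINT x|M. h i x)" using int by (intro Bochner_Integration.integral_sum) auto
  finally have 2: "(LINT x|M. H x) = (\<Sum>i\<in>A. LINT x|M. h i x)" .
  have 3: "integrable M H" using 1 by (subst Bochner_Integration.integrable_cong[OF refl H]) auto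
  show ?thesis using 3 2 True by (auto intro!: has_sum_finiteI)
next
  case False
  from has_sum_integral_nonfinite[OF assms(1) False int sm pw] show ?thesis by auto
qed

text \<open>The form in which sums over cusps, translates, frequencies and q-coefficients are
  interchanged with integrals. Pointwise convergence is demanded only on \<open>S\<close>, since off
  \<open>S\<close> the indicator kills every term.\<close>

lemma set_integral_has_sum:
  fixes h :: "'i \<Rightarrow> 'a \<Rightarrow> complex"
  assumes "countable A"
    and "\<And>i. i \<in> A \<Longrightarrow> set_integrable M S (h i)"
    and "(\<lambda>i. LINT x:S|M. norm (h i x)) summable_on A"
    and pw: "\<And>x. x \<in> S \<Longrightarrow> ((\<lambda>i. h i x) has_sum H x) A"
  shows "set_integrable M S H" and "((\<lambda>i. LINT x:S|M. h i x) has_sum (LINT x:S|M. H x)) A"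
proof -
  have "integrable M (\<lambda>x. indicat_real S x *\<^sub>R H x) \<and>
    ((\<lambda>i. LINT x|M. indicat_real S x *\<^sub>R h i x) has_sum (LINT x|M. indicat_real S x *\<^sub>R H x)) A"
  proof (rule has_sum_integral[OF assms(1)])
    show "integrable M (\<lambda>x. indicat_real S x *\<^sub>R h i x)" if "i \<in> A" for i
      using assms(2)[OF that] by (simp add: set_integrable_def)
    show "(\<lambda>i. LINT x|M. norm (indicat_real S x *\<^sub>R h i x)) summable_on A"
      using assms(3) by (simp add: set_lebesgue_integral_def)
    show "((\<lambda>i. indicat_real S x *\<^sub>R h i x) has_sum indicat_real S x *\<^sub>R H x) A" for x
      using pw[of x] by (cases "x \<in> S") auto
  qed
  then show "set_integrable M S H" "((\<lambda>i. LINT x:S|M. h i x) has_sum (LINT x:S|M. H x)) A"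
    by (auto simp: set_integrable_def set_lebesgue_integral_def)
qed

section \<open>Fourier series on the unit interval\<close>

definition ee :: "real \<Rightarrow> complex" where "ee x = cis (2 * pi * x)"

lemma ee_add: "ee (x + y) = ee x * ee y" by (simp add: ee_def cis_mult ring_distribs)
lemma ee_0 [simp]: "ee 0 = 1" by (simp add: ee_def)
lemma ee_minus: "ee (- x) = cnj (ee x)" by (simp add: ee_def cis_cnj)
lemma norm_ee [simp]: "norm (ee x) = 1" by (simp add: ee_def)
lemma ee_nonzero [simp]: "ee x \<noteq> 0" using norm_ee[of x] by fastforce
lemma ee_of_int [simp]: "ee (of_int n) = 1"
  unfolding ee_def using cis_multiple_2pi[of "real_of_int n"] by simp
lemma ee_add_int [simp]: "ee (x + of_int n) = ee x" by (simp add: ee_add)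
lemma continuous_on_ee [continuous_intros]: "continuous_on A g \<Longrightarrow> continuous_on A (\<lambda>x. ee (g x))"
  unfolding ee_def by (intro continuous_intros)
lemma borel_measurable_ee [measurable]: "ee \<in> borel_measurable borel"
  by (intro borel_measurable_continuous_onI continuous_on_ee continuous_intros)
lemma borel_measurable_cnj [measurable (raw)]:
  "f \<in> borel_measurable M \<Longrightarrow> (\<lambda>x. cnj (f x)) \<in> borel_measurable M"
  by (rule measurable_compose[OF _ borel_measurable_continuous_onI[of cnj]]) (auto intro!: continuous_intros)
lemma ee_exp: "ee x = exp (2 * of_real pi * \<i> * of_real x)"
  by (simp add: ee_def cis_conv_exp mult_ac)

lemma ee_eq_1_iff: "ee x = 1 \<longleftrightarrow> x \<in> \<int>"
proof
  assume "ee x = 1"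
  then have "cos (2 * pi * x) = 1" by (simp add: ee_def complex_eq_iff)
  then obtain n :: int where "2 * pi * x = of_int n * 2 * pi"
    using cos_one_2pi_int by auto
  then have "x = of_int n" by simp
  then show "x \<in> \<int>" by simp
qed (auto elim!: Ints_cases)

lemma unit_interval_ee_integral:
  "(LINT x:{0..<1}|lborel. ee (of_int k * x)) = (if k = 0 then 1 else 0)"
proof (cases "k = 0")
  case False
  \<comment> \<open>The half-open interval is the one whose translates tile the line, while the
    fundamental theorem of calculus is applied on the closed one; they differ by the null set
    {1}.\<close>
  have 1: "(LINT x:{0..<1}|lborel. ee (of_int k * x)) = (LINT x:{0..1}|lborel. ee (of_int k * x))"
    unfolding set_lebesgue_integral_def
    by (intro integral_cong_AE) (auto intro!: AE_I'[of "{1}"] simp: indicator_def split: if_splits)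
  let ?F = "\<lambda>x. ee (of_int k * x) / (2 * of_real pi * \<i> * of_int k)"
  have "(LINT x:{0..1}|lborel. ee (of_int k * x)) = ?F 1 - ?F 0"
    unfolding set_lebesgue_integral_def
  proof (rule integral_FTC_atLeastAtMost)
    show "(?F has_vector_derivative ee (real_of_int k * x)) (at x within {0..1})" for x
      unfolding ee_exp
      by (rule derivative_eq_intros has_vector_derivative_real_field | use False in simp)+
    show "continuous_on {0..1} (\<lambda>x. ee (real_of_int k * x))" by (intro continuous_intros)
  qed simp
  also have "\<dots> = 0" using ee_of_int[of k] by simp
  finally show ?thesis using 1 False by simp
qed (simp add: set_lebesgue_integral_def)

lemma set_integrable_unit_interval:
  fixes h :: "real \<Rightarrow> complex"
  assumes [measurable]: "h \<in> borel_measurable borel" and "\<And>x. norm (h x) \<le> B"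
  shows "set_integrable lborel {0..<1} h"
  unfolding set_integrable_def
proof (rule Bochner_Integration.integrable_bound)
  show "integrable lborel (\<lambda>x::real. indicat_real {0..<1} x * B)"
    by (intro integrable_mult_left integrable_real_indicator) (simp_all add: ennreal_less_top)
  have "B \<ge> 0" using assms(2)[of 0] norm_ge_zero order_trans by blast
  then show "AE x in lborel. norm (indicat_real {0..<1} x *\<^sub>R h x) \<le> norm (indicat_real {0..<1} x * B)"
    using assms(2) by (auto simp: indicator_def)
qed simp

text \<open>With P the partial Fourier sum over \<open>K\<close>, the integrals of h cnj(P) and of P
  cnj(P) both equal the sum of the |c n|^2. Expanding the nonnegative integral of |h - P|^2 bounds
  that sum by the integral of |h|^2, hence by \<open>B\<^sup>2\<close>.\<close>

lemma bessel_inequality: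
  fixes h :: "real \<Rightarrow> complex"
  assumes [measurable]: "h \<in> borel_measurable borel" and B: "\<And>x. norm (h x) \<le> B"
    and c: "\<And>n::int. c n = (LINT x:{0..<1}|lborel. h x * ee (- (of_int n * x)))" and K: "finite K"
  shows "(\<Sum>n\<in>K. (norm (c n))\<^sup>2) \<le> B\<^sup>2"
proof -
  have B0: "B \<ge> 0" using assms(2)[of 0] norm_ge_zero order_trans by blast
  define P where "P x = (\<Sum>n\<in>K. c n * ee (of_int n * x))" for x
  have [measurable]: "P \<in> borel_measurable borel" unfolding P_def by measurable
  have PB: "norm (P x) \<le> (\<Sum>n\<in>K. norm (c n))" for x
    unfolding P_def by (rule order_trans[OF norm_sum]) (simp add: norm_mult)
  define D where "D = (\<Sum>n\<in>K. norm (c n))"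
  have D: "norm (P x) \<le> D" for x using PB D_def by auto
  have D0: "D \<ge> 0" unfolding D_def by (simp add: sum_nonneg)
  have cnjP: "cnj (P x) = (\<Sum>n\<in>K. cnj (c n) * ee (- (of_int n * x)))" for x
    by (simp add: P_def ee_minus)
  have I1: "(LINT x:{0..<1}|lborel. h x * cnj (P x)) = of_real (\<Sum>n\<in>K. (norm (c n))\<^sup>2)"
  proof -
    have "(LINT x:{0..<1}|lborel. h x * cnj (P x)) =
      (LINT x:{0..<1}|lborel. (\<Sum>n\<in>K. cnj (c n) * (h x * ee (- (of_int n * x)))))"
      by (simp add: cnjP sum_distrib_left mult_ac)
    also have "\<dots> = (\<Sum>n\<in>K. LINT x:{0..<1}|lborel. cnj (c n) * (h x * ee (- (of_int n * x))))"
      unfolding set_lebesgue_integral_def scaleR_sum_right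
    proof (rule Bochner_Integration.integral_sum)
      fix n assume "n \<in> K"
      show "integrable lborel (\<lambda>x. indicat_real {0..<1} x *\<^sub>R (cnj (c n) * (h x * ee (- (of_int n * x)))))"
        using set_integrable_unit_interval[of "\<lambda>x. cnj (c n) * (h x * ee (- (of_int n * x)))" "norm (c n) * B"]
        by (simp add: set_integrable_def norm_mult mult_left_mono B)
    qed
    also have "\<dots> = (\<Sum>n\<in>K. cnj (c n) * c n)" by (simp add: c)
    also have "\<dots> = of_real (\<Sum>n\<in>K. (norm (c n))\<^sup>2)"
      by (simp only: of_real_sum complex_norm_square mult.commute)
    finally show ?thesis .
  qed
  have I2: "(LINT x:{0..<1}|lborel. P x * cnj (P x)) = of_real (\<Sum>n\<in>K. (norm (c n))\<^sup>2)"
  proof -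
    have e: "c n * ee (of_int n * x) * (cnj (c m) * ee (- (of_int m * x))) = c n * cnj (c m) * ee (of_int (n - m) * x)" for n m x
    proof -
      have "ee (of_int (n - m) * x) = ee (of_int n * x) * ee (- (of_int m * x))"
        by (simp add: ee_add[symmetric] algebra_simps)
      then show ?thesis by simp
    qed
    have "(LINT x:{0..<1}|lborel. P x * cnj (P x)) =
      (LINT x:{0..<1}|lborel. (\<Sum>n\<in>K. \<Sum>m\<in>K. c n * cnj (c m) * ee (of_int (n - m) * x)))"
      unfolding cnjP unfolding P_def sum_product e ..
    also have "\<dots> = (\<Sum>n\<in>K. \<Sum>m\<in>K. LINT x:{0..<1}|lborel. c n * cnj (c m) * ee (of_int (n - m) * x))"
    proof -
      have i: "set_integrable lborel {0..<1} (\<lambda>x. c n * cnj (c m) * ee (of_int (n - m) * x))" for n m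
        by (rule set_integrable_unit_interval[where B="norm (c n * cnj (c m))"]) (simp_all add: norm_mult)
      then show ?thesis
        unfolding set_lebesgue_integral_def set_integrable_def scaleR_sum_right
        by (subst Bochner_Integration.integral_sum) (auto intro!: Bochner_Integration.integrable_sum)
    qed
    also have "\<dots> = (\<Sum>n\<in>K. \<Sum>m\<in>K. c n * cnj (c m) * (if n = m then 1 else 0))"
      by (simp only: set_integral_mult_right unit_interval_ee_integral) simp
    also have "\<dots> = (\<Sum>n\<in>K. c n * cnj (c n))" using K by (simp add: if_distrib sum.delta cong: if_cong)
    also have "\<dots> = of_real (\<Sum>n\<in>K. (norm (c n))\<^sup>2)"
      by (simp only: of_real_sum complex_norm_square)
    finally show ?thesis .
  qed
  have n: "(norm (h x - P x))\<^sup>2 = (norm (h x))\<^sup>2 - 2 * Re (h x * cnj (P x)) + Re (P x * cnj (P x))" for x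
    by (simp only: cmod_power2) (simp add: power2_eq_square algebra_simps)
  have i1: "set_integrable lborel {0..<1} (\<lambda>x. h x * cnj (P x))"
    by (rule set_integrable_unit_interval[where B="B * D"]) (auto simp: norm_mult intro!: mult_mono B D B0)
  have i2: "set_integrable lborel {0..<1} (\<lambda>x. P x * cnj (P x))"
    by (rule set_integrable_unit_interval[where B="D * D"]) (auto simp: norm_mult intro!: mult_mono D D0)
  have i3: "set_integrable lborel {0..<1} (\<lambda>x. complex_of_real ((norm (h x))\<^sup>2))"
    by (rule set_integrable_unit_interval[where B="B\<^sup>2"]) (auto simp: norm_power intro!: power_mono B)
  have i3': "set_integrable lborel {0..<1} (\<lambda>x. (norm (h x))\<^sup>2)"
  proof -
    have "integrable lborel (\<lambda>x. complex_of_real (indicat_real {0..<1} x * (norm (h x))\<^sup>2))"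
      using i3 by (simp add: set_integrable_def scaleR_conv_of_real)
    then show ?thesis
      unfolding set_integrable_def complex_of_real_integrable_eq by simp
  qed
  have r: "(LINT x:{0..<1}|lborel. Re (F x)) = Re (LINT x:{0..<1}|lborel. F x)"
       "set_integrable lborel {0..<1} (\<lambda>x. Re (F x))"
    if "set_integrable lborel {0..<1} F" for F
  proof -
    show "(LINT x:{0..<1}|lborel. Re (F x)) = Re (LINT x:{0..<1}|lborel. F x)"
      using that integral_Re[of lborel "\<lambda>x. indicat_real {0..<1} x *\<^sub>R F x"]
      unfolding set_integrable_def set_lebesgue_integral_def by simp
    show "set_integrable lborel {0..<1} (\<lambda>x. Re (F x))"
      using that integrable_Re[of lborel "\<lambda>x. indicat_real {0..<1} x *\<^sub>R F x"]
      unfolding set_integrable_def by simp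
  qed
  have "0 \<le> (LINT x:{0..<1}|lborel. (norm (h x - P x))\<^sup>2)"
    unfolding set_lebesgue_integral_def by (intro integral_nonneg_AE) auto
  also have "\<dots> = (LINT x:{0..<1}|lborel. (norm (h x))\<^sup>2) - (LINT x:{0..<1}|lborel. 2 * Re (h x * cnj (P x)))
     + (LINT x:{0..<1}|lborel. Re (P x * cnj (P x)))"
  proof -
    have "(LINT x:{0..<1}|lborel. F x - G x + H x) =
        (LINT x:{0..<1}|lborel. F x) - (LINT x:{0..<1}|lborel. G x) + (LINT x:{0..<1}|lborel. H x)"
      if "set_integrable lborel {0..<1} F" "set_integrable lborel {0..<1} G" "set_integrable lborel {0..<1} H"
      for F G H :: "real \<Rightarrow> real"
      using that by (simp add: set_integral_add set_integral_diff)
    from this[OF i3' set_integrable_mult_right[OF r(2)[OF i1]] r(2)[OF i2]]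
    show ?thesis unfolding n by blast
  qed
  also have "\<dots> = (LINT x:{0..<1}|lborel. (norm (h x))\<^sup>2) - (\<Sum>n\<in>K. (norm (c n))\<^sup>2)"
    unfolding set_integral_mult_right r(1)[OF i1] r(1)[OF i2] I1 I2 by simp
  finally have "(\<Sum>n\<in>K. (norm (c n))\<^sup>2) \<le> (LINT x:{0..<1}|lborel. (norm (h x))\<^sup>2)" by simp
  also have "\<dots> \<le> (LINT x:{0..<1::real}|lborel. B\<^sup>2)"
    by (rule set_integral_mono[OF i3']) (auto intro!: power_mono B simp: set_integrable_def)
  also have "\<dots> = B\<^sup>2" by (simp add: set_lebesgue_integral_def)
  finally show ?thesis .
qed

text \<open>A Riemann-Lebesgue statement: by Bessel's inequality the squares |c n|^2 are summable
  along any injective sequence of indices. The two sequences chosen are the boundary indices of the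
  telescoping sum in \<open>fourier_inversion\<close>.\<close>

lemma fourier_coeff_tendsto_0:
  fixes h :: "real \<Rightarrow> complex"
  assumes [measurable]: "h \<in> borel_measurable borel" and B: "\<And>x. norm (h x) \<le> B"
    and c: "\<And>n::int. c n = (LINT x:{0..<1}|lborel. h x * ee (- (of_int n * x)))"
  shows "(\<lambda>M::nat. c (int M)) \<longlonglongrightarrow> 0" "(\<lambda>M::nat. c (- int M - 1)) \<longlonglongrightarrow> 0"
proof -
  have *: "(\<lambda>M::nat. c (g M)) \<longlonglongrightarrow> 0" if "inj g" for g
  proof -
    have "summable (\<lambda>M. (norm (c (g M)))\<^sup>2)"
    proof (rule summableI_nonneg_bounded)
      show "(\<Sum>i<n. (cmod (c (g i)))\<^sup>2) \<le> B\<^sup>2" for n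
      proof -
        have "(\<Sum>i<n. (cmod (c (g i)))\<^sup>2) = (\<Sum>k\<in>g ` {..<n}. (cmod (c k))\<^sup>2)"
          using that by (subst sum.reindex) (auto simp: inj_def inj_on_def)
        with bessel_inequality[OF assms, of "g ` {..<n}"] show ?thesis by simp
      qed
    qed simp
    then have "(\<lambda>M. (norm (c (g M)))\<^sup>2) \<longlonglongrightarrow> 0" by (rule summable_LIMSEQ_zero)
    then have "(\<lambda>M. sqrt ((norm (c (g M)))\<^sup>2)) \<longlonglongrightarrow> sqrt 0" by (rule tendsto_real_sqrt)
    then show ?thesis by (simp add: tendsto_norm_zero_iff)
  qed
  show "(\<lambda>M::nat. c (int M)) \<longlonglongrightarrow> 0" by (rule *) (auto simp: inj_def)
  show "(\<lambda>M::nat. c (- int M - 1)) \<longlonglongrightarrow> 0" by (rule *) (auto simp: inj_def)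
qed

text \<open>|e(u) - 1| = 2 |sin(pi u)|, and concavity of the sine on [0, pi], compared with the
  chord from 0 to pi/2, gives sin(pi v) \<ge> 2v for 0 \<le> v \<le> 1/2.\<close>

lemma ee_minus_1_lower:
  assumes "\<bar>u\<bar> \<le> 1 / 2"
  shows "norm (ee u - 1) \<ge> 4 * \<bar>u\<bar>"
proof -
  have *: "sin (pi * v) \<ge> 2 * v" if "0 \<le> v" "v \<le> 1 / 2" for v :: real
  proof -
    have "convex_on {0..pi} (\<lambda>x. - sin x)"
    proof (rule f''_ge0_imp_convex)
      show "((\<lambda>x. - sin x) has_real_derivative - cos x) (at x)" for x
        by (auto intro!: derivative_eq_intros)
      show "((\<lambda>x. - cos x) has_real_derivative sin x) (at x)" for x
        by (auto intro!: derivative_eq_intros)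
    qed (auto intro: sin_ge_zero)
    from convex_onD[OF this, of "2 * v" 0 "pi / 2"] that show ?thesis by (simp add: mult_ac)
  qed
  have "(norm (ee u - 1))\<^sup>2 = (cos (2 * pi * u) - 1)\<^sup>2 + (sin (2 * pi * u))\<^sup>2"
    by (simp add: ee_def cmod_power2)
  also have "\<dots> = 2 - 2 * cos (2 * (pi * u))"
    using sin_cos_squared_add[of "2 * pi * u"] by (simp add: power2_eq_square algebra_simps)
  also have "\<dots> = (2 * sin (pi * u))\<^sup>2"
    by (subst cos_double_sin) (simp add: power2_eq_square algebra_simps)
  finally have 1: "norm (ee u - 1) = \<bar>2 * sin (pi * u)\<bar>"
    using power2_eq_imp_eq[of "norm (ee u - 1)" "\<bar>2 * sin (pi * u)\<bar>"] by simp
  show ?thesis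
  proof (cases "u \<ge> 0")
    case True
    with *[of u] assms 1 show ?thesis by simp
  next
    case False
    with *[of "-u"] assms 1 show ?thesis by simp
  qed
qed

text \<open>Dividing g - g(x0) by e(t - x0) - 1 leaves a bounded function h, by the Lipschitz
  condition at x0. Multiplication by e(t - x0) - 1 is a difference operator on Fourier coefficients,
  so the partial sums of g at x0 telescope to g(x0) plus two coefficients of h, which tend to
  0.\<close>

lemma fourier_inversion:
  fixes g :: "real \<Rightarrow> complex"
  assumes [measurable]: "g \<in> borel_measurable borel" and B: "\<And>x. norm (g x) \<le> B"
    and per: "\<And>x m::int. g (x + of_int m) = g x"
    and lip: "\<And>u. \<bar>u\<bar> \<le> 1 / 2 \<Longrightarrow> norm (g (x0 + u) - g x0) \<le> C * \<bar>u\<bar>"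
    and c: "\<And>n::int. c n = (LINT x:{0..<1}|lborel. g x * ee (- (of_int n * x)))"
    and sm: "c summable_on UNIV"
  shows "((\<lambda>n. c n * ee (of_int n * x0)) has_sum g x0) UNIV"
proof -
  \<comment> \<open>At the points of x0 + Z the denominator is 0 and h takes the value 0 there, so h
    is bounded everywhere.\<close>
  define h where "h t = (g t - g x0) / (ee (t - x0) - 1)" for t
  have [measurable]: "h \<in> borel_measurable borel" unfolding h_def by measurable
  have hB: "norm (h t) \<le> C / 4 + 0" for t
  proof -
    define m where "m = round (t - x0)"
    define u where "u = t - x0 - of_int m"
    have u: "\<bar>u\<bar> \<le> 1 / 2" unfolding u_def m_def using of_int_round_abs_le[of "t - x0"] by (simp add: abs_minus_commute)
    have t: "t = (x0 + u) + of_int m" by (simp add: u_def)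
    have "t - x0 = u + of_int m" by (simp add: u_def)
    then have e: "ee (t - x0) = ee u" by simp
    have g: "g t = g (x0 + u)" by (subst t) (rule per)
    have C0: "C \<ge> 0" using order_trans[OF norm_ge_zero lip[of "1/2"]] by simp
    show ?thesis
    proof (cases "u = 0")
      case True
      then show ?thesis using C0 by (simp add: h_def e)
    next
      case False
      have "norm (h t) = norm (g (x0 + u) - g x0) / norm (ee u - 1)" by (simp add: h_def e g norm_divide)
      also have "\<dots> \<le> (C * \<bar>u\<bar>) / (4 * \<bar>u\<bar>)"
        using lip[OF u] ee_minus_1_lower[OF u] False C0 by (intro frac_le) auto
      finally show ?thesis using False by simp
    qed
  qed
  have gh: "g t = g x0 + (ee (t - x0) - 1) * h t" for t
  proof (cases "ee (t - x0) = 1")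
    case True
    then obtain m :: int where "t - x0 = of_int m" by (auto simp: ee_eq_1_iff elim: Ints_cases)
    then have "t = x0 + of_int m" by simp
    then have "g t = g x0" using per by simp
    with True show ?thesis by simp
  qed (simp add: h_def)
  define d where "d n = (LINT x:{0..<1}|lborel. h x * ee (- (of_int n * x)))" for n :: int
  have hi: "set_integrable lborel {0..<1} (\<lambda>x. h x * ee (- (of_int n * x)))" for n :: int
    by (rule set_integrable_unit_interval[where B="C/4"]) (use hB in \<open>auto simp: norm_mult\<close>)
  have ei: "set_integrable lborel {0..<1} (\<lambda>x. ee (- (of_int n * x)))" for n :: int
    by (rule set_integrable_unit_interval[where B=1]) auto
  \<comment> \<open>The factor e(x - x0) moves the frequency n to n - 1 and leaves the constant
    e(-x0); after the twist by e(n x0) in \<open>D\<close> the bracket becomes D(n - 1) -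
    D(n).\<close>
  have cd: "c n = g x0 * (if n = 0 then 1 else 0) + (ee (- x0) * d (n - 1) - d n)" for n
  proof -
    have e: "g x * ee (- (of_int n * x)) = g x0 * ee (- (of_int n * x)) +
       (ee (- x0) * (h x * ee (- (of_int (n - 1) * x))) - h x * ee (- (of_int n * x)))" for x
    proof -
      have "ee (x - x0) * ee (- (of_int n * x)) = ee (- x0) * ee (- (of_int (n - 1) * x))"
        by (simp add: ee_add[symmetric] algebra_simps)
      then show ?thesis by (subst gh) (simp add: algebra_simps)
    qed
    have "(LINT x:{0..<1}|lborel. F x + (G x - H x)) =
        (LINT x:{0..<1}|lborel. F x) + ((LINT x:{0..<1}|lborel. G x) - (LINT x:{0..<1}|lborel. H x))"
      if "set_integrable lborel {0..<1} F" "set_integrable lborel {0..<1} G" "set_integrable lborel {0..<1} H"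
      for F G H :: "real \<Rightarrow> complex"
      using that by (simp add: set_integral_add set_integral_diff)
    from this[OF set_integrable_mult_right[OF ei[of n]] set_integrable_mult_right[OF hi[of "n - 1"]] hi[of n]]
    have "c n = g x0 * (LINT x:{0..<1}|lborel. ee (- (of_int n * x))) + (ee (- x0) * d (n - 1) - d n)"
      unfolding c e d_def set_integral_mult_right by blast
    then show ?thesis using unit_interval_ee_integral[of "-n"] by simp
  qed
  define D where "D n = ee (of_int n * x0) * d n" for n :: int
  have cD: "c n * ee (of_int n * x0) = g x0 * (if n = 0 then 1 else 0) + (D (n - 1) - D n)" for n
  proof -
    have "ee (- x0) * ee (of_int n * x0) = ee (of_int (n - 1) * x0)"
      by (simp add: ee_add[symmetric] algebra_simps)
    then show ?thesis unfolding cd D_def by (auto simp add: algebra_simps)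
  qed
  have tel: "(\<Sum>n\<in>{- int M..int M}. c n * ee (of_int n * x0)) = g x0 + (D (- int M - 1) - D (int M))" for M
  proof (induction M)
    case (Suc M)
    have "{- int (Suc M)..int (Suc M)} = insert (- int (Suc M)) (insert (int (Suc M)) {- int M..int M})" by auto
    moreover have "D (- int M - 1) = D (- 1 - int M)" by (rule arg_cong[of _ _ D]) simp
    ultimately show ?case using Suc by (simp add: cD)
  qed (use cD[of 0] in simp)
  have "(\<lambda>n. c n * ee (of_int n * x0)) summable_on UNIV"
  proof -
    have "(\<lambda>n. norm (c n * ee (of_int n * x0))) summable_on UNIV"
      using sm by (simp add: norm_mult summable_on_iff_abs_summable_on_complex)
    then show ?thesis by (simp only: summable_on_iff_abs_summable_on_complex)
  qed
  then obtain S where S: "((\<lambda>n. c n * ee (of_int n * x0)) has_sum S) UNIV" by (auto simp: summable_on_def)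
  \<comment> \<open>The symmetric intervals are cofinal among finite sets of integers, so the
    unconditional sum, known to exist, equals the limit of the telescoped symmetric sums.\<close>
  have fl: "filterlim (\<lambda>M. {- int M..int M}) (finite_subsets_at_top UNIV) sequentially"
    unfolding filterlim_finite_subsets_at_top
  proof safe
    fix X :: "int set" assume "finite X"
    then obtain b where b: "\<And>x. x \<in> X \<Longrightarrow> \<bar>x\<bar> \<le> b"
      by (meson infinite_int_iff_unbounded_le linorder_le_cases)
    show "\<forall>\<^sub>F M in sequentially. finite {- int M..int M} \<and> X \<subseteq> {- int M..int M} \<and> {- int M..int M} \<subseteq> UNIV"
      using eventually_ge_at_top[of "nat b"] by eventually_elim (use b in fastforce)
  qed
  from filterlim_compose[OF S[unfolded has_sum_def] fl]
  have "(\<lambda>M. g x0 + (D (- int M - 1) - D (int M))) \<longlonglongrightarrow> S" by (simp only: tel)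
  moreover have "(\<lambda>M. g x0 + (D (- int M - 1) - D (int M))) \<longlonglongrightarrow> g x0 + (0 - 0)"
  proof (intro tendsto_intros)
    have "(\<lambda>M. d (int M)) \<longlonglongrightarrow> 0" "(\<lambda>M. d (- int M - 1)) \<longlonglongrightarrow> 0"
      using fourier_coeff_tendsto_0[of h "C / 4" d] hB d_def by auto
    from this[THEN tendsto_norm]
    show "(\<lambda>M. D (- int M - 1)) \<longlonglongrightarrow> 0" "(\<lambda>M. D (int M)) \<longlonglongrightarrow> 0"
      by (subst tendsto_norm_zero_iff[symmetric]; simp add: D_def norm_mult)+
  qed
  ultimately have "S = g x0" using LIMSEQ_unique by fastforce
  with S show ?thesis by simp
qed

section \<open>Periodisation over integer translates\<close>

lemma summable_on_int_inverse_square: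
  "(\<lambda>m::int. 1 / (1 + (of_int m)\<^sup>2) :: real) summable_on UNIV"
proof -
  have 1: "(\<lambda>n::nat. 1 / (1 + (of_nat n)\<^sup>2) :: real) summable_on UNIV"
  proof -
    have "summable (\<lambda>n::nat. 1 / (1 + (of_nat n)\<^sup>2) :: real)"
    proof (rule summable_comparison_test[OF _ inverse_power_summable[of 2]])
      show "\<exists>N. \<forall>n\<ge>N. norm (1 / (1 + (real n)\<^sup>2)) \<le> inverse (real n ^ 2)"
        by (intro exI[of _ 1]) (auto simp: inverse_eq_divide intro!: divide_left_mono add_pos_nonneg mult_pos_pos)
    qed simp
    then show ?thesis by (subst summable_on_UNIV_nonneg_real_iff) auto
  qed
  have 2: "(\<lambda>m::int. 1 / (1 + (of_int m)\<^sup>2) :: real) summable_on range int"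
    by (subst summable_on_reindex) (use 1 in \<open>auto simp: o_def\<close>)
  have 3: "(\<lambda>m::int. 1 / (1 + (of_int m)\<^sup>2) :: real) summable_on range (\<lambda>n. - int n)"
    by (subst summable_on_reindex) (use 1 in \<open>auto simp: o_def inj_def\<close>)
  have "range int \<union> range (\<lambda>n. - int n) = UNIV"
    by (auto simp: image_iff) (metis int_cases2)
  with summable_on_union[OF 2 3] show ?thesis by simp
qed

lemma has_sum_diff:
  fixes f g :: "'i \<Rightarrow> 'a::real_normed_vector"
  assumes "(f has_sum a) A" "(g has_sum b) A"
  shows "((\<lambda>i. f i - g i) has_sum (a - b)) A"
  using has_sum_add[OF assms(1), of "\<lambda>i. - g i" "- b"] assms(2) by (simp add: has_sum_uminus)

lemma summable_on_int_shift_inverse_square: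
  "(\<lambda>m::int. 1 / (1 + (x + of_int m)\<^sup>2) :: real) summable_on UNIV"
proof (rule summable_on_comparison_test)
  show "(\<lambda>m::int. (2 + 2 * x\<^sup>2) * (1 / (1 + (of_int m)\<^sup>2)) :: real) summable_on UNIV"
    by (intro summable_on_cmult_right summable_on_int_inverse_square)
  show "1 / (1 + (x + of_int m)\<^sup>2) \<le> (2 + 2 * x\<^sup>2) * (1 / (1 + (of_int m)\<^sup>2))" for m :: int
  proof -
    define k where "k = real_of_int m"
    \<comment> \<open>The square (2x + k)^2 is exactly the difference 2(x + k)^2 + 2x^2 -
      k^2.\<close>
    have "0 \<le> (2 * x + k)\<^sup>2" by simp
    then have "k\<^sup>2 \<le> 2 * (x + k)\<^sup>2 + 2 * x\<^sup>2"
      by (simp add: power2_eq_square algebra_simps)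
    moreover have "0 \<le> x\<^sup>2 * (x + k)\<^sup>2" by simp
    moreover have "(2 + 2 * x\<^sup>2) * (1 + (x + k)\<^sup>2) = 2 + 2 * (x + k)\<^sup>2 + 2 * x\<^sup>2 + 2 * (x\<^sup>2 * (x + k)\<^sup>2)"
      by (simp only: distrib_left distrib_right mult_1_right)
    ultimately have "1 + k\<^sup>2 \<le> (2 + 2 * x\<^sup>2) * (1 + (x + k)\<^sup>2)" by linarith
    then show ?thesis
      unfolding k_def[symmetric] by (simp add: divide_simps add_pos_nonneg mult.commute)
  qed
qed auto

text \<open>The intervals [m, m + 1) tile the line, so at each point exactly one indicator is
  nonzero; integrability of g bounds every finite sum of the integrals of norms and so permits
  termwise integration.\<close>

lemma tiling_has_sum:
  fixes g :: "real \<Rightarrow> complex"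
  assumes g: "integrable lborel g"
  shows "((\<lambda>m::int. LINT x:{0..<1}|lborel. g (x + of_int m)) has_sum (LINT x|lborel. g x)) UNIV"
proof -
  let ?I = "\<lambda>m::int. {real_of_int m..<real_of_int m + 1}"
  have cov: "\<exists>!m::int. x \<in> ?I m" for x :: real
  proof (intro ex1I[of _ "\<lfloor>x\<rfloor>"])
    show "m = \<lfloor>x\<rfloor>" if "x \<in> ?I m" for m using that by (metis atLeastLessThan_iff floor_unique)
  qed (auto simp: floor_le_iff)
  have hs: "((\<lambda>m. indicat_real (?I m) x *\<^sub>R G x) has_sum G x) UNIV" for G :: "real \<Rightarrow> complex" and x
  proof (rule has_sum_cong_neutral[THEN iffD2])
    show "((\<lambda>m. indicat_real (?I m) x *\<^sub>R G x) has_sum G x) {\<lfloor>x\<rfloor>}"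
      by (rule has_sum_finiteI) (auto simp: indicator_def floor_le_iff)
    show "indicat_real (?I m) x *\<^sub>R G x = 0" if "m \<in> UNIV - {\<lfloor>x\<rfloor>}" for m
      using that cov[of x] by (auto simp: indicator_def)
  qed auto
  have shift: "(LINT x|lborel. indicat_real (?I m) x *\<^sub>R G x) = (LINT x:{0..<1}|lborel. G (x + of_int m))"
    for m and G :: "real \<Rightarrow> 'x::{banach,second_countable_topology}"
  proof -
    have "(LINT x|lborel. indicat_real (?I m) x *\<^sub>R G x)
      = (LINT x|lborel. indicat_real (?I m) (of_int m + 1 * x) *\<^sub>R G (of_int m + 1 * x))"
      using lborel_integral_real_affine[of 1 "\<lambda>x. indicat_real (?I m) x *\<^sub>R G x" "of_int m"] by simp
    also have "\<dots> = (LINT x:{0..<1}|lborel. G (x + of_int m))"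
      unfolding set_lebesgue_integral_def
      by (intro Bochner_Integration.integral_cong) (auto simp: indicator_def add.commute)
    finally show ?thesis .
  qed
  have ii: "integrable lborel (\<lambda>x. indicat_real (?I m) x *\<^sub>R G x)" if "integrable lborel G"
    for m and G :: "real \<Rightarrow> 'x::{banach,second_countable_topology}"
    by (rule integrable_mult_indicator) (use that in auto)
  have bd: "(\<lambda>m. LINT x|lborel. norm (indicat_real (?I m) x *\<^sub>R g x)) summable_on UNIV"
  proof (rule nonneg_bdd_above_summable_on)
    show "bdd_above (sum (\<lambda>m. LINT x|lborel. norm (indicat_real (?I m) x *\<^sub>R g x)) ` {F. F \<subseteq> UNIV \<and> finite F})"
    proof (rule bdd_aboveI2)
      fix F :: "int set" assume "F \<in> {F. F \<subseteq> UNIV \<and> finite F}"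
      then have F: "finite F" by auto
      have "(\<Sum>m\<in>F. LINT x|lborel. norm (indicat_real (?I m) x *\<^sub>R g x))
         = (LINT x|lborel. (\<Sum>m\<in>F. norm (indicat_real (?I m) x *\<^sub>R g x)))"
        using ii[OF g] by (intro Bochner_Integration.integral_sum[symmetric] integrable_norm) auto
      also have "\<dots> \<le> (LINT x|lborel. norm (g x))"
      proof (rule integral_mono)
        show "integrable lborel (\<lambda>x. \<Sum>m\<in>F. norm (indicat_real (?I m) x *\<^sub>R g x))"
          using ii[OF g] by (intro Bochner_Integration.integrable_sum integrable_norm) auto
        show "(\<Sum>m\<in>F. norm (indicat_real (?I m) x *\<^sub>R g x)) \<le> norm (g x)" for x
        proof -
          have "indicat_real (?I m) x = (if m = \<lfloor>x\<rfloor> then 1 else 0)" for m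
            by (subst eq_commute) (simp add: floor_eq_iff indicator_def)
          then have "(\<Sum>m\<in>F. norm (indicat_real (?I m) x *\<^sub>R g x)) = (\<Sum>m\<in>F. if m = \<lfloor>x\<rfloor> then norm (g x) else 0)"
            by (intro sum.cong) auto
          also have "\<dots> \<le> norm (g x)" using F by (simp add: sum.delta)
          finally show ?thesis .
        qed
      qed (use g in auto)
      finally show "(\<Sum>m\<in>F. LINT x|lborel. norm (indicat_real (?I m) x *\<^sub>R g x)) \<le> (LINT x|lborel. norm (g x))" .
    qed
  qed (auto intro: integral_nonneg_AE)
  have "((\<lambda>m. LINT x|lborel. indicat_real (?I m) x *\<^sub>R g x) has_sum (LINT x|lborel. g x)) UNIV"
    using has_sum_integral[OF _ ii[OF g] bd, of g] hs by auto
  then show ?thesis unfolding shift .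
qed

lemma integrable_inverse_square: "integrable lborel (\<lambda>t::real. 1 / (1 + t\<^sup>2))"
  using integrable_inverse_1_plus_square
  by (simp add: set_integrable_def inverse_eq_divide einterval_def)

text \<open>The decay of g makes its periodisation G converge absolutely, the decay of g' makes G
  Lipschitz at every point, and unfolding identifies the Fourier coefficients of G with the Fourier
  transform of g at integers; \<open>fourier_inversion\<close> then applies pointwise. Summability
  of c is an assumption because the kernel below has an explicit transform from which it can be read
  off.\<close>

lemma poisson_summation:
  fixes g g' :: "real \<Rightarrow> complex"
  assumes der: "\<And>t. (g has_vector_derivative g' t) (at t)"
    and g: "\<And>t. norm (g t) \<le> C / (1 + t\<^sup>2)" and g': "\<And>t. norm (g' t) \<le> C / (1 + t\<^sup>2)"
    and c: "\<And>n::int. c n = (LINT t|lborel. g t * ee (- (of_int n * t)))"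
    and sm: "c summable_on UNIV"
  shows "(\<lambda>m::int. g (x + of_int m)) summable_on UNIV"
    and "((\<lambda>n. c n * ee (of_int n * x)) has_sum (\<Sum>\<^sub>\<infinity>m::int. g (x + of_int m))) UNIV"
proof -
  have C0: "C \<ge> 0" using order_trans[OF norm_ge_zero g[of 0]] by simp
  have cont: "continuous_on UNIV g"
    using der by (auto intro!: continuous_at_imp_continuous_on has_vector_derivative_continuous)
  have [measurable]: "g \<in> borel_measurable borel"
    by (rule borel_measurable_continuous_onI[OF cont])
  have sn: "(\<lambda>m::int. norm (g (x + of_int m))) summable_on UNIV" for x
    by (rule summable_on_comparison_test[OF
        summable_on_cmult_right[OF summable_on_int_shift_inverse_square, of C x]]) (use g in auto)
  then show s: "(\<lambda>m::int. g (x + of_int m)) summable_on UNIV" for x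
    by (simp only: summable_on_iff_abs_summable_on_complex)
  define G where "G x = (\<Sum>\<^sub>\<infinity>m::int. g (x + of_int m))" for x
  define K where "K x = (\<Sum>\<^sub>\<infinity>m::int. 1 / (1 + (x + of_int m)\<^sup>2))" for x :: real
  have per: "G (x + of_int k) = G x" for x k
    unfolding G_def
    by (rule infsum_reindex_bij_witness[of _ "\<lambda>m. m - k" "\<lambda>m. m + k"]) (auto simp: algebra_simps)
  \<comment> \<open>For |t - v| \<le> 1/2 one has 1 + t^2 \<le> 2(1 + v^2), so the bound on g'
    anywhere between t and t + u is at most twice its value at t. A bound centred at t is what can
    be summed over the translates.\<close>
  have gl: "norm (g (t + u) - g t) \<le> 2 * C / (1 + t\<^sup>2) * \<bar>u\<bar>" if "\<bar>u\<bar> \<le> 1 / 2" for t u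
  proof -
    have "norm (g (t + u) - g t) \<le> (2 * C / (1 + t\<^sup>2)) * norm (t + u - t)"
    proof (rule differentiable_bound[where S = "cball t (1/2)"])
      show "(g has_derivative (\<lambda>h. h *\<^sub>R g' v)) (at v within cball t (1/2))" for v
        using der[of v] by (simp add: has_vector_derivative_def has_derivative_at_withinI)
      show "onorm (\<lambda>h. h *\<^sub>R g' v) \<le> 2 * C / (1 + t\<^sup>2)" if "v \<in> cball t (1/2)" for v
      proof (rule onorm_le)
        have "\<bar>t - v\<bar> \<le> 1 / 2" using that by (simp add: dist_real_def)
        then have "(t - v)\<^sup>2 \<le> (1 / 2)\<^sup>2" by (subst abs_le_square_iff[symmetric]) simp
        moreover have "0 \<le> (2 * v - t)\<^sup>2" by simp
        ultimately have "1 + t\<^sup>2 \<le> 2 * (1 + v\<^sup>2)" by (simp add: power2_eq_square algebra_simps)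
        then have "C * (1 + t\<^sup>2) \<le> C * (2 * (1 + v\<^sup>2))" using C0 by (rule mult_left_mono)
        then have "C / (1 + v\<^sup>2) \<le> 2 * C / (1 + t\<^sup>2)"
          by (simp add: frac_le_eq divide_simps add_pos_nonneg mult_ac)
        with g'[of v] have "norm (g' v) \<le> 2 * C / (1 + t\<^sup>2)" by linarith
        from mult_right_mono[OF this abs_ge_zero]
        show "norm (h *\<^sub>R g' v) \<le> 2 * C / (1 + t\<^sup>2) * norm h" for h
          by (simp only: norm_scaleR real_norm_def mult.commute)
      qed
    qed (use that in \<open>auto simp: dist_real_def\<close>)
    then show ?thesis by simp
  qed
  have lip: "norm (G (x + u) - G x) \<le> (2 * C * K x) * \<bar>u\<bar>" if u: "\<bar>u\<bar> \<le> 1 / 2" for x u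
  proof -
    have "G (x + u) - G x = (\<Sum>\<^sub>\<infinity>m::int. g (x + u + of_int m) - g (x + of_int m))"
      unfolding G_def by (rule infsumI[symmetric]) (intro has_sum_diff has_sum_infsum s)
    also have "norm \<dots> \<le> (\<Sum>\<^sub>\<infinity>m::int. 2 * C * \<bar>u\<bar> * (1 / (1 + (x + of_int m)\<^sup>2)))"
    proof (rule norm_infsum_le)
      show "((\<lambda>m::int. g (x + u + of_int m) - g (x + of_int m)) has_sum (\<Sum>\<^sub>\<infinity>m::int. g (x + u + of_int m) - g (x + of_int m))) UNIV"
        by (intro has_sum_infsum has_sum_imp_summable[OF has_sum_diff[OF has_sum_infsum has_sum_infsum]] s)
      show "((\<lambda>m::int. 2 * C * \<bar>u\<bar> * (1 / (1 + (x + of_int m)\<^sup>2))) has_sum (\<Sum>\<^sub>\<infinity>m::int. 2 * C * \<bar>u\<bar> * (1 / (1 + (x + of_int m)\<^sup>2)))) UNIV"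
        by (intro has_sum_infsum summable_on_cmult_right summable_on_int_shift_inverse_square)
      show "norm (g (x + u + of_int m) - g (x + of_int m)) \<le> 2 * C * \<bar>u\<bar> * (1 / (1 + (x + of_int m)\<^sup>2))" for m :: int
        using gl[OF u, of "x + of_int m"] by (simp add: algebra_simps)
    qed
    also have "\<dots> = (2 * C * K x) * \<bar>u\<bar>"
      unfolding K_def by (subst infsum_cmult_right) (auto intro: summable_on_int_shift_inverse_square)
    finally show ?thesis .
  qed
  have Gcont: "continuous_on UNIV G"
  proof (rule continuous_at_imp_continuous_on, safe)
    fix x
    have "((\<lambda>u. G (x + u) - G x) \<longlongrightarrow> 0) (at 0)"
    proof (rule Lim_null_comparison)
      show "\<forall>\<^sub>F u in at 0. norm (G (x + u) - G x) \<le> (2 * C * K x) * \<bar>u\<bar>"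
        unfolding eventually_at by (rule exI[of _ "1/2"]) (auto intro: lip)
      show "((\<lambda>u. (2 * C * K x) * \<bar>u\<bar>) \<longlongrightarrow> 0) (at 0)" by (auto intro!: tendsto_eq_intros)
    qed
    then show "isCont G x" 
      by (simp add: isCont_iff LIM_zero_iff)
  qed
  have [measurable]: "G \<in> borel_measurable borel"
    by (rule borel_measurable_continuous_onI[OF Gcont])
  have "bounded (G ` {0..1})"
    by (intro compact_imp_bounded compact_continuous_image continuous_on_subset[OF Gcont]) auto
  then obtain B where B: "\<And>x. x \<in> {0..1} \<Longrightarrow> norm (G x) \<le> B"
    unfolding bounded_iff by blast
  have GB: "norm (G x) \<le> B" for x
  proof -
    have "G x = G (frac x)" using per[of "frac x" "\<lfloor>x\<rfloor>"] by (simp add: frac_def)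
    then show ?thesis using B[of "frac x"] by (simp add: frac_lt_1 less_imp_le)
  qed
  have gi: "integrable lborel (\<lambda>t. g t * ee (- (of_int n * t)))" for n :: int
  proof (rule Bochner_Integration.integrable_bound)
    show "integrable lborel (\<lambda>t::real. C * (1 / (1 + t\<^sup>2)))"
      by (intro integrable_mult_right integrable_inverse_square)
    show "AE t in lborel. norm (g t * ee (- (of_int n * t))) \<le> norm (C * (1 / (1 + t\<^sup>2)))"
      using g C0 by (simp add: norm_mult)
  qed simp
  \<comment> \<open>Unfolding: e(-n(x + m)) = e(-nx) for integer m, so integrating G against a
    character over one period is integrating g over the line.\<close>
  have cG: "c n = (LINT x:{0..<1}|lborel. G x * ee (- (of_int n * x)))" for n
  proof -
    have e: "ee (- (of_int n * (x + of_int m))) = ee (- (of_int n * x))" for x and m :: int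
      using ee_add_int[of "- (of_int n * x)" "- (n * m)"] by (simp add: algebra_simps)
    have "((\<lambda>m::int. LINT x:{0..<1}|lborel. g (x + of_int m) * ee (- (of_int n * x))) has_sum c n) UNIV"
      using tiling_has_sum[OF gi[of n]] unfolding c e .
    moreover have "((\<lambda>m::int. LINT x:{0..<1}|lborel. g (x + of_int m) * ee (- (of_int n * x)))
       has_sum (LINT x:{0..<1}|lborel. G x * ee (- (of_int n * x)))) UNIV"
    proof (rule set_integral_has_sum(2))
      show "set_integrable lborel {0..<1} (\<lambda>x. g (x + of_int m) * ee (- (of_int n * x)))" for m :: int
      proof (rule set_integrable_unit_interval[where B=C])
        show "norm (g (x + of_int m) * ee (- (of_int n * x))) \<le> C" for x
        proof -
          have "norm (g (x + of_int m)) \<le> C / (1 + (x + of_int m)\<^sup>2)" by (rule g)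
          also have "\<dots> \<le> C / 1" using C0 by (intro divide_left_mono) (auto intro: add_pos_nonneg)
          finally show ?thesis by (simp add: norm_mult)
        qed
      qed simp
      \<comment> \<open>The tiling lemma is applied to the norm of g, regarded as a complex
        function, to get the absolute summability that termwise integration requires.\<close>
      have "((\<lambda>m::int. LINT x:{0..<1}|lborel. complex_of_real (norm (g (x + of_int m)))) has_sum (LINT t|lborel. complex_of_real (norm (g t)))) UNIV"
        using gi[of 0] by (intro tiling_has_sum) auto
      then have "(\<lambda>m::int. complex_of_real (LINT x:{0..<1}|lborel. norm (g (x + of_int m)))) summable_on UNIV"
        unfolding set_integral_complex_of_real by (auto simp: summable_on_def)
      then have "(\<lambda>m::int. Re (complex_of_real (LINT x:{0..<1}|lborel. norm (g (x + of_int m))))) summable_on UNIV"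
        by (rule summable_on_Re)
      then show "(\<lambda>m::int. LINT x:{0..<1}|lborel. norm (g (x + of_int m) * ee (- (of_int n * x)))) summable_on UNIV"
        by (simp add: norm_mult)
      show "((\<lambda>m::int. g (x + of_int m) * ee (- (of_int n * x))) has_sum G x * ee (- (of_int n * x))) UNIV" for x
        unfolding G_def by (intro has_sum_cmult_left has_sum_infsum s)
    qed auto
    ultimately show ?thesis by (rule has_sum_unique)
  qed
  show "((\<lambda>n. c n * ee (of_int n * x)) has_sum (\<Sum>\<^sub>\<infinity>m::int. g (x + of_int m))) UNIV"
    unfolding G_def[symmetric] by (rule fourier_inversion[OF _ GB per lip cG sm]) auto
qed

subsection \<open>The Fourier transform of $(t^2+y^2)^{-s}$\<close>

lemma set_integrable_lebesgue_iff_lborel: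
  fixes f :: "real \<Rightarrow> 'b::{banach, second_countable_topology}"
  assumes [measurable]: "f \<in> borel_measurable borel" "S \<in> sets borel"
  shows "set_integrable lebesgue S f \<longleftrightarrow> set_integrable lborel S f"
    and "(LINT x:S|lebesgue. f x) = (LINT x:S|lborel. f x)"
  unfolding set_integrable_def set_lebesgue_integral_def
  by (auto intro!: integrable_completion integral_completion)

lemma set_integrable_complex_iff:
  "set_integrable M S (f :: 'a \<Rightarrow> complex) \<longleftrightarrow>
     set_integrable M S (\<lambda>x. Re (f x)) \<and> set_integrable M S (\<lambda>x. Im (f x))"
proof
  assume f: "set_integrable M S f"
  show "set_integrable M S (\<lambda>x. Re (f x)) \<and> set_integrable M S (\<lambda>x. Im (f x))"
    using integrable_Re[OF f[unfolded set_integrable_def]] integrable_Im[OF f[unfolded set_integrable_def]]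
    by (simp add: set_integrable_def)
next
  assume "set_integrable M S (\<lambda>x. Re (f x)) \<and> set_integrable M S (\<lambda>x. Im (f x))"
  then have "integrable M (\<lambda>x. complex_of_real (indicator S x *\<^sub>R Re (f x)) + \<i> * complex_of_real (indicator S x *\<^sub>R Im (f x)))"
    unfolding set_integrable_def
    by (intro Bochner_Integration.integrable_add integrable_mult_right) (auto simp only: complex_of_real_integrable_eq)
  also have "(\<lambda>x. complex_of_real (indicator S x *\<^sub>R Re (f x)) + \<i> * complex_of_real (indicator S x *\<^sub>R Im (f x))) = (\<lambda>x. indicator S x *\<^sub>R f x)"
    by (auto simp: fun_eq_iff complex_eq_iff)
  finally show "set_integrable M S f" by (simp add: set_integrable_def)
qed

lemma set_integral_Re_Im:
  assumes "set_integrable M S (f :: 'a \<Rightarrow> complex)"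
  shows "Re (LINT x:S|M. f x) = (LINT x:S|M. Re (f x))" "Im (LINT x:S|M. f x) = (LINT x:S|M. Im (f x))"
  using assms unfolding set_integrable_def set_lebesgue_integral_def
  by (simp_all add: integral_Re[symmetric] integral_Im[symmetric])

text \<open>The underlying theorem speaks of gauge integrals of functions absolutely integrable for
  the completed measure; for Borel functions on Borel sets these agree with integrals over
  \<open>lborel\<close>.\<close>

lemma set_integral_change_of_variables_real:
  fixes f g g' :: "real \<Rightarrow> real"
  assumes S [measurable]: "S \<in> sets borel" and T [measurable]: "g ` S \<in> sets borel"
    and der: "\<And>x. x \<in> S \<Longrightarrow> (g has_field_derivative g' x) (at x within S)"
    and inj: "inj_on g S"
    and [measurable]: "f \<in> borel_measurable borel" "(\<lambda>x. \<bar>g' x\<bar> * f (g x)) \<in> borel_measurable borel"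
  shows "set_integrable lborel S (\<lambda>x. \<bar>g' x\<bar> * f (g x)) \<longleftrightarrow> set_integrable lborel (g ` S) f"
    and "set_integrable lborel (g ` S) f \<Longrightarrow> (LINT x:S|lborel. \<bar>g' x\<bar> * f (g x)) = (LINT x:g ` S|lborel. f x)"
proof -
  have S': "S \<in> sets lebesgue" by simp
  have *: "set_integrable lebesgue S (\<lambda>x. \<bar>g' x\<bar> * f (g x)) \<and> integral S (\<lambda>x. \<bar>g' x\<bar> * f (g x)) = b
     \<longleftrightarrow> set_integrable lebesgue (g ` S) f \<and> integral (g ` S) f = b" for b
    by (rule has_absolute_integral_change_of_variables_1'[OF S' der inj])
  \<comment> \<open>The free value \<open>b\<close> is set to each of the two integrals in turn,
    which gives the two implications.\<close>
  show 1: "set_integrable lborel S (\<lambda>x. \<bar>g' x\<bar> * f (g x)) \<longleftrightarrow> set_integrable lborel (g ` S) f"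
    using *[of "integral (g ` S) f"] *[of "integral S (\<lambda>x. \<bar>g' x\<bar> * f (g x))"]
    by (auto simp: set_integrable_lebesgue_iff_lborel)
  show "(LINT x:S|lborel. \<bar>g' x\<bar> * f (g x)) = (LINT x:g ` S|lborel. f x)" if i: "set_integrable lborel (g ` S) f"
  proof -
    have i': "set_integrable lborel S (\<lambda>x. \<bar>g' x\<bar> * f (g x))" using i 1 by simp
    show ?thesis
      using *[of "integral (g ` S) f"] i set_borel_integral_eq_integral(2)[OF i] set_borel_integral_eq_integral(2)[OF i']
      by (simp add: set_integrable_lebesgue_iff_lborel)
  qed
qed

lemma set_integral_change_of_variables:
  fixes f :: "real \<Rightarrow> complex" and g g' :: "real \<Rightarrow> real"
  assumes S: "S \<in> sets borel" and T: "g ` S \<in> sets borel"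
    and der: "\<And>x. x \<in> S \<Longrightarrow> (g has_field_derivative g' x) (at x within S)"
    and inj: "inj_on g S"
    and f [measurable]: "f \<in> borel_measurable borel"
    and f' [measurable]: "(\<lambda>x. of_real \<bar>g' x\<bar> * f (g x)) \<in> borel_measurable borel"
  shows "set_integrable lborel S (\<lambda>x. of_real \<bar>g' x\<bar> * f (g x)) \<longleftrightarrow> set_integrable lborel (g ` S) f"
    and "set_integrable lborel (g ` S) f \<Longrightarrow> (LINT x:S|lborel. of_real \<bar>g' x\<bar> * f (g x)) = (LINT x:g ` S|lborel. f x)"
proof -
  have mR: "(\<lambda>x. \<bar>g' x\<bar> * Re (f (g x))) \<in> borel_measurable borel"
    using measurable_compose[OF f' borel_measurable_Re] by simp
  have mI: "(\<lambda>x. \<bar>g' x\<bar> * Im (f (g x))) \<in> borel_measurable borel"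
    using measurable_compose[OF f' borel_measurable_Im] by simp
  have fR: "(\<lambda>x. Re (f x)) \<in> borel_measurable borel" and fI: "(\<lambda>x. Im (f x)) \<in> borel_measurable borel" by auto
  note R = set_integral_change_of_variables_real[where f = "\<lambda>x. Re (f x)", OF S T der inj fR mR, simplified]
  note I = set_integral_change_of_variables_real[where f = "\<lambda>x. Im (f x)", OF S T der inj fI mI, simplified]
  show 1: "set_integrable lborel S (\<lambda>x. of_real \<bar>g' x\<bar> * f (g x)) \<longleftrightarrow> set_integrable lborel (g ` S) f"
    using R(1) I(1) by (simp add: set_integrable_complex_iff)
  show "(LINT x:S|lborel. of_real \<bar>g' x\<bar> * f (g x)) = (LINT x:g ` S|lborel. f x)"
    if i: "set_integrable lborel (g ` S) f"
  proof (rule complex_eqI)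
    have i': "set_integrable lborel (g ` S) (\<lambda>x. Re (f x))" "set_integrable lborel (g ` S) (\<lambda>x. Im (f x))"
      using i by (auto simp: set_integrable_complex_iff)
    show "Re (LINT x:S|lborel. of_real \<bar>g' x\<bar> * f (g x)) = Re (LINT x:g ` S|lborel. f x)"
      using i 1 R(2)[OF i'(1)] by (simp add: set_integral_Re_Im)
    show "Im (LINT x:S|lborel. of_real \<bar>g' x\<bar> * f (g x)) = Im (LINT x:g ` S|lborel. f x)"
      using i 1 I(2)[OF i'(2)] by (simp add: set_integral_Re_Im)
  qed
qed

lemma measurable_of_real_powr [measurable]: "(\<lambda>u::real. complex_of_real u powr s) \<in> borel_measurable borel"
  unfolding powr_def by measurable

text \<open>Euler's integral after the substitution t = v u. It is used with v = t^2 + y^2 and v =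
  y^2 for the kernel, and with v = 2 pi l for the terms of a q-expansion.\<close>

lemma gamma_integral_scaled:
  fixes v :: real and s :: complex
  assumes v: "v > 0" and s: "Re s > 0"
  shows "set_integrable lborel {0<..} (\<lambda>u. of_real u powr (s - 1) * of_real (exp (- (v * u))))"
    and "(LINT u:{0<..}|lborel. of_real u powr (s - 1) * of_real (exp (- (v * u)))) = Gamma s * of_real v powr (- s)"
proof -
  define F where "F t = complex_of_real t powr (s - 1) * of_real (exp (- t))" for t :: real
  have [measurable]: "F \<in> borel_measurable borel" unfolding F_def by measurable
  have Fd: "F t = of_real t powr (s - 1) / of_real (exp t)" for t
    by (simp add: F_def exp_minus field_simps)
  have i: "set_integrable lborel {0<..} F"
    using absolutely_integrable_Gamma_integral'[OF s] by (subst set_integrable_lebesgue_iff_lborel(1)[symmetric]) (simp_all add: Fd[abs_def])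
  have v1: "(LINT t:{0<..}|lborel. F t) = Gamma s"
  proof -
    have "(F has_integral Gamma s) {0<..}" using Gamma_integral_complex'[OF s] by (simp add: Fd[abs_def])
    then show ?thesis using set_borel_integral_eq_integral(2)[OF i] by (simp only: integral_unique)
  qed
  let ?f = "\<lambda>t::real. indicat_real {0<..} t *\<^sub>R F t"
  have sc: "?f (0 + v * u) = of_real v powr (s - 1) * (indicat_real {0<..} u *\<^sub>R (of_real u powr (s - 1) * of_real (exp (- (v * u)))))" for u
    using v by (auto simp: F_def indicator_def powr_times_real zero_less_mult_iff)
  have nz: "complex_of_real v powr (s - 1) \<noteq> 0" using v by simp
  have "integrable lborel (\<lambda>u. ?f (0 + v * u))" (is "integrable _ ?F")
    using lborel_integrable_real_affine[of ?f v 0] i v by (simp add: set_integrable_def)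
  from integrable_mult_right[OF this, of "1 / (of_real v powr (s - 1))"]
  show "set_integrable lborel {0<..} (\<lambda>u. of_real u powr (s - 1) * of_real (exp (- (v * u))))"
    unfolding sc set_integrable_def
    using nz by (simp only: mult_scaleR_right mult.assoc[symmetric] times_divide_eq_left mult_1_left
        nonzero_mult_div_cancel_left divide_self simp_thms if_False)
  have "Gamma s = v *\<^sub>R (LINT u|lborel. ?f (0 + v * u))"
    using v1 lborel_integral_real_affine[of v ?f 0] v by (simp add: set_lebesgue_integral_def)
  also have "\<dots> = v * of_real v powr (s - 1) * (LINT u:{0<..}|lborel. of_real u powr (s - 1) * of_real (exp (- (v * u))))"
    unfolding sc set_lebesgue_integral_def by (simp add: scaleR_conv_of_real)
  also have "v * of_real v powr (s - 1) = of_real v powr s"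
    using v by (simp add: powr_diff)
  finally show "(LINT u:{0<..}|lborel. of_real u powr (s - 1) * of_real (exp (- (v * u)))) = Gamma s * of_real v powr (- s)"
    using v by (simp add: powr_minus field_simps)
qed

text \<open>Read off from the characteristic function of the standard normal distribution: the
  scaling t \<mapsto> c t with c = sqrt(2u) turns its density into exp(-u t^2), and
  \<open>\<theta>\<close> is chosen so that \<theta> c t = -2 pi x t.\<close>

lemma gaussian_fourier:
  fixes u x :: real
  assumes u: "u > 0"
  shows "(LINT t|lborel. of_real (exp (- (u * t\<^sup>2))) * ee (- (x * t))) = of_real (sqrt (pi / u) * exp (- (pi\<^sup>2 * x\<^sup>2 / u)))"
proof -
  define c where "c = sqrt (2 * u)"
  have c: "c > 0" "c\<^sup>2 = 2 * u" using u by (auto simp: c_def)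
  define \<theta> where "\<theta> = - (2 * pi * x / c)"
  have "complex_of_real (exp (- (\<theta>\<^sup>2 / 2))) = char std_normal_distribution \<theta>"
    by (simp add: char_std_normal_distribution)
  also have "\<dots> = (LINT t|lborel. std_normal_density t *\<^sub>R exp (\<i> * of_real (\<theta> * t)))"
    unfolding char_def by (subst integral_density) (auto simp: normal_density_nonneg)
  also have "\<dots> = c *\<^sub>R (LINT t|lborel. std_normal_density (0 + c * t) *\<^sub>R exp (\<i> * of_real (\<theta> * (0 + c * t))))"
    using lborel_integral_real_affine[of c "\<lambda>t. std_normal_density t *\<^sub>R exp (\<i> * of_real (\<theta> * t))" 0] c by simp
  also have "(\<lambda>t. std_normal_density (0 + c * t) *\<^sub>R exp (\<i> * of_real (\<theta> * (0 + c * t)))) =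
     (\<lambda>t. of_real (1 / sqrt (2 * pi)) * (of_real (exp (- (u * t\<^sup>2))) * ee (- (x * t))))"
    using c by (auto simp: fun_eq_iff std_normal_density_def ee_exp \<theta>_def power_mult_distrib scaleR_conv_of_real mult_ac)
  finally have "complex_of_real (exp (- (\<theta>\<^sup>2 / 2))) = of_real (c / sqrt (2 * pi)) * (LINT t|lborel. of_real (exp (- (u * t\<^sup>2))) * ee (- (x * t)))"
    by (simp add: scaleR_conv_of_real)
  moreover have "\<theta>\<^sup>2 / 2 = pi\<^sup>2 * x\<^sup>2 / u"
    using c u by (simp add: \<theta>_def power_divide power_mult_distrib field_simps)
  moreover have "c / sqrt (2 * pi) = 1 / sqrt (pi / u)"
    using u by (simp add: c_def real_sqrt_mult real_sqrt_divide field_simps)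
  ultimately show ?thesis
    using u c(1) by (simp add: field_simps)
qed

text \<open>Split the exponent as (\<sigma> - 1) + 1. The first part is largest at t = 0, and in the
  second t^2 + y^2 \<ge> m (1 + t^2) with m = min(1, y^2).\<close>

lemma inverse_quadratic_bound:
  fixes y \<sigma> :: real
  assumes y: "y > 0" and \<sigma>: "\<sigma> \<ge> 1"
  obtains C where "C \<ge> 0" "\<And>t. (t\<^sup>2 + y\<^sup>2) powr (- \<sigma>) \<le> C / (1 + t\<^sup>2)"
proof
  define m where "m = min 1 (y\<^sup>2)"
  have m: "0 < m" "m \<le> 1" "m \<le> y\<^sup>2" using y by (auto simp: m_def)
  let ?C = "(y\<^sup>2) powr (- (\<sigma> - 1)) / m"
  show "?C \<ge> 0" using m by simp
  show "(t\<^sup>2 + y\<^sup>2) powr (- \<sigma>) \<le> ?C / (1 + t\<^sup>2)" for t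
  proof -
    have p: "t\<^sup>2 + y\<^sup>2 > 0" using y by (simp add: add_nonneg_pos)
    have "(t\<^sup>2 + y\<^sup>2) powr (- \<sigma>) = (t\<^sup>2 + y\<^sup>2) powr (- (\<sigma> - 1)) * (1 / (t\<^sup>2 + y\<^sup>2))"
      using p by (simp add: powr_diff powr_minus field_simps)
    also have "\<dots> \<le> (y\<^sup>2) powr (- (\<sigma> - 1)) * (1 / (m * (1 + t\<^sup>2)))"
    proof (intro mult_mono)
      show "(t\<^sup>2 + y\<^sup>2) powr (- (\<sigma> - 1)) \<le> (y\<^sup>2) powr (- (\<sigma> - 1))"
        using y \<sigma> by (intro powr_mono2') auto
      have "m * (1 + t\<^sup>2) \<le> t\<^sup>2 + y\<^sup>2"
        using m mult_right_mono[OF m(2), of "t\<^sup>2"] by (simp add: algebra_simps)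
      then show "1 / (t\<^sup>2 + y\<^sup>2) \<le> 1 / (m * (1 + t\<^sup>2))"
        using m p by (intro divide_left_mono mult_pos_pos) (auto intro: add_pos_nonneg)
    qed (use p in auto)
    finally show ?thesis by simp
  qed
qed

definition fourier_kernel :: "complex \<Rightarrow> real \<Rightarrow> real \<Rightarrow> complex" where
  "fourier_kernel s y x = (LINT t|lborel. of_real (t\<^sup>2 + y\<^sup>2) powr (- s) * ee (- (x * t)))"

text \<open>Writing Gamma(s) (t^2 + y^2)^(-s) as an Euler integral over u makes the dependence on t
  Gaussian; after Fubini the t-integral is \<open>gaussian_fourier\<close>. Its factor 1/sqrt(u)
  lowers the exponent s - 1 to s - 3/2.\<close>

lemma fourier_kernel_eq:
  assumes y: "y > 0" and s: "Re s \<ge> 1"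
  shows "Gamma s * fourier_kernel s y x = of_real (sqrt pi) *
     (LINT u:{0<..}|lborel. of_real u powr (s - 3 / 2) * of_real (exp (- (u * y\<^sup>2) - pi\<^sup>2 * x\<^sup>2 / u)))"
proof -
  define \<sigma> where "\<sigma> = Re s"
  define F where "F t u = (indicat_real {0<..} u *\<^sub>R (of_real u powr (s - 1) * of_real (exp (- ((t\<^sup>2 + y\<^sup>2) * u))))) * ee (- (x * t))"
    for t u :: real
  have p: "t\<^sup>2 + y\<^sup>2 > 0" for t using y by (simp add: add_nonneg_pos)
  have [measurable]: "case_prod F \<in> borel_measurable (lborel \<Otimes>\<^sub>M lborel)"
    unfolding F_def by measurable
  have g: "set_integrable lborel {0<..} (\<lambda>u. of_real u powr (s - 1) * of_real (exp (- ((t\<^sup>2 + y\<^sup>2) * u))))"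
     "(LINT u:{0<..}|lborel. of_real u powr (s - 1) * of_real (exp (- ((t\<^sup>2 + y\<^sup>2) * u)))) = Gamma s * of_real (t\<^sup>2 + y\<^sup>2) powr (- s)" for t
    using gamma_integral_scaled[OF p, of s] s by auto
  \<comment> \<open>The inner integral of the norm is the same Euler integral at the real exponent
    \<sigma> = Re s; as a function of t it is integrable by \<open>inverse_quadratic_bound\<close>,
    which is the hypothesis of Fubini.\<close>
  have nF: "(LINT u|lborel. norm (F t u)) = Re (Gamma (of_real \<sigma>)) * (t\<^sup>2 + y\<^sup>2) powr (- \<sigma>)" for t
  proof -
    have "complex_of_real (LINT u|lborel. norm (F t u)) =
       (LINT u:{0<..}|lborel. of_real u powr (of_real \<sigma> - 1) * of_real (exp (- ((t\<^sup>2 + y\<^sup>2) * u))))"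
      unfolding set_lebesgue_integral_def integral_complex_of_real[symmetric]
    proof (rule Bochner_Integration.integral_cong[OF refl])
      fix u :: real
      have "complex_of_real (norm (F t u)) = of_real (u powr (\<sigma> - 1) * exp (- ((t\<^sup>2 + y\<^sup>2) * u)))" if "u > 0"
        using that by (simp add: F_def norm_mult norm_powr_real_powr \<sigma>_def)
      moreover have "complex_of_real u powr (of_real \<sigma> - 1) = of_real (u powr (\<sigma> - 1))" if "u > 0"
        using that powr_of_real[of u "\<sigma> - 1"] by simp
      ultimately show "complex_of_real (norm (F t u)) = indicat_real {0<..} u *\<^sub>R
          (complex_of_real u powr (of_real \<sigma> - 1) * of_real (exp (- ((t\<^sup>2 + y\<^sup>2) * u))))"
        by (cases "u > 0") (simp_all add: F_def)
    qed
    also have "\<dots> = Gamma (of_real \<sigma>) * of_real (t\<^sup>2 + y\<^sup>2) powr (- of_real \<sigma>)"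
      using gamma_integral_scaled(2)[OF p, of "of_real \<sigma>"] s by (simp add: \<sigma>_def)
    also have "of_real (t\<^sup>2 + y\<^sup>2) powr (- of_real \<sigma>) = complex_of_real ((t\<^sup>2 + y\<^sup>2) powr (- \<sigma>))"
      using p[of t] by (subst powr_of_real[symmetric]) auto
    finally have "Re (complex_of_real (LINT u|lborel. norm (F t u))) = Re (Gamma (of_real \<sigma>) * complex_of_real ((t\<^sup>2 + y\<^sup>2) powr (- \<sigma>)))"
      by simp
    then show ?thesis by simp
  qed
  obtain C where C: "C \<ge> 0" "\<And>t. (t\<^sup>2 + y\<^sup>2) powr (- \<sigma>) \<le> C / (1 + t\<^sup>2)"
    using inverse_quadratic_bound[OF y, of \<sigma>] s \<sigma>_def by auto
  have "integrable (lborel \<Otimes>\<^sub>M lborel) (case_prod F)"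
  proof (rule lborel_pair.Fubini_integrable)
    show "AE t in lborel. integrable lborel (\<lambda>u. case_prod F (t, u))"
      using integrable_mult_left[OF g(1)[unfolded set_integrable_def]] unfolding F_def by (intro AE_I2) simp
    have "integrable lborel (\<lambda>t. Re (Gamma (of_real \<sigma>)) * (t\<^sup>2 + y\<^sup>2) powr (- \<sigma>))"
    proof (rule Bochner_Integration.integrable_bound)
      show "integrable lborel (\<lambda>t::real. Re (Gamma (of_real \<sigma>)) * (C * (1 / (1 + t\<^sup>2))))"
        by (intro integrable_mult_right integrable_inverse_square)
      show "AE t in lborel. norm (Re (Gamma (of_real \<sigma>)) * (t\<^sup>2 + y\<^sup>2) powr (- \<sigma>)) \<le> norm (Re (Gamma (of_real \<sigma>)) * (C * (1 / (1 + t\<^sup>2))))"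
        using C(1) mult_left_mono[OF C(2) abs_ge_zero] by (auto simp: abs_mult)
    qed simp
    then show "integrable lborel (\<lambda>t. LINT u|lborel. norm (case_prod F (t, u)))" by (simp add: nF)
  qed simp
  from lborel_pair.Fubini_integral[OF this]
  have sw: "(LINT u|lborel. LINT t|lborel. F t u) = (LINT t|lborel. LINT u|lborel. F t u)" .
  have "(LINT t|lborel. LINT u|lborel. F t u) = (LINT t|lborel. Gamma s * (of_real (t\<^sup>2 + y\<^sup>2) powr (- s) * ee (- (x * t))))"
  proof -
    have "(LINT u|lborel. F t u) = Gamma s * (of_real (t\<^sup>2 + y\<^sup>2) powr (- s) * ee (- (x * t)))" for t
    proof -
      have "(LINT u|lborel. F t u) =
          (LINT u:{0<..}|lborel. of_real u powr (s - 1) * of_real (exp (- ((t\<^sup>2 + y\<^sup>2) * u)))) * ee (- (x * t))"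
        unfolding F_def set_lebesgue_integral_def by (rule integral_mult_left_zero)
      then show ?thesis unfolding g(2) by (simp only: mult.assoc)
    qed
    then show ?thesis by simp
  qed
  also have "\<dots> = Gamma s * fourier_kernel s y x" unfolding fourier_kernel_def by simp
  finally have 1: "(LINT t|lborel. LINT u|lborel. F t u) = Gamma s * fourier_kernel s y x" .
  have "(LINT t|lborel. F t u) = of_real (sqrt pi) * (indicat_real {0<..} u *\<^sub>R (of_real u powr (s - 3 / 2) * of_real (exp (- (u * y\<^sup>2) - pi\<^sup>2 * x\<^sup>2 / u))))" for u
  proof (cases "u > 0")
    case True
    have "F t u = (of_real u powr (s - 1) * of_real (exp (- (u * y\<^sup>2)))) * (of_real (exp (- (u * t\<^sup>2))) * ee (- (x * t)))" for t
    proof -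
      have "exp (- ((t\<^sup>2 + y\<^sup>2) * u)) = exp (- (u * y\<^sup>2)) * exp (- (u * t\<^sup>2))"
        by (simp add: mult_exp_exp algebra_simps)
      then show ?thesis using True by (simp add: F_def mult_ac)
    qed
    then have "(LINT t|lborel. F t u) = (of_real u powr (s - 1) * of_real (exp (- (u * y\<^sup>2)))) * of_real (sqrt (pi / u) * exp (- (pi\<^sup>2 * x\<^sup>2 / u)))"
      using gaussian_fourier[OF True, of x] by simp
    also have "\<dots> = (of_real u powr (s - 1) / of_real (sqrt u)) * of_real (sqrt pi) * of_real (exp (- (u * y\<^sup>2) - pi\<^sup>2 * x\<^sup>2 / u))"
      by (simp add: real_sqrt_divide exp_diff exp_minus field_simps)
    also have "of_real u powr (s - 1) / of_real (sqrt u) = of_real u powr (s - 3 / 2)"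
    proof -
      have "complex_of_real (sqrt u) = of_real u powr (of_real (1 / 2))"
        using True by (subst powr_of_real) (auto simp: powr_half_sqrt)
      moreover have "s - 3 / 2 = (s - 1) - of_real (1 / 2)" by simp
      ultimately show ?thesis using True by (simp add: powr_diff[symmetric])
    qed
    finally show ?thesis using True by (simp add: mult_ac)
  qed (simp add: F_def)
  then have "(LINT u|lborel. LINT t|lborel. F t u) = of_real (sqrt pi) *
     (LINT u:{0<..}|lborel. of_real u powr (s - 3 / 2) * of_real (exp (- (u * y\<^sup>2) - pi\<^sup>2 * x\<^sup>2 / u)))"
    by (simp only: set_lebesgue_integral_def integral_mult_right_zero)
  with sw 1 show ?thesis by simp
qed


lemma set_integrable_dominated:
  fixes g :: "real \<Rightarrow> 'b::{banach, second_countable_topology}" and f :: "real \<Rightarrow> real"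
  assumes "set_integrable lborel A f" "g \<in> borel_measurable borel" "A \<in> sets borel"
    and "\<And>x. x \<in> A \<Longrightarrow> norm (g x) \<le> f x"
  shows "set_integrable lborel A g" and "norm (LINT x:A|lborel. g x) \<le> (LINT x:A|lborel. f x)"
proof -
  show g: "set_integrable lborel A g"
  proof (rule set_integrable_bound[OF assms(1)])
    show "set_borel_measurable lborel A g"
      unfolding set_borel_measurable_def using assms(2,3) by measurable
    show "AE x in lborel. x \<in> A \<longrightarrow> norm (g x) \<le> norm (f x)"
      using assms(4) by (intro AE_I2) force
  qed
  show "norm (LINT x:A|lborel. g x) \<le> (LINT x:A|lborel. f x)"
    unfolding set_lebesgue_integral_def
  proof (rule Bochner_Integration.integral_norm_bound_integral)
    fix x :: real assume "x \<in> space lborel"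
    show "norm (indicat_real A x *\<^sub>R g x) \<le> indicat_real A x *\<^sub>R f x"
      using assms(4)[of x] by (cases "x \<in> A") auto
  qed (use g assms(1) in \<open>auto simp: set_integrable_def\<close>)
qed

lemma norm_of_real_powr: "u > 0 \<Longrightarrow> norm (complex_of_real u powr s) = u powr Re s"
  by (simp add: norm_powr_real_powr)

lemma norm_gamma_integrand_integral:
  fixes v :: real and s :: complex
  assumes v: "v > 0" and s: "Re s > 0"
  shows "(LINT u:{0<..}|lborel. norm (of_real u powr (s - 1) * complex_of_real (exp (- (v * u))))) = Gamma (Re s) * v powr (- Re s)"
proof -
  have "complex_of_real (LINT u:{0<..}|lborel. norm (of_real u powr (s - 1) * complex_of_real (exp (- (v * u)))))
     = (LINT u:{0<..}|lborel. of_real u powr (of_real (Re s) - 1) * of_real (exp (- (v * u))))"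
    unfolding set_integral_complex_of_real[symmetric]
  proof (rule set_lebesgue_integral_cong)
    show "\<forall>u. u \<in> {0<..} \<longrightarrow> complex_of_real (norm (of_real u powr (s - 1) * complex_of_real (exp (- (v * u)))))
        = of_real u powr (of_real (Re s) - 1) * of_real (exp (- (v * u)))"
    proof (intro allI impI)
      fix u :: real assume "u \<in> {0<..}"
      then have u: "u > 0" by simp
      then have "complex_of_real u powr (of_real (Re s) - 1) = of_real (u powr (Re s - 1))"
        using powr_of_real[of u "Re s - 1"] by simp
      then show "complex_of_real (norm (of_real u powr (s - 1) * complex_of_real (exp (- (v * u)))))
        = of_real u powr (of_real (Re s) - 1) * of_real (exp (- (v * u)))"
        using u by (simp add: norm_mult norm_of_real_powr)
    qed
  qed simp
  also have "\<dots> = Gamma (of_real (Re s)) * of_real v powr (- of_real (Re s))"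
    using gamma_integral_scaled(2)[OF v, of "of_real (Re s)"] s by simp
  also have "\<dots> = complex_of_real (Gamma (Re s) * v powr (- Re s))"
    using powr_of_real[of v "- Re s"] v by (simp add: Gamma_complex_of_real)
  finally show ?thesis by (simp only: of_real_eq_iff)
qed

text \<open>Without the term pi^2 x^2 / u the integral is again Euler's, at s - 1/2. This is the
  origin of Gamma(s - 1/2) and of y^(1-s) in the constant term.\<close>

lemma fourier_kernel_0:
  assumes y: "y > 0" and s: "Re s \<ge> 1"
  shows "Gamma s * fourier_kernel s y 0 = of_real (sqrt pi) * Gamma (s - 1 / 2) * of_real (y\<^sup>2) powr (1 / 2 - s)"
proof -
  have "(LINT u:{0<..}|lborel. of_real u powr (s - 1 / 2 - 1) * of_real (exp (- (y\<^sup>2 * u)))) =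
      Gamma (s - 1 / 2) * of_real (y\<^sup>2) powr (- (s - 1 / 2))"
    using s y by (intro gamma_integral_scaled(2)) auto
  then show ?thesis
    using fourier_kernel_eq[OF y s, of 0] by (simp add: mult_ac diff_diff_eq)
qed

text \<open>With w = pi^2 x^2 / u the inequality exp(-w) \<le> 1/w trades the exponential for u /
  (pi^2 x^2), and an Euler integral at s + 1/2 remains. Quadratic decay makes the values at integers
  summable.\<close>

lemma fourier_kernel_decay:
  assumes y: "y > 0" and s: "Re s \<ge> 1"
  obtains C where "C \<ge> 0" "\<And>x. x \<noteq> 0 \<Longrightarrow> norm (fourier_kernel s y x) \<le> C / x\<^sup>2"
proof
  let ?h = "\<lambda>x u. complex_of_real u powr (s - 3 / 2) * of_real (exp (- (u * y\<^sup>2) - pi\<^sup>2 * x\<^sup>2 / u))"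
  let ?G = "Gamma (Re s + 1 / 2) * (y\<^sup>2) powr (- (Re s + 1 / 2))"
  let ?C = "sqrt pi * ?G / (pi\<^sup>2 * norm (Gamma s))"
  have Gs: "Gamma s \<noteq> 0" using s by (auto simp: Gamma_eq_zero_iff elim!: nonpos_Ints_cases)
  have G0: "?G \<ge> 0" using s by (simp add: Gamma_real_nonneg)
  show "?C \<ge> 0" using G0 by simp
  show "norm (fourier_kernel s y x) \<le> ?C / x\<^sup>2" if x: "x \<noteq> 0" for x
  proof -
    have i: "set_integrable lborel {0<..} (\<lambda>u. norm (of_real u powr ((s + 1 / 2) - 1) * complex_of_real (exp (- (y\<^sup>2 * u)))))"
      using s y by (intro set_integrable_norm gamma_integral_scaled(1)) auto
    have "norm (LINT u:{0<..}|lborel. ?h x u) \<le> (LINT u:{0<..}|lborel. norm (of_real u powr ((s + 1 / 2) - 1) * complex_of_real (exp (- (y\<^sup>2 * u)))) / (pi\<^sup>2 * x\<^sup>2))"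
    proof -
      have "norm (?h x u) \<le> norm (of_real u powr ((s + 1 / 2) - 1) * complex_of_real (exp (- (y\<^sup>2 * u)))) / (pi\<^sup>2 * x\<^sup>2)"
        if u: "u > 0" for u
      proof -
        define w where "w = pi\<^sup>2 * x\<^sup>2 / u"
        have w: "w > 0" using u x by (simp add: w_def)
        have "exp (- w) \<le> 1 / w"
        proof -
          have "w \<le> exp w" using exp_ge_add_one_self[of w] by linarith
          with w show ?thesis by (simp add: exp_minus divide_simps)
        qed
        then have ew: "exp (- w) \<le> u / (pi\<^sup>2 * x\<^sup>2)" by (simp add: w_def)
        have "norm (?h x u) = u powr (Re s - 3 / 2) * exp (- (y\<^sup>2 * u)) * exp (- w)"
          using u by (simp add: norm_mult norm_of_real_powr w_def mult_exp_exp mult.commute[of u])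
        also have "\<dots> \<le> u powr (Re s - 3 / 2) * exp (- (y\<^sup>2 * u)) * (u / (pi\<^sup>2 * x\<^sup>2))"
          using ew by (intro mult_left_mono) auto
        also have "u powr (Re s - 3 / 2) * exp (- (y\<^sup>2 * u)) * (u / (pi\<^sup>2 * x\<^sup>2)) = (u powr (Re s - 3 / 2) * u) * exp (- (y\<^sup>2 * u)) / (pi\<^sup>2 * x\<^sup>2)"
          by simp
        also have "u powr (Re s - 3 / 2) * u = u powr (Re s - 1 / 2)"
          using u powr_add[of u "Re s - 3 / 2" 1] by simp
        finally show ?thesis using u by (simp add: norm_mult norm_of_real_powr)
      qed
      with i show ?thesis
        by (intro set_integrable_dominated(2)) (auto intro!: set_integrable_divide)
    qed
    also have "\<dots> = ?G / (pi\<^sup>2 * x\<^sup>2)"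
      using norm_gamma_integrand_integral[of "y\<^sup>2" "s + 1 / 2"] s y by simp
    finally have 1: "norm (LINT u:{0<..}|lborel. ?h x u) \<le> ?G / (pi\<^sup>2 * x\<^sup>2)" .
    have "norm (Gamma s) * norm (fourier_kernel s y x) = sqrt pi * norm (LINT u:{0<..}|lborel. ?h x u)"
      using arg_cong[OF fourier_kernel_eq[OF y s, of x], of norm] by (simp add: norm_mult)
    also have "\<dots> \<le> sqrt pi * (?G / (pi\<^sup>2 * x\<^sup>2))" using 1 by (intro mult_left_mono) auto
    finally have "norm (Gamma s) * norm (fourier_kernel s y x) / norm (Gamma s) \<le> sqrt pi * (?G / (pi\<^sup>2 * x\<^sup>2)) / norm (Gamma s)"
      by (rule divide_right_mono) simp
    also have "norm (Gamma s) * norm (fourier_kernel s y x) / norm (Gamma s) = norm (fourier_kernel s y x)"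
      using Gs by simp
    also have "sqrt pi * (?G / (pi\<^sup>2 * x\<^sup>2)) / norm (Gamma s) = ?C / x\<^sup>2"
      by (simp only: times_divide_eq_right divide_divide_eq_left mult_ac)
    finally show ?thesis .
  qed
qed

lemma integral_over_line_split:
  fixes h :: "real \<Rightarrow> complex"
  assumes h: "integrable lborel h"
  shows "(LINT v|lborel. h v) = (LINT v:{0<..}|lborel. h v + h (- v))"
    and "set_integrable lborel {0<..} (\<lambda>v. h v + h (- v))"
proof -
  have i1: "set_integrable lborel {0<..} h"
    unfolding set_integrable_def using h by (intro integrable_mult_indicator) auto
  have i2: "set_integrable lborel {..<0} h"
    unfolding set_integrable_def using h by (intro integrable_mult_indicator) auto
  have e: "indicat_real {..<0} (0 + (- 1) * v) *\<^sub>R h (0 + (- 1) * v) = indicat_real {0<..} v *\<^sub>R h (- v)" for v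
    by (auto simp: indicator_def)
  have i3: "set_integrable lborel {0<..} (\<lambda>v. h (- v))"
    using lborel_integrable_real_affine[OF i2[unfolded set_integrable_def], of "-1" 0]
    unfolding e set_integrable_def by simp
  have 2: "(LINT v:{..<0}|lborel. h v) = (LINT v:{0<..}|lborel. h (- v))"
    using lborel_integral_real_affine[of "-1" "\<lambda>v. indicat_real {..<0} v *\<^sub>R h v" 0]
    unfolding e set_lebesgue_integral_def by simp
  have "(LINT v|lborel. h v) = (LINT v:{0<..} \<union> {..<0}|lborel. h v)"
    unfolding set_lebesgue_integral_def using h
    by (intro integral_cong_AE) (auto intro!: AE_I'[of "{0}"] simp: indicator_def split: if_splits)
  also have "\<dots> = (LINT v:{0<..}|lborel. h v) + (LINT v:{..<0}|lborel. h v)"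
    using i1 i2 by (intro set_integral_Un) auto
  finally show "(LINT v|lborel. h v) = (LINT v:{0<..}|lborel. h v + h (- v))"
    using set_integral_add(2)[OF i1 i3] 2 by simp
  show "set_integrable lborel {0<..} (\<lambda>v. h v + h (- v))"
    by (rule set_integral_add(1)[OF i1 i3])
qed

text \<open>The substitution u = k exp(v) with k = pi |x| / y puts v = 0 where the two exponents u
  y^2 and pi^2 x^2 / u are equal, so their sum becomes 2 pi |x| y cosh v. Folding v to the positive
  half-line produces twice the integral that defines \<open>bessel_K\<close>.\<close>

lemma fourier_kernel_bessel:
  assumes y: "y > 0" and s: "Re s \<ge> 1" and x: "x \<noteq> 0"
  shows "Gamma s * fourier_kernel s y x = 2 * of_real (sqrt pi) * of_real (pi * \<bar>x\<bar> / y) powr (s - 1 / 2)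
     * bessel_K (s - 1 / 2) (2 * pi * \<bar>x\<bar> * y)"
proof -
  define k where "k = pi * \<bar>x\<bar> / y"
  define a where "a = 2 * pi * \<bar>x\<bar> * y"
  define \<nu> where "\<nu> = s - 1 / 2"
  have k: "k > 0" using x y by (simp add: k_def)
  have a: "a > 0" using x y by (simp add: a_def)
  define h where "h u = complex_of_real u powr (s - 3 / 2) * of_real (exp (- (u * y\<^sup>2) - pi\<^sup>2 * x\<^sup>2 / u))" for u :: real
  define g where "g v = k * exp v" for v
  define H where "H v = exp (\<nu> * of_real v) * complex_of_real (exp (- (a * cosh v)))" for v :: real
  have [measurable]: "h \<in> borel_measurable borel" unfolding h_def by measurable
  have gU: "g ` UNIV = {0<..}"
  proof (intro equalityI subsetI)
    fix u :: real assume "u \<in> {0<..}"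
    then show "u \<in> g ` UNIV" using k by (intro image_eqI[of _ _ "ln (u / k)"]) (auto simp: g_def)
  qed (use k in \<open>auto simp: g_def\<close>)
  have hi: "set_integrable lborel {0<..} h"
  proof -
    have "norm (h u) \<le> norm (of_real u powr ((s - 1 / 2) - 1) * complex_of_real (exp (- (y\<^sup>2 * u))))" if "u > 0" for u
      using that by (auto simp: h_def norm_mult mult.commute[of u] intro!: mult_left_mono)
    moreover have "set_integrable lborel {0<..} (\<lambda>u. norm (of_real u powr ((s - 1 / 2) - 1) * complex_of_real (exp (- (y\<^sup>2 * u)))))"
      using s y by (intro set_integrable_norm gamma_integral_scaled(1)) simp_all
    ultimately show ?thesis
      using set_integrable_dominated(1)[of "{0<..}" "\<lambda>u. norm (of_real u powr ((s - 1 / 2) - 1) * complex_of_real (exp (- (y\<^sup>2 * u))))" h]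
      by (metis \<open>h \<in> borel_measurable borel\<close> greaterThan_borel greaterThan_iff)
  qed
  have gh: "of_real \<bar>g v\<bar> * h (g v) = of_real k powr \<nu> * H v" for v
  proof -
    have "of_real \<bar>g v\<bar> * h (g v) = (of_real (g v) * of_real (g v) powr (s - 3 / 2)) * of_real (exp (- (g v * y\<^sup>2) - pi\<^sup>2 * x\<^sup>2 / g v))"
      using k by (simp add: h_def g_def)
    also have "of_real (g v) * of_real (g v) powr (s - 3 / 2) = complex_of_real (g v) powr \<nu>"
      using k powr_add[of "complex_of_real (g v)" 1 "s - 3 / 2"] by (simp add: g_def \<nu>_def)
    also have "complex_of_real (g v) powr \<nu> = of_real k powr \<nu> * exp (\<nu> * of_real v)"
      using k by (simp add: g_def powr_times_real) (simp add: powr_def flip: exp_of_real)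
    also have "- (g v * y\<^sup>2) - pi\<^sup>2 * x\<^sup>2 / g v = - (a * cosh v)"
      using k x y by (simp add: g_def k_def a_def cosh_def exp_minus power2_eq_square field_simps)
    finally show ?thesis by (simp add: H_def)
  qed
  have der: "(g has_field_derivative g v) (at v within UNIV)" for v
    unfolding g_def by (auto intro!: derivative_eq_intros)
  have inj: "inj_on g UNIV" using k by (auto simp: g_def inj_on_def)
  have m: "(\<lambda>v. of_real \<bar>g v\<bar> * h (g v)) \<in> borel_measurable borel"
    unfolding g_def by measurable
  note C = set_integral_change_of_variables[of UNIV g g h, OF _ _ der inj _ m, unfolded gU gh]
  have "set_integrable lborel UNIV (\<lambda>v. of_real k powr \<nu> * H v)" using C(1) hi by simp
  from set_integrable_mult_right[OF this, of "1 / of_real k powr \<nu>"] have Hi: "integrable lborel H"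
    using k by (simp add: set_integrable_def)
  have "(LINT u:{0<..}|lborel. h u) = (LINT v|lborel. of_real k powr \<nu> * H v)"
    using C(2) hi by (simp add: set_lebesgue_integral_def)
  also have "\<dots> = of_real k powr \<nu> * (LINT v:{0<..}|lborel. H v + H (- v))"
    by (simp add: integral_over_line_split(1)[OF Hi])
  also have "(\<lambda>v. H v + H (- v)) = (\<lambda>v. 2 * (of_real (exp (- a * cosh v)) * cosh (\<nu> * of_real v)))"
    by (simp add: H_def cosh_def[of "_::complex"] fun_eq_iff scaleR_conv_of_real field_simps)
  also have "(LINT v:{0<..}|lborel. 2 * (of_real (exp (- a * cosh v)) * cosh (\<nu> * of_real v))) = 2 * bessel_K \<nu> a"
    by (simp add: bessel_K_def)
  finally show ?thesis
    using fourier_kernel_eq[OF y s, of x] by (simp add: h_def k_def a_def \<nu>_def)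
qed

subsection \<open>Fourier expansion of the periodised kernel\<close>

lemma Gamma_complex_nonzero: "Re s > 0 \<Longrightarrow> Gamma (s :: complex) \<noteq> 0"
  by (auto simp: Gamma_eq_zero_iff elim!: nonpos_Ints_cases)

lemma fourier_kernel_summable:
  assumes y: "y > 0" and s: "Re s \<ge> 1"
  shows "(\<lambda>n::int. fourier_kernel s y (of_int n)) summable_on UNIV"
proof -
  obtain C where C: "C \<ge> 0" "\<And>x. x \<noteq> 0 \<Longrightarrow> norm (fourier_kernel s y x) \<le> C / x\<^sup>2"
    using fourier_kernel_decay[OF y s] by blast
  define M where "M = max (norm (fourier_kernel s y 0)) (2 * C)"
  have M: "norm (fourier_kernel s y 0) \<le> M" "2 * C \<le> M" by (auto simp: M_def)
  have "(\<lambda>n::int. norm (fourier_kernel s y (of_int n))) summable_on UNIV"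
  proof (rule summable_on_comparison_test)
    show "(\<lambda>n::int. M * (1 / (1 + (of_int n)\<^sup>2))) summable_on UNIV"
      by (intro summable_on_cmult_right summable_on_int_inverse_square)
    show "norm (fourier_kernel s y (of_int n)) \<le> M * (1 / (1 + (of_int n)\<^sup>2))" for n :: int
    proof (cases "n = 0")
      case False
      define k where "k = real_of_int n"
      have k: "k\<^sup>2 \<ge> 1" unfolding k_def using False
        by (metis int_one_le_iff_zero_less of_int_1_le_iff of_int_power zero_less_power2)
      have "norm (fourier_kernel s y k) \<le> C / k\<^sup>2" using C(2)[of k] False by (simp add: k_def)
      also have "\<dots> \<le> 2 * C / (1 + k\<^sup>2)"
        using k C(1) mult_left_mono[OF k C(1)] by (simp add: divide_simps algebra_simps) 
      also have "\<dots> \<le> M / (1 + k\<^sup>2)" using M by (intro divide_right_mono) auto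
      finally show ?thesis by (simp add: k_def)
    qed (use M in simp)
  qed auto
  then show ?thesis by (simp only: summable_on_iff_abs_summable_on_complex)
qed

lemma kernel_poisson:
  assumes y: "y > 0" and s: "Re s \<ge> 1"
  shows "(\<lambda>m::int. complex_of_real ((x + of_int m)\<^sup>2 + y\<^sup>2) powr (- s)) summable_on UNIV"
    and "((\<lambda>n. fourier_kernel s y (of_int n) * ee (of_int n * x)) has_sum
      (\<Sum>\<^sub>\<infinity>m::int. complex_of_real ((x + of_int m)\<^sup>2 + y\<^sup>2) powr (- s))) UNIV"
proof -
  define g where "g t = complex_of_real (t\<^sup>2 + y\<^sup>2) powr (- s)" for t
  define g' where "g' t = - s * of_real (2 * t) * complex_of_real (t\<^sup>2 + y\<^sup>2) powr (- s - 1)" for t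
  have p: "t\<^sup>2 + y\<^sup>2 > 0" for t using y by (simp add: add_nonneg_pos)
  obtain C where C: "C \<ge> 0" "\<And>t. (t\<^sup>2 + y\<^sup>2) powr (- Re s) \<le> C / (1 + t\<^sup>2)"
    using inverse_quadratic_bound[OF y s] by blast
  \<comment> \<open>One constant for both decay hypotheses: C serves for g, and |s|/y times C for
    g', because 2|t| \<le> (t^2 + y^2)/y.\<close>
  define D where "D = max C (norm s / y * C)"
  have D: "C \<le> D" "norm s / y * C \<le> D" by (auto simp: D_def)
  have der: "(g has_vector_derivative g' t) (at t)" for t
  proof -
    have np: "complex_of_real (t\<^sup>2 + y\<^sup>2) \<notin> \<real>\<^sub>\<le>\<^sub>0"
      using p[of t] complex_nonpos_Reals_iff by force
    have "((\<lambda>w. (w\<^sup>2 + of_real (y\<^sup>2)) powr (- s)) has_field_derivative (- s) * ((of_real t)\<^sup>2 + of_real (y\<^sup>2)) powr (- s - 1) * (2 * of_real t)) (at (complex_of_real t))"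
      using np by (auto intro!: derivative_eq_intros)
    from has_vector_derivative_real_field[OF this]
    show ?thesis by (simp add: g_def[abs_def] g'_def mult_ac)
  qed
  have gb: "norm (g t) \<le> D / (1 + t\<^sup>2)" for t
  proof -
    have "norm (g t) = (t\<^sup>2 + y\<^sup>2) powr (- Re s)" unfolding g_def using p[of t] by (subst norm_of_real_powr) auto
    also have "\<dots> \<le> C / (1 + t\<^sup>2)" by (rule C)
    also have "\<dots> \<le> D / (1 + t\<^sup>2)" using D by (intro divide_right_mono) auto
    finally show ?thesis .
  qed
  have gb': "norm (g' t) \<le> D / (1 + t\<^sup>2)" for t
  proof -
    have t: "2 * \<bar>t\<bar> \<le> (t\<^sup>2 + y\<^sup>2) / y"
    proof -
      have "0 \<le> (\<bar>t\<bar> - y)\<^sup>2" by simp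
      then have "2 * \<bar>t\<bar> * y \<le> t\<^sup>2 + y\<^sup>2" by (simp add: power2_eq_square algebra_simps)
      then show ?thesis using y by (simp add: field_simps)
    qed
    have "norm (g' t) = norm s * (2 * \<bar>t\<bar>) * (t\<^sup>2 + y\<^sup>2) powr (- Re s - 1)"
      unfolding g'_def norm_mult using p[of t] by (subst norm_of_real_powr) auto
    also have "\<dots> \<le> norm s * ((t\<^sup>2 + y\<^sup>2) / y) * (t\<^sup>2 + y\<^sup>2) powr (- Re s - 1)"
      using t by (intro mult_right_mono mult_left_mono) auto
    also have "\<dots> = norm s / y * (t\<^sup>2 + y\<^sup>2) powr (- Re s)"
      using p[of t] by (simp add: powr_diff)
    also have "\<dots> \<le> norm s / y * (C / (1 + t\<^sup>2))" using y C(2) by (intro mult_left_mono) auto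
    also have "\<dots> \<le> D / (1 + t\<^sup>2)"
      using D divide_right_mono[OF D(2), of "1 + t\<^sup>2"] by simp
    finally show ?thesis .
  qed
  note P = poisson_summation[OF der gb gb', of "\<lambda>n. fourier_kernel s y (of_int n)" x]
  show "(\<lambda>m::int. complex_of_real ((x + of_int m)\<^sup>2 + y\<^sup>2) powr (- s)) summable_on UNIV"
    and "((\<lambda>n. fourier_kernel s y (of_int n) * ee (of_int n * x)) has_sum
      (\<Sum>\<^sub>\<infinity>m::int. complex_of_real ((x + of_int m)\<^sup>2 + y\<^sup>2) powr (- s))) UNIV"
    using P fourier_kernel_summable[OF y s] by (simp_all add: fourier_kernel_def g_def)
qed

text \<open>This is what makes Fourier coefficients with respect to \<open>whittaker_W\<close>
  unique. If the Bessel function vanished on the positive axis, Poisson summation would equate the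
  sum of (m^2 + y^2)^(-s) with its constant term, of size C y^(1 - 2\<sigma>). The single term m = 0
  has size y^(-2\<sigma>) and the others together at most T, which is impossible for small
  y.\<close>

lemma bessel_K_nonvanishing:
  assumes "Re \<nu> \<ge> 1 / 2"
  obtains a where "a > 0" "bessel_K \<nu> a \<noteq> 0"
proof (rule ccontr)
  assume "\<not> thesis"
  with that have K: "bessel_K \<nu> a = 0" if "a > 0" for a using \<open>a > 0\<close> by blast
  define s where "s = \<nu> + 1 / 2"
  have s: "Re s \<ge> 1" using assms by (simp add: s_def)
  have Gs: "Gamma s \<noteq> 0" using s by (intro Gamma_complex_nonzero) auto
  have F0: "fourier_kernel s y x = 0" if "y > 0" "x \<noteq> 0" for x y
    using fourier_kernel_bessel[OF that(1) s that(2)] K[of "2 * pi * \<bar>x\<bar> * y"] that Gs by (simp add: s_def)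
  define C where "C = norm (of_real (sqrt pi) * Gamma (s - 1 / 2) / Gamma s)"
  define T where "T = (\<Sum>\<^sub>\<infinity>m::int. 2 * (1 / (1 + (of_int m)\<^sup>2)) :: real)"
  have Ts: "(\<lambda>m::int. 2 * (1 / (1 + (of_int m)\<^sup>2)) :: real) summable_on UNIV"
    by (intro summable_on_cmult_right summable_on_int_inverse_square)
  have T0: "T \<ge> 0" unfolding T_def by (intro infsum_nonneg) auto
  \<comment> \<open>Multiplying the final inequality by y^(2\<sigma>) gives 1 \<le> C y + T
    y^(2\<sigma>) \<le> (C + T) y; this y makes the right side smaller than 1.\<close>
  define y where "y = 1 / (2 * (T + C + 1))"
  have C0: "C \<ge> 0" by (simp add: C_def)
  have y: "0 < y" "y \<le> 1" "(T + C) * y < 1" using T0 C0 by (simp_all add: y_def field_simps)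
  define \<sigma> where "\<sigma> = Re s"
  have \<sigma>: "\<sigma> \<ge> 1" using s by (simp add: \<sigma>_def)
  define g where "g m = complex_of_real ((0 + of_int m)\<^sup>2 + y\<^sup>2) powr (- s)" for m :: int
  note P = kernel_poisson[OF y(1) s, of 0, folded g_def]
  have ng: "norm (g m) = ((of_int m)\<^sup>2 + y\<^sup>2) powr (- \<sigma>)" for m
  proof -
    have "(of_int m)\<^sup>2 + y\<^sup>2 > 0" using y by (simp add: add_nonneg_pos)
    then show ?thesis by (simp only: g_def \<sigma>_def norm_of_real_powr uminus_complex.sel add_0)
  qed
  have "((\<lambda>n. fourier_kernel s y (of_int n) * ee (of_int n * 0)) has_sum fourier_kernel s y 0) UNIV"
  proof (rule has_sum_cong_neutral[THEN iffD2])
    show "((\<lambda>n. fourier_kernel s y (of_int n) * ee (of_int n * 0)) has_sum fourier_kernel s y 0) {0}"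
      by (rule has_sum_finiteI) auto
  qed (use y F0 in auto)
  with P(2) have "(\<Sum>\<^sub>\<infinity>m. g m) = fourier_kernel s y 0" by (rule has_sum_unique)
  also have "norm \<dots> = C * y powr (1 - 2 * \<sigma>)"
  proof -
    have "fourier_kernel s y 0 = of_real (sqrt pi) * Gamma (s - 1 / 2) / Gamma s * of_real (y\<^sup>2) powr (1 / 2 - s)"
      using fourier_kernel_0[OF y(1) s] Gs by (simp add: field_simps)
    then have "norm (fourier_kernel s y 0) = C * (y\<^sup>2) powr (1 / 2 - \<sigma>)"
      using y by (simp only: norm_mult C_def) (subst norm_of_real_powr, auto simp: \<sigma>_def)
    also have "(y\<^sup>2) powr (1 / 2 - \<sigma>) = y powr (1 - 2 * \<sigma>)"
      using y by (simp add: powr_powr flip: powr_numeral)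
    finally show ?thesis .
  qed
  finally have up: "norm (\<Sum>\<^sub>\<infinity>m. g m) = C * y powr (1 - 2 * \<sigma>)" .
  have split: "(\<Sum>\<^sub>\<infinity>m. g m) = g 0 + (\<Sum>\<^sub>\<infinity>m\<in>UNIV - {0}. g m)"
  proof -
    have "(\<Sum>\<^sub>\<infinity>m\<in>{0} \<union> (UNIV - {0}). g m) = (\<Sum>\<^sub>\<infinity>m\<in>{0}. g m) + (\<Sum>\<^sub>\<infinity>m\<in>UNIV - {0}. g m)"
      by (intro infsum_Un_disjoint summable_on_subset_banach[OF P(1)]) auto
    then show ?thesis by (simp add: Un_absorb1)
  qed
  have rest: "norm (\<Sum>\<^sub>\<infinity>m\<in>UNIV - {0}. g m) \<le> T"
  proof -
    have "norm (\<Sum>\<^sub>\<infinity>m\<in>UNIV - {0}. g m) \<le> (\<Sum>\<^sub>\<infinity>m\<in>UNIV - {0::int}. 2 * (1 / (1 + (of_int m)\<^sup>2)) :: real)"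
    proof (rule norm_infsum_le)
      show "(g has_sum infsum g (UNIV - {0})) (UNIV - {0})"
        by (intro has_sum_infsum summable_on_subset_banach[OF P(1)]) auto
      show "((\<lambda>m::int. 2 * (1 / (1 + (of_int m)\<^sup>2)) :: real) has_sum (\<Sum>\<^sub>\<infinity>m\<in>UNIV - {0::int}. 2 * (1 / (1 + (of_int m)\<^sup>2)) :: real)) (UNIV - {0})"
        by (intro has_sum_infsum summable_on_subset_banach[OF Ts]) auto
      fix m :: int assume "m \<in> UNIV - {0}"
      define k where "k = real_of_int m"
      have k: "k\<^sup>2 \<ge> 1" unfolding k_def using \<open>m \<in> UNIV - {0}\<close>
        by (metis Diff_iff singletonI int_one_le_iff_zero_less of_int_1_le_iff of_int_power zero_less_power2)
      have "norm (g m) \<le> (k\<^sup>2 + y\<^sup>2) powr (- 1)"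
        unfolding ng k_def[symmetric] using \<sigma> k by (intro powr_mono) (auto intro: add_increasing2)
      also have "\<dots> \<le> 2 * (1 / (1 + k\<^sup>2))"
      proof -
        have "1 + k\<^sup>2 \<le> 2 * (k\<^sup>2 + y\<^sup>2)" using k zero_le_power2[of y] by (simp only: distrib_left)
        moreover have "k\<^sup>2 + y\<^sup>2 > 0" using k zero_le_power2[of y] by linarith
        ultimately show ?thesis by (simp add: powr_minus divide_simps add_pos_nonneg)
      qed
      finally show "norm (g m) \<le> 2 * (1 / (1 + (of_int m)\<^sup>2))" by (simp add: k_def)
    qed
    also have "\<dots> \<le> T" unfolding T_def
      by (rule infsum_mono_neutral[OF summable_on_subset_banach[OF Ts] Ts]) auto
    finally show ?thesis .
  qed
  have "norm (g 0) = y powr (- 2 * \<sigma>)"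
    unfolding ng using y by (simp add: powr_powr flip: powr_numeral)
  moreover have "norm (g 0) \<le> norm (\<Sum>\<^sub>\<infinity>m. g m) + norm (\<Sum>\<^sub>\<infinity>m\<in>UNIV - {0}. g m)"
    unfolding split by (metis add_diff_cancel_right' norm_triangle_ineq4)
  ultimately have "y powr (- 2 * \<sigma>) \<le> C * y powr (1 - 2 * \<sigma>) + T" using up rest by linarith
  then have "y powr (- 2 * \<sigma>) * y powr (2 * \<sigma>) \<le> (C * y powr (1 - 2 * \<sigma>) + T) * y powr (2 * \<sigma>)"
    by (rule mult_right_mono) simp
  also have "\<dots> = C * (y powr (1 - 2 * \<sigma>) * y powr (2 * \<sigma>)) + T * y powr (2 * \<sigma>)" by (simp add: algebra_simps)
  also have "y powr (1 - 2 * \<sigma>) * y powr (2 * \<sigma>) = y" using y by (simp flip: powr_add)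
  also have "y powr (- 2 * \<sigma>) * y powr (2 * \<sigma>) = 1" using y by (simp flip: powr_add)
  also have "C * y + T * y powr (2 * \<sigma>) \<le> C * y + T * y"
    using y \<sigma> T0 powr_mono'[of 1 "2 * \<sigma>" y] by (intro add_left_mono mult_left_mono) auto
  finally show False using y(3) by (simp add: algebra_simps)
qed

text \<open>In y^s (pi |n| / y)^(s - 1/2) the powers of y combine to sqrt(y), which together with
  sqrt|n| belongs to the Whittaker function; sqrt(pi) completes the power of pi. What is left does
  not depend on z.\<close>

lemma fourier_kernel_whittaker:
  assumes y: "Im z > 0" and s: "Re s \<ge> 1" and n: "n \<noteq> (0::int)"
  shows "of_real (Im z) powr s * (fourier_kernel s (Im z) (of_int n) * ee (of_int n * Re z))
    = of_real pi powr s * of_real \<bar>of_int n\<bar> powr (s - 1) / Gamma s * whittaker_W s n z"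
proof -
  define y where "y = Im z"
  define k where "k = \<bar>real_of_int n\<bar>"
  have p: "y > 0" "k > 0" using assms by (auto simp: y_def k_def)
  have Gs: "Gamma s \<noteq> 0" using s by (intro Gamma_complex_nonzero) auto
  have a: "of_real (a * b) powr w = of_real a powr w * of_real b powr w" if "a > 0" "b > 0" for a b :: real and w :: complex
    using that by (simp add: powr_times_real)
  have b: "of_real (sqrt u) = complex_of_real u powr (1 / 2)" if "u > 0" for u
    using that powr_of_real[of u "1/2"] by (simp add: powr_half_sqrt)
  have "of_real (pi * k / y) powr (s - 1 / 2) = of_real pi powr (s - 1 / 2) * of_real k powr (s - 1 / 2) * of_real (inverse y) powr (s - 1 / 2)"
  proof -
    have "pi * k / y = (pi * k) * inverse y" by (simp add: divide_inverse)
    moreover have "of_real ((pi * k) * inverse y) powr (s - 1 / 2) = of_real (pi * k) powr (s - 1 / 2) * of_real (inverse y) powr (s - 1 / 2)"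
      by (rule a) (use p in simp_all)
    moreover have "of_real (pi * k) powr (s - 1 / 2) = of_real pi powr (s - 1 / 2) * of_real k powr (s - 1 / 2)"
      by (rule a) (use p in simp_all)
    ultimately show ?thesis by simp
  qed
  also have "complex_of_real (inverse y) powr (s - 1 / 2) = of_real y powr (1 / 2 - s)"
  proof -
    have "complex_of_real (inverse y) powr (s - 1 / 2) * of_real y powr (s - 1 / 2) = 1"
      using a[of "inverse y" y] p by simp
    moreover have "of_real y powr (1 / 2 - s) * of_real y powr (s - 1 / 2) = 1" using p by (simp flip: powr_add)
    ultimately show ?thesis using p by (metis mult_right_cancel mult_zero_right zero_neq_one)
  qed
  finally have e: "of_real (pi * k / y) powr (s - 1 / 2) = of_real pi powr (s - 1 / 2) * of_real k powr (s - 1 / 2) * of_real y powr (1 / 2 - s)" .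
  have pw: "of_real y powr s * of_real y powr (1 / 2 - s) = of_real (sqrt y)"
    "of_real (sqrt pi) * of_real pi powr (s - 1 / 2) = complex_of_real pi powr s"
    "of_real k powr (s - 1 / 2) = of_real k powr (s - 1) * complex_of_real (sqrt k)"
    using p by (simp_all add: b flip: powr_add)
  have "of_real y powr s * (Gamma s * fourier_kernel s y (of_int n)) =
     of_real pi powr s * of_real k powr (s - 1) * (2 * of_real (sqrt (k * y)) * bessel_K (s - 1 / 2) (2 * pi * k * y))"
  proof -
    have "of_real y powr s * (Gamma s * fourier_kernel s y (of_int n)) =
       2 * (of_real (sqrt pi) * of_real pi powr (s - 1 / 2)) * of_real k powr (s - 1 / 2)
         * (of_real y powr s * of_real y powr (1 / 2 - s)) * bessel_K (s - 1 / 2) (2 * pi * k * y)"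
    proof -
      have "real_of_int n \<noteq> 0" using n by simp
      from fourier_kernel_bessel[OF p(1) s this, folded k_def]
      show ?thesis by (simp only: e mult_ac)
    qed
    then show ?thesis unfolding pw by (simp add: real_sqrt_mult mult_ac)
  qed
  then have 1: "of_real y powr s * fourier_kernel s y (of_int n) =
     of_real pi powr s * of_real k powr (s - 1) / Gamma s * (2 * of_real (sqrt (k * y)) * bessel_K (s - 1 / 2) (2 * pi * k * y))"
    using Gs by (simp add: field_simps)
  have 2: "whittaker_W s n z = (2 * of_real (sqrt (k * y)) * bessel_K (s - 1 / 2) (2 * pi * k * y)) * ee (of_int n * Re z)"
    by (simp add: whittaker_W_def k_def y_def ee_exp mult_ac)
  show ?thesis
    unfolding 2 mult.assoc[symmetric] using 1 by (simp add: k_def y_def)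
qed

section \<open>Uniqueness of Fourier coefficients\<close>

lemma whittaker_W_separate: "whittaker_W s n z = whittaker_W s n (\<i> * of_real (Im z)) * ee (of_int n * Re z)"
  by (simp add: whittaker_W_def ee_exp mult_ac)

text \<open>Multiply by e(-kx) and integrate over a period. The constant D sits at frequency 0,
  which \<open>A\<close> omits, so it must vanish as well. The lemma serves both for the expansion
  of the Eisenstein series and for comparing q-coefficients in the Hecke relation.\<close>

lemma trigonometric_series_unique:
  assumes h: "\<And>x. ((\<lambda>n. c n * ee (of_int n * x)) has_sum D) A" and A: "0 \<notin> A"
  shows "D = 0" and "\<And>n. n \<in> A \<Longrightarrow> c n = 0"
proof -
  have cs: "(\<lambda>n. norm (c n)) summable_on A"
    using h[of 0] by (simp add: summable_on_iff_abs_summable_on_complex[symmetric]) (auto simp: summable_on_def)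
  have B: "((\<lambda>n. c n * (if n = k then 1 else 0)) has_sum (if k = 0 then D else 0)) A" for k
  proof -
    have e: "ee (of_int n * x) * ee (- (of_int k * x)) = ee (of_int (n - k) * x)" for n x
      by (simp add: ee_add[symmetric] algebra_simps)
    have "((\<lambda>n. LINT x:{0..<1}|lborel. c n * ee (of_int (n - k) * x)) has_sum (LINT x:{0..<1}|lborel. D * ee (of_int (- k) * x))) A"
    proof (rule set_integral_has_sum(2))
      show "set_integrable lborel {0..<1} (\<lambda>x. c n * ee (of_int (n - k) * x))" for n
        by (rule set_integrable_unit_interval[where B="norm (c n)"]) (auto simp: norm_mult)
      show "(\<lambda>n. LINT x:{0..<1}|lborel. norm (c n * ee (of_int (n - k) * x))) summable_on A"
        using cs by (simp add: norm_mult set_lebesgue_integral_def)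
      show "((\<lambda>n. c n * ee (of_int (n - k) * x)) has_sum D * ee (of_int (- k) * x)) A" for x
        using has_sum_cmult_left[OF h[of x], of "ee (- (of_int k * x))"] by (simp add: mult.assoc e)
    qed auto
    then show ?thesis
      by (simp only: set_integral_mult_right unit_interval_ee_integral) (simp add: if_distrib cong: if_cong)
  qed
  have "((\<lambda>n. c n * (if n = 0 then 1 else 0)) has_sum 0) A" by (rule has_sum_0) (use A in auto)
  from has_sum_unique[OF B[of 0] this] show "D = 0" by simp
  show "c n = 0" if n: "n \<in> A" for n
  proof -
    have "((\<lambda>m. c m * (if m = n then 1 else 0)) has_sum c n) A"
    proof (rule has_sum_cong_neutral[THEN iffD2])
      show "((\<lambda>m. c m * (if m = n then 1 else 0)) has_sum c n) {n}" by (rule has_sum_finiteI) auto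
    qed (use n in auto)
    moreover have "n \<noteq> 0" using n A by auto
    ultimately show ?thesis using has_sum_unique[OF _ B[of n]] by fastforce
  qed
qed

text \<open>At fixed y the difference of two expansions is a trigonometric series without constant
  term whose sum (b - a) y^(1-s) does not depend on x.\<close>

lemma fourier_expansion_unique:
  assumes s: "Re s \<ge> 1" and p: "is_fourier_expansion N f chi s p" and q: "is_fourier_expansion N f chi s q"
  shows "p = q"
proof -
  obtain a \<phi> where p': "p = (a, \<phi>)" by (cases p)
  obtain b \<psi> where q': "q = (b, \<psi>)" by (cases q)
  have 0: "\<phi> 0 = 0" "\<psi> 0 = 0" using p q by (auto simp: is_fourier_expansion_def p' q')
  have h: "((\<lambda>n. (\<phi> n - \<psi> n) * whittaker_W s n (\<i> * of_real y) * ee (of_int n * x)) has_sum (b - a) * of_real y powr (1 - s)) {n. n \<noteq> 0}"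
    if y: "y > 0" for x y
  proof -
    define z where "z = Complex x y"
    have z: "z \<in> upper_half_plane" using y by (simp add: z_def upper_half_plane_def)
    have "((\<lambda>n. \<phi> n * whittaker_W s n z - \<psi> n * whittaker_W s n z) has_sum
      ((eisenstein_star N f chi z s - a * of_real (Im z) powr (1 - s)) - (eisenstein_star N f chi z s - b * of_real (Im z) powr (1 - s)))) {n. n \<noteq> 0}"
      using p q z by (intro has_sum_diff) (auto simp: is_fourier_expansion_def p' q')
    moreover have "\<phi> n * whittaker_W s n z - \<psi> n * whittaker_W s n z = (\<phi> n - \<psi> n) * whittaker_W s n (\<i> * of_real y) * ee (of_int n * x)" for n
    proof -
      have "whittaker_W s n z = whittaker_W s n (\<i> * of_real y) * ee (of_int n * x)"
        using whittaker_W_separate[of s n z] by (simp add: z_def)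
      then show ?thesis by (simp only: left_diff_distrib mult.assoc)
    qed
    moreover have "(eisenstein_star N f chi z s - a * of_real (Im z) powr (1 - s)) - (eisenstein_star N f chi z s - b * of_real (Im z) powr (1 - s)) = (b - a) * of_real y powr (1 - s)"
      by (simp add: z_def algebra_simps)
    ultimately show ?thesis by simp
  qed
  have ab: "a = b" using trigonometric_series_unique(1)[OF h[of 1]] by simp
  have "\<phi> n = \<psi> n" for n
  proof (cases "n = 0")
    case False
    obtain a where a: "a > 0" "bessel_K (s - 1 / 2) a \<noteq> 0"
      using bessel_K_nonvanishing[of "s - 1 / 2"] s by auto
    \<comment> \<open>The height is chosen for each n so that the Bessel argument 2 pi |n| y is the
      point \<open>a\<close> at which the Bessel function is known not to vanish.\<close>
    define y where "y = a / (2 * pi * \<bar>real_of_int n\<bar>)"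
    have y: "y > 0" using a False by (simp add: y_def)
    have "2 * pi * \<bar>real_of_int n\<bar> * y = a" using False by (simp add: y_def)
    then have "whittaker_W s n (\<i> * of_real y) \<noteq> 0"
      using a y False by (simp add: whittaker_W_def)
    moreover have "(\<phi> n - \<psi> n) * whittaker_W s n (\<i> * of_real y) = 0"
      using trigonometric_series_unique(2)[OF h[OF y]] False by simp
    ultimately show ?thesis by simp
  qed (use 0 in simp)
  with ab show ?thesis by (auto simp: p' q')
qed

subsection \<open>Continuation of Dirichlet series by Mellin transforms\<close>

text \<open>Two candidate continuations agree where both represent the series, that is to the right
  of \<open>M\<close>, and hence on the common half-plane to the right of \<open>m\<close>, which is
  connected and contains t0.\<close>

lemma continued_dirichlet_series_eqI:
  assumes "\<alpha> < Re t0" "F holomorphic_on {t. Re t > \<alpha>}"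
    and "\<And>t. Re t > \<beta> \<Longrightarrow> ((\<lambda>n. c n * of_nat n powr (- t)) has_sum F t) A"
  shows "continued_dirichlet_series A c t0 = F t0"
  unfolding continued_dirichlet_series_def
proof (rule the_equality)
  show "\<exists>F' \<alpha> \<beta>. \<alpha> < Re t0 \<and> F' holomorphic_on {t. Re t > \<alpha>} \<and>
        (\<forall>t. Re t > \<beta> \<longrightarrow> ((\<lambda>n. c n * of_nat n powr (- t)) has_sum F' t) A) \<and> F t0 = F' t0"
    using assms by blast
next
  fix v
  assume "\<exists>F' \<alpha> \<beta>. \<alpha> < Re t0 \<and> F' holomorphic_on {t. Re t > \<alpha>} \<and>
        (\<forall>t. Re t > \<beta> \<longrightarrow> ((\<lambda>n. c n * of_nat n powr (- t)) has_sum F' t) A) \<and> v = F' t0"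
  then obtain F' \<alpha>' \<beta>' where F': "\<alpha>' < Re t0" "F' holomorphic_on {t. Re t > \<alpha>'}"
    "\<And>t. Re t > \<beta>' \<Longrightarrow> ((\<lambda>n. c n * of_nat n powr (- t)) has_sum F' t) A" and v: "v = F' t0" by blast
  define m where "m = max \<alpha> \<alpha>'"
  define M where "M = max m (max \<beta> \<beta>')"
  have "F' t0 = F t0"
  proof (rule analytic_continuation_open[of "{t. Re t > M}" "{t. Re t > m}" F' F])
    show "open {t. Re t > M}" "open {t. Re t > m}" by (simp_all add: open_halfspace_Re_gt)
    have "complex_of_real (M + 1) \<in> {t. Re t > M}" by simp
    then show "{t. Re t > M} \<noteq> {}" by blast
    show "connected {t. Re t > m}" by (intro convex_connected convex_halfspace_Re_gt)
    show "{t. Re t > M} \<subseteq> {t. Re t > m}" by (auto simp: M_def)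
    show "F' holomorphic_on {t. Re t > m}" "F holomorphic_on {t. Re t > m}"
      by (auto intro: holomorphic_on_subset[OF F'(2)] holomorphic_on_subset[OF assms(2)] simp: m_def)
    show "t0 \<in> {t. Re t > m}" using assms(1) F'(1) by (simp add: m_def)
    show "F' z = F z" if "z \<in> {t. Re t > M}" for z
      using that assms(3)[of z] F'(3)[of z] by (auto simp: M_def intro: has_sum_unique)
  qed
  then show "v = F t0" using v by simp
qed

text \<open>Turns a factor exp(r |ln y|) into a shift of the Mellin exponent by r in both
  directions.\<close>

lemma exp_ln_bound:
  fixes y r :: real
  assumes "y > 0" "r \<ge> 0"
  shows "exp (r * \<bar>ln y\<bar>) \<le> y powr r + y powr (- r)"
  using assms by (cases "ln y \<ge> 0") (auto simp: powr_def)

text \<open>Expanding $y^{t-1} = y^{t_0-1} \sum_k (t-t_0)^k (\ln y)^k/k!$ under the integral shows that the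
  Mellin transform is given by a power series near every point of the strip of convergence.\<close>

lemma mellin_holomorphic:
  fixes \<Phi> :: "real \<Rightarrow> complex"
  assumes [measurable]: "\<Phi> \<in> borel_measurable borel"
    and i: "\<And>\<sigma>. \<sigma> > \<alpha> \<Longrightarrow> set_integrable lborel {0<..} (\<lambda>y. norm (\<Phi> y) * y powr (\<sigma> - 1))"
  shows "(\<lambda>t. LINT y:{0<..}|lborel. \<Phi> y * of_real y powr (t - 1)) holomorphic_on {t. Re t > \<alpha>}"
proof -
  define M where "M t = (LINT y:{0<..}|lborel. \<Phi> y * of_real y powr (t - 1))" for t
  have "M field_differentiable (at t0)" if t0: "Re t0 > \<alpha>" for t0
  proof -
    define r where "r = (Re t0 - \<alpha>) / 2"
    have r: "r > 0" "Re t0 - r > \<alpha>" "Re t0 + r > \<alpha>" using t0 by (auto simp: r_def field_simps)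
    define c where "c k = (LINT y:{0<..}|lborel. \<Phi> y * of_real y powr (t0 - 1) * of_real (ln y) ^ k / fact k)" for k :: nat
    \<comment> \<open>\<open>E\<close> dominates every partial sum of the logarithmic expansion for
      |w - t0| \<le> r. Since r is half the distance from t0 to the line Re t = \<alpha>, both
      shifted exponents stay in the region where the integral converges.\<close>
    define E where "E y = norm (\<Phi> y) * y powr (Re t0 + r - 1) + norm (\<Phi> y) * y powr (Re t0 - r - 1)" for y
    have Ei: "set_integrable lborel {0<..} E"
      unfolding E_def by (intro set_integral_add(1) i r)
    have S: "(\<lambda>k. c k * (w - t0) ^ k) sums M w" if w: "w \<in> ball t0 r" for w
    proof -
      define h where "h k y = \<Phi> y * of_real y powr (t0 - 1) * of_real (ln y) ^ k / fact k * (w - t0) ^ k" for k :: nat and y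
      have [measurable]: "h k \<in> borel_measurable borel" for k unfolding h_def by measurable
      have nw: "norm (w - t0) \<le> r" using w by (simp add: dist_norm norm_minus_commute)
      have nh: "norm (h k y) = norm (\<Phi> y) * y powr (Re t0 - 1) * ((norm (w - t0) * \<bar>ln y\<bar>) ^ k /\<^sub>R fact k)" if "y > 0" for k y
        using that by (simp add: h_def norm_mult norm_divide norm_power norm_of_real_powr power_mult_distrib field_simps)
      have hE: "(\<Sum>k\<in>K. norm (h k y)) \<le> E y" if y: "y > 0" and K: "finite K" for K y
      proof -
        have "(\<Sum>k\<in>K. (norm (w - t0) * \<bar>ln y\<bar>) ^ k /\<^sub>R fact k) \<le> exp (norm (w - t0) * \<bar>ln y\<bar>)"
          unfolding exp_def using K by (intro sum_le_suminf summable_exp_generic) auto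
        also have "\<dots> \<le> exp (r * \<bar>ln y\<bar>)" using nw by (simp add: mult_right_mono)
        also have "\<dots> \<le> y powr r + y powr (- r)" using y r by (intro exp_ln_bound) auto
        finally have "norm (\<Phi> y) * y powr (Re t0 - 1) * (\<Sum>k\<in>K. (norm (w - t0) * \<bar>ln y\<bar>) ^ k /\<^sub>R fact k)
           \<le> norm (\<Phi> y) * y powr (Re t0 - 1) * (y powr r + y powr (- r))" by (intro mult_left_mono) auto
        also have "\<dots> = E y"
          using y by (simp add: E_def ring_distribs mult.assoc flip: powr_add) (simp add: algebra_simps)
        finally show ?thesis using y by (simp add: nh sum_distrib_left)
      qed
      have hi: "set_integrable lborel {0<..} (h k)" for k
        by (rule set_integrable_dominated(1)[OF Ei]) (use hE[of _ "{k}"] in auto)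
      have "(\<lambda>k. LINT y:{0<..}|lborel. h k y) sums M w"
      proof (rule has_sum_imp_sums)
        show "((\<lambda>k. LINT y:{0<..}|lborel. h k y) has_sum M w) UNIV"
          unfolding M_def
        proof (rule set_integral_has_sum(2)[OF _ hi])
          show "(\<lambda>k. LINT y:{0<..}|lborel. norm (h k y)) summable_on UNIV"
          proof (rule nonneg_bdd_above_summable_on)
            show "bdd_above (sum (\<lambda>k. LINT y:{0<..}|lborel. norm (h k y)) ` {F. F \<subseteq> UNIV \<and> finite F})"
            proof (rule bdd_aboveI2)
              fix K :: "nat set" assume "K \<in> {F. F \<subseteq> UNIV \<and> finite F}"
              then have K: "finite K" by simp
              have n: "set_integrable lborel {0<..} (\<lambda>y. norm (h k y))" for k
                by (rule set_integrable_norm[OF hi])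
              have "(\<Sum>k\<in>K. LINT y:{0<..}|lborel. norm (h k y)) = (LINT y:{0<..}|lborel. (\<Sum>k\<in>K. norm (h k y)))"
                using n unfolding set_integrable_def set_lebesgue_integral_def scaleR_sum_right
                by (intro Bochner_Integration.integral_sum[symmetric]) auto
              also have "\<dots> \<le> (LINT y:{0<..}|lborel. E y)"
              proof (rule set_integral_mono[OF _ Ei])
                show "set_integrable lborel {0<..} (\<lambda>y. \<Sum>k\<in>K. norm (h k y))"
                  using n unfolding set_integrable_def scaleR_sum_right by (intro Bochner_Integration.integrable_sum) auto
              qed (use hE K in auto)
              finally show "(\<Sum>k\<in>K. LINT y:{0<..}|lborel. norm (h k y)) \<le> (LINT y:{0<..}|lborel. E y)" .
            qed
          qed (auto simp: set_lebesgue_integral_def intro!: integral_nonneg_AE)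
          show "((\<lambda>k. h k y) has_sum \<Phi> y * of_real y powr (w - 1)) UNIV" if "y \<in> {0<..}" for y
          proof (rule norm_summable_imp_has_sum)
            have y: "y > 0" using that by simp
            show "summable (\<lambda>k. norm (h k y))"
              by (rule summableI_nonneg_bounded[of _ "E y"]) (use hE y in auto)
            have "(\<lambda>k. ((w - t0) * of_real (ln y)) ^ k /\<^sub>R fact k) sums exp ((w - t0) * of_real (ln y))"
              by (rule exp_converges)
            from sums_mult[OF this, of "\<Phi> y * of_real y powr (t0 - 1)"]
            have "(\<lambda>k. h k y) sums (\<Phi> y * (of_real y powr (t0 - 1) * exp ((w - t0) * of_real (ln y))))"
              by (simp only: h_def power_mult_distrib scaleR_conv_of_real divide_inverse of_real_inverse of_real_fact mult_ac)
            also have "of_real y powr (t0 - 1) * exp ((w - t0) * of_real (ln y)) = of_real y powr (w - 1)"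
              using y by (simp add: powr_def mult_exp_exp Ln_of_real algebra_simps)
            finally show "(\<lambda>k. h k y) sums (\<Phi> y * of_real y powr (w - 1))" .
          qed
        qed auto
      qed
      moreover have "(LINT y:{0<..}|lborel. h k y) = c k * (w - t0) ^ k" for k
        unfolding h_def c_def by simp
      ultimately show ?thesis by simp
    qed
    have "M holomorphic_on ball t0 r"
      using S by (rule power_series_holomorphic)
    then show ?thesis using r by (auto simp: holomorphic_on_open field_differentiable_def)
  qed
  then show ?thesis
    unfolding M_def[symmetric] by (auto simp: holomorphic_on_def intro: field_differentiable_at_within)
qed

lemma zeta_real_summable: "\<sigma> > 1 \<Longrightarrow> (\<lambda>n::nat. real n powr (- \<sigma>)) summable_on {1..}"
proof -
  assume "\<sigma> > 1"
  then have "summable (\<lambda>n::nat. real n powr (- \<sigma>))" by (simp add: summable_real_powr_iff)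
  then have "(\<lambda>n::nat. real n powr (- \<sigma>)) summable_on UNIV" by (subst summable_on_UNIV_nonneg_real_iff) auto
  then show ?thesis by (rule summable_on_subset_banach) auto
qed

text \<open>Each exponential has Mellin transform Gamma(t) (2 pi l)^(-t). The integrals of the norms
  are at most a constant times l^(k - Re t), which is summable for Re t > k + 1.\<close>

lemma mellin_dirichlet_series:
  fixes b :: "nat \<Rightarrow> complex" and \<Phi> :: "real \<Rightarrow> complex"
  assumes b: "\<And>l. l \<ge> 1 \<Longrightarrow> norm (b l) \<le> C * real l powr k" and t: "Re t > 0" "Re t > k + 1"
    and \<Phi>: "\<And>y. y > 0 \<Longrightarrow> ((\<lambda>l. b l * of_real (exp (- (2 * pi * real l * y)))) has_sum \<Phi> y) {1..}"
  shows "((\<lambda>l. b l * of_nat l powr (- t)) has_sum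
           of_real (2 * pi) powr t / Gamma t * (LINT y:{0<..}|lborel. \<Phi> y * of_real y powr (t - 1))) {1..}"
    and "set_integrable lborel {0<..} (\<lambda>y. \<Phi> y * of_real y powr (t - 1))"
proof -
  define h where "h l y = b l * (of_real y powr (t - 1) * of_real (exp (- (2 * pi * real l * y))))" for l y
  have C0: "C \<ge> 0" using order_trans[OF norm_ge_zero b[of 1]] by simp
  have v: "2 * pi * real l > 0" if "l \<ge> 1" for l :: nat using that by simp
  have hi: "set_integrable lborel {0<..} (h l)" if "l \<in> {1..}" for l
    unfolding h_def using gamma_integral_scaled(1)[OF v, of l t] that t by (intro set_integrable_mult_right) auto
  have "(\<lambda>l. LINT y:{0<..}|lborel. norm (h l y)) summable_on {1..}"
  proof (rule summable_on_comparison_test)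
    show "(\<lambda>l. (C * (Gamma (Re t) * (2 * pi) powr (- Re t))) * real l powr (- (Re t - k))) summable_on {1..}"
      using t by (intro summable_on_cmult_right zeta_real_summable) auto
    show "0 \<le> (LINT y:{0<..}|lborel. norm (h l y))" for l
      by (auto simp: set_lebesgue_integral_def intro!: integral_nonneg_AE)
    fix l :: nat assume l: "l \<in> {1..}"
    have "(LINT y:{0<..}|lborel. norm (h l y)) = norm (b l) * (Gamma (Re t) * (2 * pi * real l) powr (- Re t))"
      using norm_gamma_integrand_integral[OF v, of l t] l t by (simp add: h_def norm_mult[of "b l"])
    also have "\<dots> \<le> (C * real l powr k) * (Gamma (Re t) * (2 * pi * real l) powr (- Re t))"
      using b[of l] l t by (intro mult_right_mono) auto
    also have "\<dots> = (C * (Gamma (Re t) * (2 * pi) powr (- Re t))) * (real l powr k * real l powr (- Re t))"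
      using l by (simp add: powr_mult)
    also have "real l powr k * real l powr (- Re t) = real l powr (- (Re t - k))"
      by (simp flip: powr_add)
    finally show "(LINT y:{0<..}|lborel. norm (h l y)) \<le> (C * (Gamma (Re t) * (2 * pi) powr (- Re t))) * real l powr (- (Re t - k))" .
  qed
  note * = set_integral_has_sum[OF _ hi this, of "\<lambda>y. \<Phi> y * of_real y powr (t - 1)"]
  have pw: "((\<lambda>l. h l y) has_sum \<Phi> y * of_real y powr (t - 1)) {1..}" if "y \<in> {0<..}" for y
    using has_sum_cmult_left[OF \<Phi>[of y], of "of_real y powr (t - 1)"] that by (simp add: h_def mult_ac)
  show "set_integrable lborel {0<..} (\<lambda>y. \<Phi> y * of_real y powr (t - 1))"
    using *(1) pw by auto
  have "((\<lambda>l. LINT y:{0<..}|lborel. h l y) has_sum (LINT y:{0<..}|lborel. \<Phi> y * of_real y powr (t - 1))) {1..}"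
    using *(2) pw by auto
  from has_sum_cmult_right[OF this, of "of_real (2 * pi) powr t / Gamma t"]
  show "((\<lambda>l. b l * of_nat l powr (- t)) has_sum
           of_real (2 * pi) powr t / Gamma t * (LINT y:{0<..}|lborel. \<Phi> y * of_real y powr (t - 1))) {1..}"
  proof (rule has_sum_cong[THEN iffD1, rotated])
    fix l :: nat assume l: "l \<in> {1..}"
    have G: "Gamma t \<noteq> 0" using t by (auto simp: Gamma_eq_zero_iff elim!: nonpos_Ints_cases)
    have "(LINT y:{0<..}|lborel. h l y) = b l * (Gamma t * of_real (2 * pi * real l) powr (- t))"
      using gamma_integral_scaled(2)[OF v, of l t] l t by (simp add: h_def)
    also have "complex_of_real (2 * pi * real l) powr (- t) = of_real (2 * pi) powr (- t) * of_nat l powr (- t)"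
      using l powr_times_real[of "of_real (2 * pi)" "of_real (real l)" "- t"] by simp
    finally show "of_real (2 * pi) powr t / Gamma t * (LINT y:{0<..}|lborel. h l y) = b l * of_nat l powr (- t)"
      using G by (simp add: powr_minus field_simps)
  qed
qed

text \<open>Two independent abscissas: \<open>k + 1\<close>, where the coefficient bound makes the
  series converge, and \<open>\<alpha>\<close>, where the Mellin integral of \<Phi> converges. The
  gap between them is the continuation.\<close>

lemma continued_dirichlet_series_mellin:
  fixes b :: "nat \<Rightarrow> complex" and \<Phi> :: "real \<Rightarrow> complex"
  assumes b: "\<And>l. l \<ge> 1 \<Longrightarrow> norm (b l) \<le> C * real l powr k" and \<alpha>: "\<alpha> \<ge> 0"
    and [measurable]: "\<Phi> \<in> borel_measurable borel"
    and \<Phi>: "\<And>y. y > 0 \<Longrightarrow> ((\<lambda>l. b l * of_real (exp (- (2 * pi * real l * y)))) has_sum \<Phi> y) {1..}"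
    and i: "\<And>\<sigma>. \<sigma> > \<alpha> \<Longrightarrow> set_integrable lborel {0<..} (\<lambda>y. norm (\<Phi> y) * y powr (\<sigma> - 1))"
  defines "F \<equiv> \<lambda>t. of_real (2 * pi) powr t / Gamma t * (LINT y:{0<..}|lborel. \<Phi> y * of_real y powr (t - 1))"
  shows "F holomorphic_on {t. Re t > \<alpha>}"
    and "\<And>t. Re t > max 0 (k + 1) \<Longrightarrow> ((\<lambda>l. b l * of_nat l powr (- t)) has_sum F t) {1..}"
    and "Re t0 > \<alpha> \<Longrightarrow> continued_dirichlet_series {1..} b t0 = F t0"
proof -
  show h: "F holomorphic_on {t. Re t > \<alpha>}"
    unfolding F_def
  proof (intro holomorphic_on_mult holomorphic_on_divide mellin_holomorphic i)
    show "(\<lambda>t. complex_of_real (2 * pi) powr t) holomorphic_on {t. Re t > \<alpha>}"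
      by (intro holomorphic_intros)
    show "Gamma holomorphic_on {t. Re t > \<alpha>}"
      using \<alpha> by (intro holomorphic_Gamma) (auto elim!: nonpos_Ints_cases)
    show "Gamma t \<noteq> 0" if "t \<in> {t. Re t > \<alpha>}" for t
      using that \<alpha> by (auto simp: Gamma_eq_zero_iff elim!: nonpos_Ints_cases)
  qed auto
  show s: "((\<lambda>l. b l * of_nat l powr (- t)) has_sum F t) {1..}" if "Re t > max 0 (k + 1)" for t
    unfolding F_def using that by (intro mellin_dirichlet_series(1)[OF b _ _ \<Phi>]) auto
  show "continued_dirichlet_series {1..} b t0 = F t0" if "Re t0 > \<alpha>"
    using that h s by (rule continued_dirichlet_series_eqI)
qed

subsection \<open>Gauss sums of primitive characters\<close>

lemma ee_power: "ee x ^ n = ee (real n * x)"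
  by (simp only: ee_def Complex.DeMoivre mult_ac)

lemma sum_int_residues: "(\<Sum>d\<in>{0..<int n}. F d) = (\<Sum>k<n. F (int k))"
  by (rule sum.reindex_bij_witness[of _ int nat]) auto

lemma sum_ee_residues:
  assumes c: "c > (0::nat)"
  shows "(\<Sum>j\<in>{0..<int c}. ee (of_int (m * j) / of_nat c)) = (if int c dvd m then of_nat c else 0)"
proof -
  define z where "z = ee (of_int m / of_nat c)"
  have e: "ee (of_int (m * int j) / of_nat c) = z ^ j" for j
    by (simp add: z_def ee_power mult_ac)
  have s: "(\<Sum>j\<in>{0..<int c}. ee (of_int (m * j) / of_nat c)) = (\<Sum>j<c. z ^ j)"
    unfolding sum_int_residues e ..
  show ?thesis
  proof (cases "int c dvd m")
    case True
    then obtain k where "m = int c * k" by (elim dvdE)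
    then have "z = 1" using c by (simp add: z_def)
    then show ?thesis using s True by simp
  next
    case False
    have "z \<noteq> 1"
    proof
      assume "z = 1"
      then obtain k :: int where "of_int m / of_nat c = (of_int k :: real)"
        by (auto simp: z_def ee_eq_1_iff elim: Ints_cases)
      then have "real_of_int m = real_of_int (k * int c)" using c by (simp add: field_simps)
      then have "m = k * int c" by (simp only: of_int_eq_iff)
      with False show False by simp
    qed
    moreover have "z ^ c = 1" using c ee_of_int[of m] by (simp add: z_def ee_power)
    ultimately show ?thesis using s False by (simp add: geometric_sum)
  qed
qed

section \<open>Values and Gauss sums of an even primitive character\<close>

locale even_primitive_char =
  fixes N :: nat and chi :: "int \<Rightarrow> complex"
  assumes N_gt_1: "N > 1" and primitive: "primitive_dirichlet_char N chi" and even: "chi (- 1) = 1"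
begin

lemma chi_mult: "chi (m * n) = chi m * chi n"
  and chi_period: "chi (n + int N) = chi n"
  and chi_nonzero_iff: "chi n \<noteq> 0 \<longleftrightarrow> coprime n (int N)"
  using primitive by (auto simp: primitive_dirichlet_char_def dirichlet_char_def)

lemma chi_minus: "chi (- n) = chi n"
  using chi_mult[of "- 1" n] even by simp

lemma chi_abs: "chi \<bar>n\<bar> = chi n"
  by (simp add: abs_if chi_minus)

lemma chi_add_mult: "chi (n + int N * k) = chi n"
proof -
  have *: "chi (n + int N * int j) = chi n" for n j
  proof (induction j)
    case (Suc j)
    then show ?case using chi_period[of "n + int N * int j"] by (simp add: algebra_simps)
  qed simp
  show ?thesis
  proof (cases "k \<ge> 0")
    case True
    then show ?thesis using *[of n "nat k"] by simp
  next
    case False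
    then show ?thesis using *[of "n + int N * k" "nat (- k)"] by simp
  qed
qed

lemma chi_mod: "chi (n mod int N) = chi n"
  using chi_add_mult[of "n mod int N" "n div int N"] by simp

lemma chi_cong: "[m = n] (mod int N) \<Longrightarrow> chi m = chi n"
  by (metis chi_mod cong_def)

lemma chi_0 [simp]: "chi 0 = 0"
  using chi_nonzero_iff[of 0] N_gt_1 by auto

lemma chi_1 [simp]: "chi 1 = 1"
  using chi_mult[of 1 1] chi_nonzero_iff[of 1] by simp

text \<open>Powers of a value are again values, of which there are only finitely many by
  periodicity; a value of modulus above 1 would have unbounded powers.\<close>

lemma norm_chi_le: "norm (chi n) \<le> 1"
proof (rule ccontr)
  assume "\<not> norm (chi n) \<le> 1"
  then have n: "norm (chi n) > 1" by simp
  define B where "B = Max (norm ` chi ` {0..<int N})"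
  have B: "norm (chi m) \<le> B" for m
  proof -
    have "norm (chi (m mod int N)) \<le> B"
      unfolding B_def using N_gt_1 by (intro Max_ge) auto
    then show ?thesis by (simp add: chi_mod)
  qed
  have p: "chi (n ^ k) = chi n ^ k" for k by (induction k) (auto simp: chi_mult)
  obtain k where "B < norm (chi n) ^ k" using real_arch_pow[OF n] by blast
  with B[of "n ^ k"] show False by (simp add: p norm_power)
qed

text \<open>Two moduli of at most 1 with product 1 are both 1, and on the unit circle the inverse is
  the conjugate.\<close>

lemma chi_cnj_inverse:
  assumes "chi k * chi k' = 1"
  shows "cnj (chi k') = chi k"
proof -
  have "norm (chi k) * norm (chi k') = 1" using assms by (metis norm_mult norm_one)
  moreover have "norm (chi k) * norm (chi k') \<le> 1 * norm (chi k')" using norm_chi_le by (intro mult_right_mono) auto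
  ultimately have "norm (chi k') = 1" using norm_chi_le[of k'] by linarith
  then have "chi k' * cnj (chi k') = 1" by (simp add: complex_norm_square[symmetric])
  with assms show ?thesis by (metis mult.commute mult.left_commute mult_1_right)
qed

lemma sum_residues_mult:
  assumes a: "coprime a (int N)" and F: "\<And>x. F (x mod int N) = F x"
  shows "(\<Sum>d\<in>{0..<int N}. F (a * d)) = (\<Sum>d\<in>{0..<int N}. F d :: complex)"
proof -
  obtain b where b: "[a * b = 1] (mod int N)" using cong_solve_coprime_int[OF a] by blast
  have 1: "(b * (a * d mod int N)) mod int N = d" if "d \<in> {0..<int N}" for d
  proof -
    have "[b * (a * d) = 1 * d] (mod int N)"
      using cong_scalar_right[OF b, of d] by (simp add: mult_ac)
    then show ?thesis using that by (simp add: mod_mult_right_eq cong_def)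
  qed
  have 2: "(a * (b * d mod int N)) mod int N = d" if "d \<in> {0..<int N}" for d
  proof -
    have "[a * (b * d) = 1 * d] (mod int N)"
      using cong_scalar_right[OF b, of d] by (simp add: mult_ac)
    then show ?thesis using that by (simp add: mod_mult_right_eq cong_def)
  qed
  show ?thesis
    by (rule sum.reindex_bij_witness[of _ "\<lambda>d. b * d mod int N" "\<lambda>d. a * d mod int N"])
       (use 1 2 N_gt_1 F in auto)
qed

text \<open>The minus sign is that of the phases of the q-expansion on the line above -d/N. Because
  chi is even, the value at k = 1 is still the ordinary Gauss sum.\<close>

definition twisted_gauss :: "int \<Rightarrow> complex" where
  "twisted_gauss k = (\<Sum>d\<in>{0..<int N}. cnj (chi d) * ee (- (of_int (k * d) / of_nat N)))"

lemma ee_mod: "ee (of_int (k * (x mod int N)) / of_nat N) = ee (of_int (k * x) / of_nat N)"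
proof -
  have "real_of_int x = of_int (x mod int N) + of_int (int N) * of_int (x div int N)"
    by (metis mod_mult_div_eq of_int_add of_int_mult)
  then have "of_int (k * x) / real N = of_int (k * (x mod int N)) / real N + of_int (k * (x div int N))"
    using N_gt_1 by (simp add: field_simps)
  then show ?thesis by (simp only: ee_add_int)
qed

lemma ee_mod': "ee (- (of_int (k * (x mod int N)) / of_nat N)) = ee (- (of_int (k * x) / of_nat N))"
  by (simp only: ee_minus ee_mod)

lemma twisted_gauss_1: "twisted_gauss 1 = gauss_sum N (conj_char chi)"
proof -
  have "twisted_gauss 1 = (\<Sum>d\<in>{0..<int N}. cnj (chi ((- 1) * d)) * ee (- (of_int (1 * ((- 1) * d)) / of_nat N)))"
    unfolding twisted_gauss_def
    by (rule sum_residues_mult[symmetric]) (simp_all only: ee_mod' chi_mod, simp)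
  also have "\<dots> = (\<Sum>d\<in>{0..<int N}. cnj (chi d) * ee (of_int d / of_nat N))"
    by (simp add: chi_minus)
  also have "\<dots> = gauss_sum N (conj_char chi)"
    unfolding sum_int_residues gauss_sum_def conj_char_def
    by (intro sum.cong) (auto simp: ee_exp)
  finally show ?thesis .
qed

text \<open>Separability for every k, including k not prime to N, is the point where primitivity
  enters. If g = gcd(k, N) > 1, choose n congruent to 1 modulo N/g with chi(n) \<noteq> 1. Then kn
  and k are congruent modulo N, so replacing d by nd multiplies the sum by a number different from
  1, and the sum is 0.\<close>

lemma twisted_gauss_eq: "twisted_gauss k = gauss_sum N (conj_char chi) * chi k"
proof (cases "coprime k (int N)")
  case True
  obtain k' where k': "[k * k' = 1] (mod int N)" using cong_solve_coprime_int[OF True] by blast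
  have ck: "coprime k' (int N)" using k' by (metis coprime_iff_invertible_int mult.commute)
  have c: "cnj (chi k') = chi k"
    using chi_cong[OF k'] by (intro chi_cnj_inverse) (simp add: chi_mult)
  have "twisted_gauss k = (\<Sum>d\<in>{0..<int N}. cnj (chi (k' * d)) * ee (- (of_int (k * (k' * d)) / of_nat N)))"
    unfolding twisted_gauss_def
    by (rule sum_residues_mult[OF ck, symmetric]) (simp only: ee_mod' chi_mod)
  also have "\<dots> = (\<Sum>d\<in>{0..<int N}. cnj (chi k') * (cnj (chi d) * ee (- (of_int (1 * d) / of_nat N))))"
  proof (rule sum.cong[OF refl])
    fix d
    have "[k * (k' * d) = d] (mod int N)" using cong_scalar_right[OF k', of d] by (simp add: mult_ac)
    then have "ee (- (of_int (1 * (k * (k' * d))) / of_nat N)) = ee (- (of_int (1 * d) / of_nat N))"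
      by (metis ee_mod' cong_def)
    then show "cnj (chi (k' * d)) * ee (- (of_int (k * (k' * d)) / of_nat N)) =
        cnj (chi k') * (cnj (chi d) * ee (- (of_int (1 * d) / of_nat N)))"
      by (simp add: chi_mult)
  qed
  also have "\<dots> = cnj (chi k') * twisted_gauss 1" by (simp add: twisted_gauss_def sum_distrib_left)
  finally show ?thesis by (simp add: c twisted_gauss_1)
next
  case False
  define g where "g = nat (gcd k (int N))"
  have gN: "int g dvd int N" "int g dvd k" by (auto simp: g_def)
  have g1: "g > 1"
  proof -
    have "gcd k (int N) > 0" using N_gt_1 by (simp add: gcd_pos_int)
    moreover have "gcd k (int N) \<noteq> 1" using False by (simp add: coprime_iff_gcd_eq_1)
    ultimately have "gcd k (int N) > 1" by linarith
    then show ?thesis by (simp add: g_def)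
  qed
  define M where "M = N div g"
  have "g dvd N" using gN by simp
  then have M: "N = M * g" by (simp add: M_def)
  have "M > 0" using M N_gt_1 by (cases "M = 0") auto
  then have "M dvd N" "M < N" using M g1 by auto
  then obtain n where n: "coprime n (int N)" "n mod int M = 1 mod int M" "chi n \<noteq> 1"
    using primitive unfolding primitive_dirichlet_char_def by blast
  have "int M dvd n - 1" using n(2) by (simp add: mod_eq_dvd_iff)
  then have "int M * int g dvd (n - 1) * k" using gN by (intro mult_dvd_mono)
  then have kn: "int N dvd k * n - k" by (simp add: M algebra_simps)
  have "twisted_gauss k = (\<Sum>d\<in>{0..<int N}. cnj (chi (n * d)) * ee (- (of_int (k * (n * d)) / of_nat N)))"
    unfolding twisted_gauss_def
    by (rule sum_residues_mult[OF n(1), symmetric]) (simp only: ee_mod' chi_mod)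
  also have "\<dots> = (\<Sum>d\<in>{0..<int N}. cnj (chi n) * (cnj (chi d) * ee (- (of_int (k * d) / of_nat N))))"
  proof (rule sum.cong[OF refl])
    fix d
    have "int N dvd (k * n - k) * d" using kn by simp
    then have "[k * (n * d) = k * d] (mod int N)" by (simp add: cong_iff_dvd_diff algebra_simps)
    then have "ee (- (of_int (1 * (k * (n * d))) / of_nat N)) = ee (- (of_int (1 * (k * d)) / of_nat N))"
      by (metis ee_mod' cong_def)
    then show "cnj (chi (n * d)) * ee (- (of_int (k * (n * d)) / of_nat N)) =
        cnj (chi n) * (cnj (chi d) * ee (- (of_int (k * d) / of_nat N)))"
      by (simp add: chi_mult)
  qed
  also have "\<dots> = cnj (chi n) * twisted_gauss k" by (simp add: twisted_gauss_def sum_distrib_left)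
  finally have "(1 - cnj (chi n)) * twisted_gauss k = 0" by (simp add: algebra_simps)
  moreover have "cnj (chi n) \<noteq> 1" using n(3) by (metis complex_cnj_cnj complex_cnj_one)
  ultimately have "twisted_gauss k = 0" by simp
  then show ?thesis using False chi_nonzero_iff[of k] by auto
qed

text \<open>Fourier inversion on Z/N at the residue 1: the sum of e(k/N)
  \<open>twisted_gauss k\<close> over k is N, whereas every twisted Gauss sum is a multiple of the
  one at k = 1.\<close>

lemma gauss_sum_nonzero: "gauss_sum N (conj_char chi) \<noteq> 0"
proof
  assume 0: "gauss_sum N (conj_char chi) = 0"
  have "(\<Sum>k\<in>{0..<int N}. ee (of_int k / of_nat N) * twisted_gauss k) =
    (\<Sum>k\<in>{0..<int N}. \<Sum>d\<in>{0..<int N}. cnj (chi d) * ee (of_int ((1 - d) * k) / of_nat N))"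
  proof (rule sum.cong[OF refl])
    fix k
    have "ee (of_int k / of_nat N) * ee (- (of_int (k * d) / of_nat N)) = ee (of_int ((1 - d) * k) / of_nat N)" for d
      unfolding ee_add[symmetric] by (rule arg_cong[of _ _ ee]) (simp add: algebra_simps diff_divide_distrib)
    then show "ee (of_int k / of_nat N) * twisted_gauss k = (\<Sum>d\<in>{0..<int N}. cnj (chi d) * ee (of_int ((1 - d) * k) / of_nat N))"
      unfolding twisted_gauss_def sum_distrib_left by (intro sum.cong refl) (metis mult.left_commute)
  qed
  also have "\<dots> = (\<Sum>d\<in>{0..<int N}. cnj (chi d) * (\<Sum>k\<in>{0..<int N}. ee (of_int ((1 - d) * k) / of_nat N)))"
    by (subst sum.swap) (simp add: sum_distrib_left)
  also have "\<dots> = (\<Sum>d\<in>{0..<int N}. cnj (chi d) * (if int N dvd 1 - d then of_nat N else 0))"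
    using N_gt_1 by (subst sum_ee_residues) auto
  also have "\<dots> = (\<Sum>d\<in>{0..<int N}. if d = 1 then of_nat N else 0)"
  proof (rule sum.cong[OF refl])
    fix d assume d: "d \<in> {0..<int N}"
    have "int N dvd 1 - d \<longleftrightarrow> d = 1"
    proof
      assume "int N dvd 1 - d"
      then have "1 mod int N = d mod int N" by (simp add: mod_eq_dvd_iff)
      then show "d = 1" using d N_gt_1 by simp
    qed simp
    then show "cnj (chi d) * (if int N dvd 1 - d then of_nat N else 0) = (if d = 1 then of_nat N else 0)" by simp
  qed
  also have "\<dots> = of_nat N" using N_gt_1 by (simp add: sum.delta)
  finally show False using 0 N_gt_1 by (simp add: twisted_gauss_eq)
qed

text \<open>Write d = r + N j. The character sees only r, so the sum over j modulo c' detects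
  whether c' divides m, and the sum over r is a twisted Gauss sum at m / c'.\<close>

lemma sum_chi_ee:
  assumes c: "c' > 0" 
  shows "(\<Sum>d\<in>{0..<int (N * c')}. cnj (chi d) * ee (- (of_int (m * d) / of_nat (N * c')))) =
    (if int c' dvd m then of_nat c' * gauss_sum N (conj_char chi) * chi (m div int c') else 0)"
proof -
  have N0: "N > 0" using N_gt_1 by simp
  have "(\<Sum>d\<in>{0..<int (N * c')}. cnj (chi d) * ee (- (of_int (m * d) / of_nat (N * c')))) =
    (\<Sum>(r, j)\<in>{0..<int N} \<times> {0..<int c'}. cnj (chi (r + int N * j)) * ee (- (of_int (m * (r + int N * j)) / of_nat (N * c'))))"
  proof (rule sum.reindex_bij_witness[of _ "\<lambda>(r, j). r + int N * j" "\<lambda>d. (d mod int N, d div int N)"])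
    fix b assume b: "b \<in> {0..<int N} \<times> {0..<int c'}"
    obtain r j where rj: "b = (r, j)" by (cases b)
    then have r: "0 \<le> r" "r < int N" "0 \<le> j" "j < int c'" using b by auto
    have "int N * j + int N \<le> int N * int c'" using r mult_left_mono[of "j + 1" "int c'" "int N"] by (simp add: algebra_simps)
    then show "(case b of (r, j) \<Rightarrow> r + int N * j) \<in> {0..<int (N * c')}" using r by (auto simp: rj)
    show "((case b of (r, j) \<Rightarrow> r + int N * j) mod int N, (case b of (r, j) \<Rightarrow> r + int N * j) div int N) = b"
      using r by (simp add: rj)
  next
    fix d assume d: "d \<in> {0..<int (N * c')}"
    have "d div int N < int c'"
    proof (rule ccontr)
      assume "\<not> d div int N < int c'"
      then have "int N * int c' \<le> int N * (d div int N)" by (intro mult_left_mono) auto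
      also have "\<dots> \<le> d"
        using mult_div_mod_eq[of "int N" d] pos_mod_sign[of "int N" d] N0 by linarith
      finally show False using d by simp
    qed
    then show "(d mod int N, d div int N) \<in> {0..<int N} \<times> {0..<int c'}"
      using d N0 by (auto simp: pos_imp_zdiv_nonneg_iff)
  qed (simp_all only: prod.case mod_mult_div_eq)
  also have "\<dots> = (\<Sum>r\<in>{0..<int N}. \<Sum>j\<in>{0..<int c'}. cnj (chi r) * ee (- (of_int (m * r) / of_nat (N * c'))) * ee (of_int ((- m) * j) / of_nat c'))"
    unfolding sum.cartesian_product[symmetric]
  proof (intro sum.cong refl)
    fix r j
    have "- (of_int (m * (r + int N * j)) / of_nat (N * c')) = - (of_int (m * r) / of_nat (N * c')) + of_int ((- m) * j) / real c'"
      using N0 c by (simp add: field_simps)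
    then have "ee (- (of_int (m * (r + int N * j)) / of_nat (N * c'))) = ee (- (of_int (m * r) / of_nat (N * c'))) * ee (of_int ((- m) * j) / real c')"
      by (simp only: ee_add)
    then show "cnj (chi (r + int N * j)) * ee (- (of_int (m * (r + int N * j)) / of_nat (N * c'))) =
      cnj (chi r) * ee (- (of_int (m * r) / of_nat (N * c'))) * ee (of_int ((- m) * j) / of_nat c')"
      by (simp only: chi_add_mult mult.assoc)
  qed
  also have "\<dots> = (\<Sum>r\<in>{0..<int N}. cnj (chi r) * ee (- (of_int (m * r) / of_nat (N * c')))) * (if int c' dvd - m then of_nat c' else 0)"
    unfolding sum_ee_residues[OF c, symmetric] sum_product ..
  also have "\<dots> = (if int c' dvd m then of_nat c' * gauss_sum N (conj_char chi) * chi (m div int c') else 0)"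
  proof (cases "int c' dvd m")
    case True
    then obtain k where k: "m = int c' * k" by (elim dvdE)
    have "(\<Sum>r\<in>{0..<int N}. cnj (chi r) * ee (- (of_int (m * r) / of_nat (N * c')))) = twisted_gauss k"
      unfolding twisted_gauss_def using c by (intro sum.cong) (auto simp: k)
    then show ?thesis using c by (simp add: k twisted_gauss_eq)
  qed simp
  finally show ?thesis .
qed

end

section \<open>Dirichlet series over the cusps equivalent to infinity\<close>

text \<open>Bottom rows with c > 0 and d reduced modulo c: these index the nontrivial double cosets
  of \<open>Gamma_inf N\<close> in \<open>Gamma0 N\<close>. The translates d + c m that were divided
  out are the variable of Poisson summation.\<close>

definition cusp_pairs :: "nat \<Rightarrow> (nat \<times> int) set" where
  "cusp_pairs N = {(c, d). c > 0 \<and> N dvd c \<and> 0 \<le> d \<and> d < int c \<and> coprime (int c) d}"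

text \<open>Coprimality is dropped so that for each c the sum over d runs over a complete residue
  system and can be evaluated by Gauss sums.\<close>

definition all_pairs :: "nat \<Rightarrow> (nat \<times> int) set" where
  "all_pairs N = Sigma {c. c > 0 \<and> N dvd c} (\<lambda>c. {0..<int c})"

lemma cusp_pairs_subset: "cusp_pairs N \<subseteq> all_pairs N"
  by (auto simp: cusp_pairs_def all_pairs_def)

lemma countable_cusp_pairs: "countable (cusp_pairs N)"
  by (rule countableI_type)

lemma norm_of_nat_powr: "n > 0 \<Longrightarrow> norm (complex_of_nat n powr w) = real n powr Re w"
  using norm_of_real_powr[of "real n" w] by simp

lemma all_pairs_summable:
  assumes "\<sigma> > 2"
  shows "(\<lambda>(c, d). real c powr (- \<sigma>)) summable_on all_pairs N"
  unfolding all_pairs_def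
proof (rule summable_on_SigmaI)
  show "((\<lambda>d. case (c, d) of (c, d) \<Rightarrow> real c powr (- \<sigma>)) has_sum real c * real c powr (- \<sigma>)) {0..<int c}" for c
    by (rule has_sum_finiteI) auto
  have "(\<lambda>c. real c * real c powr (- \<sigma>)) summable_on {1..}"
  proof (rule summable_on_cong[THEN iffD1])
    show "(\<lambda>c. real c powr (- (\<sigma> - 1))) summable_on {1..}"
      using assms by (intro zeta_real_summable) auto
    show "real c powr (- (\<sigma> - 1)) = real c * real c powr (- \<sigma>)" if "c \<in> {1..}" for c
      using that by (simp add: powr_diff powr_minus field_simps)
  qed
  then show "(\<lambda>c. real c * real c powr (- \<sigma>)) summable_on {c. c > 0 \<and> N dvd c}"
    by (rule summable_on_subset_banach) auto
qed auto

lemma cusp_pairs_summable: "\<sigma> > 2 \<Longrightarrow> (\<lambda>(c, d). real c powr (- \<sigma>)) summable_on cusp_pairs N"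
  by (rule summable_on_subset_banach[OF all_pairs_summable cusp_pairs_subset])

lemma nat_Dirichlet_summable:
  assumes "Re w > 1" and "\<And>n. n \<ge> 1 \<Longrightarrow> norm (b n) \<le> 1"
  shows "(\<lambda>n. norm (b n * complex_of_nat n powr (- w))) summable_on {1..}"
proof (rule summable_on_comparison_test)
  show "(\<lambda>n. real n powr (- Re w)) summable_on {1..}" using assms by (intro zeta_real_summable)
  show "norm (b n * complex_of_nat n powr (- w)) \<le> real n powr (- Re w)" if "n \<in> {1..}" for n
    using that assms(2)[of n] by (simp add: norm_mult norm_of_nat_powr mult_left_le_one_le)
qed auto

context even_primitive_char
begin

text \<open>For fixed c the terms form a Ramanujan sum twisted by the conjugate character; this is
  the Dirichlet series of these sums over the multiples c of N.\<close>

definition ramanujan_series :: "complex \<Rightarrow> int \<Rightarrow> complex" where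
  "ramanujan_series w m =
     (\<Sum>\<^sub>\<infinity>(c, d)\<in>cusp_pairs N. of_nat c powr (- w) * cnj (chi d) * ee (- (of_int (m * d) / of_nat c)))"

lemma pair_term_norm_le:
  assumes "c > 0"
  shows "norm (of_nat c powr (- w) * cnj (chi d) * ee x) \<le> real c powr (- Re w)"
  using assms norm_chi_le[of d] by (simp add: norm_mult norm_of_nat_powr mult_left_le)

lemma pair_series_summable:
  assumes w: "Re w > 2" and A: "A \<subseteq> all_pairs N"
  shows "(\<lambda>(c, d). of_nat c powr (- w) * cnj (chi d) * ee (x c d)) summable_on A"
proof -
  have "(\<lambda>p. norm (case p of (c, d) \<Rightarrow> of_nat c powr (- w) * cnj (chi d) * ee (x c d))) summable_on A"
  proof (rule summable_on_comparison_test)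
    show "(\<lambda>(c, d). real c powr (- Re w)) summable_on A"
      by (rule summable_on_subset_banach[OF all_pairs_summable[OF w] A])
    show "norm (case p of (c, d) \<Rightarrow> of_nat c powr (- w) * cnj (chi d) * ee (x c d)) \<le> (case p of (c, d) \<Rightarrow> real c powr (- Re w))"
      if "p \<in> A" for p
      using that A pair_term_norm_le by (auto simp: all_pairs_def)
  qed auto
  then show ?thesis by (simp only: summable_on_iff_abs_summable_on_complex)
qed

text \<open>For c = N c' the sum over d vanishes unless c' divides m, so for m \<noteq> 0 the series
  over c reduces to a finite divisor sum. For m = 0 every c' divides m, but the factor chi(0) is
  0.\<close>

lemma full_pair_series:
  assumes w: "Re w > 2"
  shows "((\<lambda>(c, d). of_nat c powr (- w) * cnj (chi d) * ee (- (of_int (m * d) / of_nat c))) has_sum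
    (if m = 0 then 0 else of_nat N powr (- w) * gauss_sum N (conj_char chi) *
       of_nat (nat \<bar>m\<bar>) powr (1 - w) * sigma_char chi (w - 1) (nat \<bar>m\<bar>))) (all_pairs N)"
    (is "(?T has_sum ?V) _")
proof -
  let ?W = "gauss_sum N (conj_char chi)"
  have N0: "N > 0" using N_gt_1 by simp
  obtain S where S: "(?T has_sum S) (all_pairs N)"
    using pair_series_summable[OF w order_refl, of "\<lambda>c d. - (of_int (m * d) / of_nat c)"] by (auto simp: summable_on_def)
  define H where "H c = (\<Sum>d\<in>{0..<int c}. of_nat c powr (- w) * cnj (chi d) * ee (- (of_int (m * d) / of_nat c)))" for c
  have "(H has_sum S) {c. c > 0 \<and> N dvd c}"
    using S unfolding all_pairs_def
    by (rule has_sum_Sigma') (auto simp: H_def intro!: has_sum_finiteI)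
  moreover have "bij_betw (\<lambda>c'. N * c') {1..} {c. c > 0 \<and> N dvd c}"
    by (rule bij_betwI[of _ _ _ "\<lambda>c. c div N"]) (use N0 in \<open>auto simp: dvd_imp_le Suc_le_eq div_greater_zero_iff\<close>)
  ultimately have S': "((\<lambda>c'. H (N * c')) has_sum S) {1..}"
    by (simp add: has_sum_reindex_bij_betw)
  have H: "H (N * c') = (if int c' dvd m then of_nat (N * c') powr (- w) * (of_nat c' * ?W * chi (m div int c')) else 0)" if "c' \<ge> 1" for c'
  proof -
    have "H (N * c') = of_nat (N * c') powr (- w) * (\<Sum>d\<in>{0..<int (N * c')}. cnj (chi d) * ee (- (of_int (m * d) / of_nat (N * c'))))"
      by (simp only: H_def sum_distrib_left mult.assoc)
    then show ?thesis using that by (subst (asm) sum_chi_ee) auto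
  qed
  have "((\<lambda>c'. H (N * c')) has_sum ?V) {1..}"
  proof (cases "m = 0")
    case True
    then show ?thesis using H by (auto intro!: has_sum_0)
  next
    case False
    define M where "M = nat \<bar>m\<bar>"
    have M: "M > 0" "int M = \<bar>m\<bar>" using False by (auto simp: M_def)
    have dv: "int c dvd m \<longleftrightarrow> c dvd M" for c using M(2) by (metis dvd_abs_iff int_dvd_int_iff)
    have "((\<lambda>c'. H (N * c')) has_sum (\<Sum>c' | c' dvd M. H (N * c'))) {1..}"
    proof (rule has_sum_cong_neutral[THEN iffD1])
      show "((\<lambda>c'. H (N * c')) has_sum (\<Sum>c' | c' dvd M. H (N * c'))) {c'. c' dvd M}"
        using M by (intro has_sum_finite) auto
      show "H (N * c') = 0" if "c' \<in> {1..} - {c'. c' dvd M}" for c'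
        using that H[of c'] by (simp add: dv)
      show "H (N * c') = 0" if "c' \<in> {c'. c' dvd M} - {1..}" for c'
        using that M by (auto simp: Suc_le_eq)
    qed auto
    \<comment> \<open>Passing to the complementary divisor d = |m| / c' turns c'^(1-w) into
      |m|^(1-w) d^(w-1), which is the shape of the divisor function.\<close>
    also have "(\<Sum>c' | c' dvd M. H (N * c')) = (\<Sum>d | d dvd M. of_nat N powr (- w) * ?W * of_nat M powr (1 - w) * (chi (int d) * of_nat d powr (w - 1)))"
    proof (rule sum.reindex_bij_witness[of _ "\<lambda>d. M div d" "\<lambda>d. M div d"])
      have "M div (M div d) = d \<and> M div d dvd M" if "d dvd M" for d
      proof -
        obtain e where e: "M = d * e" using \<open>d dvd M\<close> by (elim dvdE)
        then show ?thesis using M(1) by simp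
      qed
      then show "M div (M div d) = d" "M div d \<in> {c'. c' dvd M}" if "d \<in> {d. d dvd M}" for d
        using that by auto
      then show "M div (M div d) = d" "M div d \<in> {c'. c' dvd M}" if "d \<in> {d. d dvd M}" for d
        using that by auto
    next
      fix c' assume c': "c' \<in> {c'. c' dvd M}"
      then obtain d where d: "M = c' * d" by (auto elim: dvdE)
      then have p: "c' > 0" "d > 0" using M by auto
      have e1: "chi (m div int c') = chi (int d)"
      proof -
        obtain k where k: "m = int c' * k" using c' dv by (auto elim: dvdE)
        have "int c' * \<bar>k\<bar> = int c' * int d"
          using M(2) unfolding d k by (auto simp: abs_mult)
        then have "\<bar>k\<bar> = int d" by (subst (asm) mult_left_cancel) (use p in auto)
        then show ?thesis using k p chi_abs[of k] by simp
      qed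
      have e2: "of_nat M powr (1 - w) * of_nat d powr (w - 1) = complex_of_nat c' powr (1 - w)"
      proof -
        have "complex_of_nat M powr (1 - w) = of_nat c' powr (1 - w) * of_nat d powr (1 - w)"
          using powr_times_real[of "of_nat c'" "of_nat d" "1 - w"] p by (simp add: d)
        then show ?thesis using p by (simp add: mult.assoc flip: powr_add)
      qed
      have e3: "complex_of_nat (N * c') powr (- w) = of_nat N powr (- w) * of_nat c' powr (- w)"
        using powr_times_real[of "of_nat N" "of_nat c'" "- w"] p N0 by simp
      have e4: "complex_of_nat c' powr (- w) * of_nat c' = of_nat c' powr (1 - w)"
        using p powr_add[of "complex_of_nat c'" "- w" 1] by simp
      have e5: "M div c' = d" using d p by simp
      have "H (N * c') = of_nat N powr (- w) * ?W * (of_nat c' powr (- w) * of_nat c') * chi (int d)"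
        using H[of c'] c' p by (simp add: dv e1 e3 del: of_nat_mult)
      also have "\<dots> = of_nat N powr (- w) * ?W * of_nat M powr (1 - w) * (chi (int d) * of_nat d powr (w - 1))"
        unfolding e4 e2[symmetric] by (simp only: mult_ac)
      finally show "of_nat N powr (- w) * ?W * of_nat M powr (1 - w) * (chi (int (M div c')) * of_nat (M div c') powr (w - 1)) = H (N * c')"
        by (simp only: e5)
    qed
    also have "\<dots> = of_nat N powr (- w) * ?W * of_nat M powr (1 - w) * sigma_char chi (w - 1) M"
      by (simp add: sigma_char_def sum_distrib_left)
    finally show ?thesis using False by (simp add: M_def)
  qed
  with S' have "S = ?V" by (rule has_sum_unique)
  with S show ?thesis by simp
qed

lemma L_char_has_sum:
  assumes w: "Re w > 1"
  shows "((\<lambda>n. conj_char chi (int n) * of_nat n powr (- w)) has_sum L_char N (conj_char chi) w) {n. n \<ge> 1 \<and> coprime n N}"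
    and "((\<lambda>n. chi (int n) * of_nat n powr (- w)) has_sum L_char N chi w) {n. n \<ge> 1 \<and> coprime n N}"
proof -
  have *: "((\<lambda>n. \<psi> (int n) * of_nat n powr (- w)) has_sum L_char N \<psi> w) {n. n \<ge> 1 \<and> coprime n N}"
    if "\<And>n. norm (\<psi> n) \<le> 1" for \<psi>
  proof -
    have "(\<lambda>n. \<psi> (int n) * of_nat n powr (- w)) summable_on {1..}"
      using nat_Dirichlet_summable[of w "\<lambda>n. \<psi> (int n)"] w that by (simp only: summable_on_iff_abs_summable_on_complex)
    then have "(\<lambda>n. \<psi> (int n) * of_nat n powr (- w)) summable_on {n. n \<ge> 1 \<and> coprime n N}"
      by (rule summable_on_subset_banach) auto
    then show ?thesis unfolding L_char_def by (rule has_sum_infsum)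
  qed
  show "((\<lambda>n. conj_char chi (int n) * of_nat n powr (- w)) has_sum L_char N (conj_char chi) w) {n. n \<ge> 1 \<and> coprime n N}"
    by (rule *) (simp add: conj_char_def norm_chi_le)
  show "((\<lambda>n. chi (int n) * of_nat n powr (- w)) has_sum L_char N chi w) {n. n \<ge> 1 \<and> coprime n N}"
    by (rule *) (rule norm_chi_le)
qed

text \<open>Every pair $(c,d)$ with $N \mid c$ and $d$ prime to $N$ is $g$ times a coprime pair, where
  $g = \gcd(c,d)$ is prime to $N$; so the sum over coprime pairs times $L(\overline\chi,w)$ is the sum over all pairs.\<close>

lemma L_char_times_ramanujan_series:
  assumes w: "Re w > 2"
  shows "L_char N (conj_char chi) w * ramanujan_series w m =
    (if m = 0 then 0 else of_nat N powr (- w) * gauss_sum N (conj_char chi) *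
       of_nat (nat \<bar>m\<bar>) powr (1 - w) * sigma_char chi (w - 1) (nat \<bar>m\<bar>))" (is "_ = ?V")
proof -
  define T where "T = (\<lambda>(c, d). of_nat c powr (- w) * cnj (chi d) * ee (- (of_int (m * d) / of_nat c)))"
  define G where "G = {n. n \<ge> 1 \<and> coprime n N}"
  define P1 where "P1 = {(c, d). c > 0 \<and> N dvd c \<and> 0 \<le> d \<and> d < int c \<and> coprime d (int N)}"
  have N0: "N > 0" using N_gt_1 by simp
  have "(T has_sum ?V) (all_pairs N)" unfolding T_def by (rule full_pair_series[OF w])
  \<comment> \<open>Pairs whose d shares a factor with N carry chi(d) = 0, so restricting to d prime
    to N does not change the sum.\<close>
  then have V1: "(T has_sum ?V) P1"
  proof (rule has_sum_cong_neutral[THEN iffD1, rotated -1])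
    show "T p = 0" if "p \<in> all_pairs N - P1" for p
      using that chi_nonzero_iff[of "snd p"] by (auto simp: all_pairs_def P1_def T_def split: prod.splits)
  qed (auto simp: all_pairs_def P1_def)
  have bij: "bij_betw (\<lambda>(g, (c, d)). (g * c, int g * d)) (G \<times> cusp_pairs N) P1"
  proof (rule bij_betwI')
    fix x y assume x: "x \<in> G \<times> cusp_pairs N" and y: "y \<in> G \<times> cusp_pairs N"
    have gcd: "gcd (int (fst z * fst (snd z))) (int (fst z) * snd (snd z)) = int (fst z)"
      if "z \<in> G \<times> cusp_pairs N" for z
      using that by (auto simp: cusp_pairs_def G_def gcd_mult_distrib_int[symmetric] abs_mult split: prod.splits)
    obtain g c d where xx: "x = (g, (c, d))" by (cases x) auto
    obtain g' c' d' where yy: "y = (g', (c', d'))" by (cases y) auto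
    show "((case x of (g, c, d) \<Rightarrow> (g * c, int g * d)) = (case y of (g, c, d) \<Rightarrow> (g * c, int g * d))) = (x = y)"
    proof
      assume e: "(case x of (g, c, d) \<Rightarrow> (g * c, int g * d)) = (case y of (g, c, d) \<Rightarrow> (g * c, int g * d))"
      then have "int g = int g'" using gcd[OF x] gcd[OF y] by (simp add: xx yy)
      moreover have "g > 0" using x by (auto simp: xx G_def)
      ultimately show "x = y" using e by (simp add: xx yy)
    qed simp
  next
    fix x assume x: "x \<in> G \<times> cusp_pairs N"
    obtain g c d where xx: "x = (g, (c, d))" by (cases x) auto
    have h: "g > 0" "coprime g N" "c > 0" "N dvd c" "0 \<le> d" "d < int c" "coprime (int c) d"
      using x by (auto simp: xx G_def cusp_pairs_def)
    have "coprime d (int N)"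
      using h(4,7) by (metis coprime_commute coprime_divisors dvd_refl int_dvd_int_iff)
    moreover have "coprime (int g) (int N)" using h(2) by simp
    ultimately show "(case x of (g, c, d) \<Rightarrow> (g * c, int g * d)) \<in> P1"
      using h by (auto simp: xx P1_def intro!: mult_strict_left_mono)
  next
    fix p assume "p \<in> P1"
    then obtain c d where p: "p = (c, d)" "c > 0" "N dvd c" "0 \<le> d" "d < int c" "coprime d (int N)"
      by (auto simp: P1_def)
    define g where "g = nat (gcd (int c) d)"
    have gd: "int g dvd int c" "int g dvd d" "g > 0" "gcd (int c) d = int g" using p by (auto simp: g_def)
    obtain c' where c': "c = g * c'" using gd(1) by (auto simp: int_dvd_int_iff elim: dvdE)
    obtain d' where d': "d = int g * d'" using gd(2) by (auto elim: dvdE)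
    have gN: "coprime (int g) (int N)"
      using p(6) gd(2) by (metis coprime_divisors dvd_refl)
    have "N dvd c'" using p(3) gN unfolding c' by (metis coprime_commute coprime_dvd_mult_right_iff coprime_int_iff)
    moreover have "coprime (int c') d'"
    proof -
      have "int g * gcd (int c') d' = int g" using gd(4) by (simp add: c' d' gcd_mult_left)
      then show ?thesis using gd(3) by (simp add: coprime_iff_gcd_eq_1)
    qed
    moreover have "0 \<le> d'" "d' < int c'" "c' > 0"
      using p gd(3) by (auto simp: c' d' zero_le_mult_iff mult_less_cancel_left_pos)
    ultimately have "(g, (c', d')) \<in> G \<times> cusp_pairs N" using gN gd(3) by (auto simp: G_def cusp_pairs_def)
    then show "\<exists>x\<in>G \<times> cusp_pairs N. p = (case x of (g, c, d) \<Rightarrow> (g * c, int g * d))"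
      by (rule bexI[rotated]) (simp add: p c' d')
  qed
  have Tg: "T (case x of (g, c, d) \<Rightarrow> (g * c, int g * d)) = (conj_char chi (int (fst x)) * of_nat (fst x) powr (- w)) * T (snd x)"
    if "x \<in> G \<times> cusp_pairs N" for x
  proof -
    obtain g c d where xx: "x = (g, (c, d))" by (cases x) auto
    have h: "g > 0" "c > 0" using that by (auto simp: xx G_def cusp_pairs_def)
    have "complex_of_nat (g * c) powr (- w) = of_nat g powr (- w) * of_nat c powr (- w)"
      using powr_times_real[of "of_nat g" "of_nat c" "- w"] h by simp
    moreover have "of_int (m * (int g * d)) / real (g * c) = of_int (m * d) / real c" using h by simp
    ultimately show ?thesis
      by (simp add: xx T_def conj_char_def chi_mult del: of_nat_mult of_int_mult)
  qed
  have "((\<lambda>x. T (case x of (g, c, d) \<Rightarrow> (g * c, int g * d))) has_sum ?V) (G \<times> cusp_pairs N)"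
    using V1 has_sum_reindex_bij_betw[OF bij, of T] by (simp add: case_prod_unfold)
  then have V2: "((\<lambda>x. (conj_char chi (int (fst x)) * of_nat (fst x) powr (- w)) * T (snd x)) has_sum ?V) (G \<times> cusp_pairs N)"
    by (rule has_sum_cong[THEN iffD1, rotated]) (rule Tg)
  have R: "(T has_sum ramanujan_series w m) (cusp_pairs N)"
    unfolding T_def ramanujan_series_def by (intro has_sum_infsum pair_series_summable w cusp_pairs_subset)
  have "((\<lambda>g. (conj_char chi (int g) * of_nat g powr (- w)) * ramanujan_series w m) has_sum ?V) G"
  proof (rule has_sum_Sigma'[OF V2])
    show "((\<lambda>y. (conj_char chi (int (fst (g, y))) * of_nat (fst (g, y)) powr (- w)) * T (snd (g, y))) has_sum
        (conj_char chi (int g) * of_nat g powr (- w)) * ramanujan_series w m) (cusp_pairs N)" for g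
      unfolding fst_conv snd_conv by (rule has_sum_cmult_right[OF R])
  qed
  moreover have "((\<lambda>g. (conj_char chi (int g) * of_nat g powr (- w)) * ramanujan_series w m) has_sum (L_char N (conj_char chi) w * ramanujan_series w m)) G"
    unfolding G_def using w by (intro has_sum_cmult_left L_char_has_sum) auto
  ultimately show ?thesis using has_sum_unique by blast
qed

text \<open>The bound does not depend on m, so multiplying a(l) by the Ramanujan series at l - n
  preserves the growth O(l^2) of the coefficients.\<close>

lemma norm_ramanujan_series_le:
  assumes w: "Re w > 2"
  shows "norm (ramanujan_series w m) \<le> (\<Sum>\<^sub>\<infinity>(c, d)\<in>cusp_pairs N. real c powr (- Re w))"
  unfolding ramanujan_series_def
proof (rule norm_infsum_le[OF has_sum_infsum[OF pair_series_summable[OF w cusp_pairs_subset]] has_sum_infsum[OF cusp_pairs_summable[OF w]]])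
  fix p assume "p \<in> cusp_pairs N"
  then show "norm (case p of (c, d) \<Rightarrow> of_nat c powr (- w) * cnj (chi d) * ee (- (of_int (m * d) / of_nat c)))
     \<le> (case p of (c, d) \<Rightarrow> real c powr (- Re w))"
    using pair_term_norm_le by (auto simp: cusp_pairs_def)
qed

text \<open>The term n = 1 dominates: the remaining terms are at most n^(-3) \<le> 1 / (2 n (n -
  1)), which telescopes to 1/2. The range fits w = 2s with Re s > 2.\<close>

lemma L_char_nonzero:
  assumes w: "Re w \<ge> 4"
  shows "L_char N chi w \<noteq> 0" and "L_char N (conj_char chi) w \<noteq> 0"
proof -
  have *: "L_char N \<psi> w \<noteq> 0"
    if hs: "((\<lambda>n. \<psi> (int n) * of_nat n powr (- w)) has_sum L_char N \<psi> w) {n. n \<ge> 1 \<and> coprime n N}"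
      and n\<psi>: "\<And>n. norm (\<psi> n) \<le> 1" and \<psi>1: "\<psi> 1 = 1" for \<psi>
  proof
    assume 0: "L_char N \<psi> w = 0"
    define A where "A = {n. n \<ge> 1 \<and> coprime n N} - {1}"
    have "((\<lambda>n. \<psi> (int n) * of_nat n powr (- w)) has_sum (0 - \<psi> (int 1) * of_nat 1 powr (- w))) A"
      unfolding A_def using has_sum_Diff[OF hs has_sum_finite[of "{1}"]] 0 by simp
    then have h: "((\<lambda>n. \<psi> (int n) * of_nat n powr (- w)) has_sum (- 1)) A" by (simp add: \<psi>1)
    define g where "g n = 1 / (2 * (real n - 1) * real n)" for n :: nat
    have g: "(g has_sum (1 / 2)) {2..}"
    proof -
      define u where "u n = 1 / (2 * (real n + 1))" for n :: nat
      have "(\<lambda>n. (1 / 2) * inverse (real (Suc n))) \<longlonglongrightarrow> 0"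
        by (rule tendsto_mult_right_zero[OF LIMSEQ_inverse_real_of_nat])
      then have "u \<longlonglongrightarrow> 0" by (simp add: u_def[abs_def] inverse_eq_divide add.commute)
      then have "(\<lambda>n. u (Suc n) - u n) sums (0 - u 0)" by (rule telescope_sums)
      then have "(\<lambda>n. - (u (Suc n) - u n)) sums (- (0 - u 0))" by (rule sums_minus)
      moreover have "- (u (Suc n) - u n) = g (n + 2)" for n
      proof -
        have "1 / (2 * x) - 1 / (2 * (x + 1)) = 1 / (2 * x * (x + 1))" if "x > 0" for x :: real
          using that by (simp add: field_simps)
        from this[of "real n + 1"] show ?thesis by (simp add: u_def g_def algebra_simps)
      qed
      ultimately have s: "(\<lambda>n. g (n + 2)) sums (1 / 2)" by (simp add: u_def)
      have "norm (g (n + 2)) = g (n + 2)" for n by (simp add: g_def)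
      then have "((\<lambda>n. g (n + 2)) has_sum (1 / 2)) UNIV"
        using s by (intro norm_summable_imp_has_sum) (auto simp: sums_iff)
      moreover have "bij_betw (\<lambda>n. n + 2) UNIV {2::nat..}"
        by (rule bij_betwI[of _ _ _ "\<lambda>n. n - 2"]) auto
      ultimately show ?thesis using has_sum_reindex_bij_betw[of "\<lambda>n. n + 2" UNIV "{2..}" g] by simp
    qed
    have gA: "g summable_on A"
      by (rule summable_on_subset_banach[OF has_sum_imp_summable[OF g]]) (auto simp: A_def)
    have "norm (- 1 :: complex) \<le> infsum g A"
    proof (rule norm_infsum_le[OF h has_sum_infsum[OF gA]])
      fix n assume "n \<in> A"
      then have n: "n \<ge> 2" by (auto simp: A_def)
      have "norm (\<psi> (int n) * of_nat n powr (- w)) \<le> real n powr (- Re w)"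
        using n n\<psi>[of "int n"] by (simp add: norm_mult norm_of_nat_powr mult_left_le_one_le)
      also have "\<dots> \<le> real n powr (- 3)" using n w by (intro powr_mono) auto
      also have "\<dots> = 1 / (real n ^ 2 * real n)" using n by (simp add: powr_minus powr_numeral power3_eq_cube power2_eq_square field_simps)
      also have "\<dots> \<le> g n"
      proof -
        have "2 * (real n - 1) \<le> real n ^ 2" using zero_le_power2[of "real n - 1"] by (simp add: power2_eq_square algebra_simps)
        then show ?thesis unfolding g_def using n by (intro divide_left_mono mult_right_mono mult_pos_pos) auto
      qed
      finally show "norm (\<psi> (int n) * of_nat n powr (- w)) \<le> g n" .
    qed
    also have "infsum g A \<le> infsum g {2..}"
      by (rule infsum_mono_neutral[OF gA has_sum_imp_summable[OF g]]) (auto simp: A_def g_def)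
    also have "infsum g {2..} = 1 / 2" using g by (rule infsumI)
    finally show False by simp
  qed
  show "L_char N chi w \<noteq> 0"
    using w by (intro * L_char_has_sum(2) norm_chi_le) auto
  show "L_char N (conj_char chi) w \<noteq> 0"
    using w by (intro * L_char_has_sum(1)) (auto simp: conj_char_def norm_chi_le)
qed

end

subsection \<open>Growth of cusp forms\<close>

definition mat2 :: "int \<Rightarrow> int \<Rightarrow> int \<Rightarrow> int \<Rightarrow> int ^ 2 ^ 2" where
  "mat2 p q c d = (\<chi> i j. if i = 1 then if j = 1 then p else q else if j = 1 then c else d)"

lemma mat2_nth [simp]:
  "mat2 p q c d $ 1 $ 1 = p" "mat2 p q c d $ 1 $ 2 = q"
  "mat2 p q c d $ 2 $ 1 = c" "mat2 p q c d $ 2 $ 2 = d"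
  by (simp_all add: mat2_def)

lemma mat2_eta: "A = mat2 (A $ 1 $ 1) (A $ 1 $ 2) (A $ 2 $ 1) (A $ 2 $ 2)"
  by (simp add: vec_eq_iff forall_2)

lemma mat2_mult: "mat2 p q c d ** mat2 p' q' c' d' =
    mat2 (p * p' + q * c') (p * q' + q * d') (c * p' + d * c') (c * q' + d * d')"
  by (simp add: vec_eq_iff forall_2 matrix_matrix_mult_def sum_2)

lemma mat2_eq_iff: "mat2 p q c d = mat2 p' q' c' d' \<longleftrightarrow> p = p' \<and> q = q' \<and> c = c' \<and> d = d'"
  by (metis mat2_nth)

lemma mat2_in_Gamma0_iff: "mat2 p q c d \<in> Gamma0 N \<longleftrightarrow> p * d - q * c = 1 \<and> int N dvd c"
  by (simp add: Gamma0_def det_2)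

lemma Gamma0_cases:
  assumes "\<gamma> \<in> Gamma0 N"
  obtains p q c d where "\<gamma> = mat2 p q c d" "p * d - q * c = 1" "int N dvd c"
  using assms mat2_eta[of \<gamma>] mat2_in_Gamma0_iff by metis

lemma aut_factor_mat2: "aut_factor (mat2 p q c d) z = of_int c * z + of_int d"
  by (simp add: aut_factor_def)

lemma moebius_act_mat2: "moebius_act (mat2 p q c d) z = (of_int p * z + of_int q) / (of_int c * z + of_int d)"
  by (simp add: moebius_act_def aut_factor_mat2)

lemma aut_factor_nonzero:
  assumes "p * d - q * c = (1 :: int)" "Im z > 0"
  shows "of_int c * z + of_int d \<noteq> 0"
proof
  assume 0: "of_int c * z + of_int d = 0"
  then have "Im (of_int c * z + of_int d) = 0" by simp
  then have "c = 0" using assms(2) by simp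
  with 0 assms(1) show False by simp
qed

lemma Im_moebius_act:
  assumes "p * d - q * c = (1 :: int)"
  shows "Im (moebius_act (mat2 p q c d) z) = Im z / (norm (of_int c * z + of_int d))\<^sup>2"
proof -
  have "Im (moebius_act (mat2 p q c d) z) = Im ((of_int p * z + of_int q) * cnj (of_int c * z + of_int d)) / (norm (of_int c * z + of_int d))\<^sup>2"
    unfolding moebius_act_mat2 by (subst complex_div_cnj) (simp only: Im_divide_of_real flip: of_real_power)
  also have "Im ((of_int p * z + of_int q) * cnj (of_int c * z + of_int d)) = of_int (p * d - q * c) * Im z"
    by (simp add: algebra_simps)
  finally show ?thesis using assms by simp
qed

lemma moebius_act_in_upper_half_plane:
  assumes "p * d - q * c = (1 :: int)" "Im z > 0"
  shows "Im (moebius_act (mat2 p q c d) z) > 0"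
  using aut_factor_nonzero[OF assms] assms by (simp add: Im_moebius_act[OF assms(1)])

lemma moebius_act_mult:
  assumes A: "p * d - q * c = 1" and B: "p' * d' - q' * c' = 1" and z: "Im z > 0"
  shows "aut_factor (mat2 p q c d ** mat2 p' q' c' d') z =
      aut_factor (mat2 p q c d) (moebius_act (mat2 p' q' c' d') z) * aut_factor (mat2 p' q' c' d') z"
    and "moebius_act (mat2 p q c d ** mat2 p' q' c' d') z = moebius_act (mat2 p q c d) (moebius_act (mat2 p' q' c' d') z)"
proof -
  have nz: "of_int c' * z + of_int d' \<noteq> 0" by (rule aut_factor_nonzero[OF B z])
  define w where "w = moebius_act (mat2 p' q' c' d') z"
  have w: "w * (of_int c' * z + of_int d') = of_int p' * z + of_int q'"
    using nz by (simp add: w_def moebius_act_mat2)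
  have nz': "of_int c * w + of_int d \<noteq> 0"
    using moebius_act_in_upper_half_plane[OF B z] by (intro aut_factor_nonzero[OF A]) (simp add: w_def)
  have e: "(of_int x * w + of_int y) * (of_int c' * z + of_int d') =
      of_int (x * p' + y * c') * z + of_int (x * q' + y * d')" for x y
  proof -
    have "(of_int x * w + of_int y) * (of_int c' * z + of_int d') =
        of_int x * (w * (of_int c' * z + of_int d')) + of_int y * (of_int c' * z + of_int d')"
      by (simp add: algebra_simps)
    also have "\<dots> = of_int (x * p' + y * c') * z + of_int (x * q' + y * d')"
      unfolding w by (simp add: algebra_simps)
    finally show ?thesis .
  qed
  show "aut_factor (mat2 p q c d ** mat2 p' q' c' d') z =
      aut_factor (mat2 p q c d) (moebius_act (mat2 p' q' c' d') z) * aut_factor (mat2 p' q' c' d') z"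
    unfolding mat2_mult aut_factor_mat2 w_def[symmetric] e ..
  have "(of_int p * w + of_int q) / (of_int c * w + of_int d) =
     ((of_int p * w + of_int q) * (of_int c' * z + of_int d')) / ((of_int c * w + of_int d) * (of_int c' * z + of_int d'))"
    using nz by simp
  then show "moebius_act (mat2 p q c d ** mat2 p' q' c' d') z = moebius_act (mat2 p q c d) (moebius_act (mat2 p' q' c' d') z)"
    unfolding mat2_mult w_def[symmetric] unfolding moebius_act_mat2 e by simp
qed

section \<open>Bounds for f and its coefficients\<close>

locale cusp_form_expansion =
  fixes N :: nat and f :: "complex \<Rightarrow> complex" and a :: "nat \<Rightarrow> complex"
  assumes N_pos: "N > 0" and cusp: "cusp_form2 N f"
    and expansion: "\<And>z. z \<in> upper_half_plane \<Longrightarrow>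
           ((\<lambda>n. a n * exp (2 * of_real pi * \<i> * of_nat n * z)) has_sum f z) {1..}"
begin

lemma f_holomorphic: "f holomorphic_on upper_half_plane"
  using cusp by (simp add: cusp_form2_def)

lemma f_continuous: "continuous_on upper_half_plane f"
  by (rule holomorphic_on_imp_continuous_on[OF f_holomorphic])

lemma f_transform:
  assumes "p * d - q * c = 1" "int N dvd c" "Im z > 0"
  shows "f (moebius_act (mat2 p q c d) z) = (of_int c * z + of_int d)\<^sup>2 * f z"
proof -
  have "slash2 f (mat2 p q c d) z = f z"
    using cusp assms by (auto simp: cusp_form2_def mat2_in_Gamma0_iff upper_half_plane_def)
  then show ?thesis
    using aut_factor_nonzero[OF assms(1,3)] by (simp add: slash2_def aut_factor_mat2 field_simps)
qed

text \<open>The slash of $f$ by a matrix of determinant 1 depends only on its entries modulo $N$: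
  two such matrices differ by a left factor in $\Gamma(N)$.\<close>

lemma slash2_cong_mod:
  assumes A: "p * d - q * c = 1" and B: "p' * d' - q' * c' = 1" and z: "Im z > 0"
    and cong: "int N dvd c' - c" "int N dvd d' - d"
  shows "slash2 f (mat2 p' q' c' d') z = slash2 f (mat2 p q c d) z"
proof -
  \<comment> \<open>The primed matrix times the inverse of the unprimed one. Its lower left entry
    c'd - d'c is all that has to be divisible by N, so congruent bottom rows suffice.\<close>
  define P where "P = mat2 (p' * d - q' * c) (q' * p - p' * q) (c' * d - d' * c) (d' * p - c' * q)"
  have dP: "(p' * d - q' * c) * (d' * p - c' * q) - (q' * p - p' * q) * (c' * d - d' * c) = 1"
  proof -
    have "(p' * d - q' * c) * (d' * p - c' * q) - (q' * p - p' * q) * (c' * d - d' * c) = (p * d - q * c) * (p' * d' - q' * c')"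
      by (simp add: algebra_simps)
    then show ?thesis using A B by simp
  qed
  have mult: "P ** mat2 p q c d = mat2 p' q' c' d'"
  proof -
    have "(p' * d - q' * c) * p + (q' * p - p' * q) * c = p' * (p * d - q * c)"
      "(p' * d - q' * c) * q + (q' * p - p' * q) * d = q' * (p * d - q * c)"
      "(c' * d - d' * c) * p + (d' * p - c' * q) * c = c' * (p * d - q * c)"
      "(c' * d - d' * c) * q + (d' * p - c' * q) * d = d' * (p * d - q * c)"
      by (simp_all add: algebra_simps)
    then show ?thesis unfolding P_def mat2_mult mat2_eq_iff A by simp
  qed
  have dv: "int N dvd c' * d - d' * c"
  proof -
    have "c' * d - d' * c = (c' - c) * d - (d' - d) * c" by (simp add: algebra_simps)
    then show ?thesis using cong by (metis dvd_diff dvd_mult2)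
  qed
  define w where "w = moebius_act (mat2 p q c d) z"
  have w: "Im w > 0" unfolding w_def by (rule moebius_act_in_upper_half_plane[OF A z])
  have "slash2 f (mat2 p' q' c' d') z = f (moebius_act P w) / (aut_factor P w * aut_factor (mat2 p q c d) z)\<^sup>2"
    unfolding slash2_def mult[symmetric] P_def w_def moebius_act_mult[OF dP A z] ..
  also have "f (moebius_act P w) = (aut_factor P w)\<^sup>2 * f w"
    unfolding P_def aut_factor_mat2 by (rule f_transform[OF dP dv w])
  finally have "slash2 f (mat2 p' q' c' d') z = (aut_factor P w)\<^sup>2 * f w / (aut_factor P w * aut_factor (mat2 p q c d) z)\<^sup>2" .
  moreover have "aut_factor P w \<noteq> 0"
    unfolding P_def aut_factor_mat2 by (rule aut_factor_nonzero[OF dP w])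
  ultimately show ?thesis by (simp add: slash2_def w_def power_mult_distrib)
qed

text \<open>The slash tends to 0 at infinity and has period N, because translation by a multiple of
  N changes the bottom row (c, d) only modulo N. What remains is a compact rectangle. The height 1/5
  is the one reached in the Dirichlet approximation argument below.\<close>

lemma slash2_bounded:
  assumes A: "p * d - q * c = (1 :: int)"
  obtains K where "\<And>w. Im w \<ge> 1 / 5 \<Longrightarrow> norm (slash2 f (mat2 p q c d) w) \<le> K"
proof -
  define s where "s = slash2 f (mat2 p q c d)"
  have "(s \<longlongrightarrow> 0) (filtercomap Im at_top)"
    using cusp A by (auto simp: cusp_form2_def s_def mat2_in_Gamma0_iff)
  then have "eventually (\<lambda>w. norm (s w) < 1) (filtercomap Im at_top)"
    by (auto simp: tendsto_iff)
  then obtain Y where Y: "\<And>w. Im w \<ge> Y \<Longrightarrow> norm (s w) < 1"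
    by (auto simp: eventually_filtercomap_at_top_linorder)
  have per: "s (w + of_int (int N * k)) = s w" if w: "Im w > 0" for w k
  proof -
    have B: "p * (c * (int N * k) + d) - (p * (int N * k) + q) * c = 1" using A by (simp add: algebra_simps)
    have "slash2 f (mat2 p (p * (int N * k) + q) c (c * (int N * k) + d)) w = s w"
      unfolding s_def by (rule slash2_cong_mod[OF A B w]) auto
    moreover have "slash2 f (mat2 p (p * (int N * k) + q) c (c * (int N * k) + d)) w = s (w + of_int (int N * k))"
      unfolding s_def slash2_def aut_factor_mat2 moebius_act_mat2 by (simp add: algebra_simps)
    ultimately show ?thesis by simp
  qed
  define Q where "Q = cbox (Complex 0 (1 / 5)) (Complex (real N) (max Y 1))"
  have Q: "w \<in> Q \<longleftrightarrow> 0 \<le> Re w \<and> Re w \<le> real N \<and> 1 / 5 \<le> Im w \<and> Im w \<le> max Y 1" for w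
    by (auto simp: Q_def in_cbox_complex_iff)
  have "continuous_on Q s"
    unfolding s_def slash2_def
  proof (intro continuous_intros)
    have nz: "aut_factor (mat2 p q c d) w \<noteq> 0" if "w \<in> Q" for w
      using aut_factor_nonzero[OF A, of w] that Q by (auto simp: aut_factor_mat2)
    then show "\<forall>x\<in>Q. (aut_factor (mat2 p q c d) x)\<^sup>2 \<noteq> 0" by simp
    show c: "continuous_on Q (aut_factor (mat2 p q c d))"
      unfolding aut_factor_mat2[abs_def] by (intro continuous_intros)
    show "continuous_on Q (\<lambda>x. f (moebius_act (mat2 p q c d) x))"
    proof (rule continuous_on_compose2[OF f_continuous])
      show "continuous_on Q (moebius_act (mat2 p q c d))"
        unfolding moebius_act_def[abs_def] using nz by (intro continuous_intros c) auto
      show "moebius_act (mat2 p q c d) ` Q \<subseteq> upper_half_plane"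
        using moebius_act_in_upper_half_plane[OF A] Q by (force simp: upper_half_plane_def)
    qed
  qed
  then have "compact (s ` Q)" by (rule compact_continuous_image) (simp add: Q_def compact_cbox)
  then obtain B where B: "\<And>w. w \<in> Q \<Longrightarrow> norm (s w) \<le> B"
    using compact_imp_bounded[of "s ` Q"] unfolding bounded_iff by (metis imageI)
  have "norm (s w) \<le> max 1 B" if w: "Im w \<ge> 1 / 5" for w
  proof (cases "Im w \<ge> Y")
    case True
    then show ?thesis using Y[of w] by simp
  next
    case False
    define k where "k = \<lfloor>Re w / real N\<rfloor>"
    define w' where "w' = w + of_int (int N * (- k))"
    have "of_int k * real N \<le> Re w" "Re w < (of_int k + 1) * real N"
      using N_pos floor_correct[of "Re w / real N"] unfolding k_def[symmetric] by (simp_all add: field_simps)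
    then have "w' \<in> Q" using w False by (simp add: Q w'_def algebra_simps)
    moreover have "s w' = s w" unfolding w'_def using w by (intro per) auto
    ultimately show ?thesis using B[of w'] by simp
  qed
  then show ?thesis using that unfolding s_def by blast
qed

text \<open>The slash depends on the matrix only through its bottom row modulo N, so finitely many
  bounds cover all matrices of determinant 1; \<open>rep\<close> picks a completable row in each
  residue class.\<close>

lemma slash2_uniformly_bounded:
  obtains K where "K \<ge> 0"
    "\<And>p q c d w. p * d - q * c = 1 \<Longrightarrow> Im w \<ge> 1 / 5 \<Longrightarrow> norm (slash2 f (mat2 p q c d) w) \<le> K"
proof -
  define X where "X = {(c, d). \<exists>p q. p * d - q * c = (1 :: int)}"
  define r where "r = (\<lambda>(c, d). (c mod int N, d mod int N))"
  have bd: "\<exists>K. \<forall>p q w. p * snd x - q * fst x = 1 \<longrightarrow> Im w \<ge> 1 / 5 \<longrightarrow> norm (slash2 f (mat2 p q (fst x) (snd x)) w) \<le> K" if x: "x \<in> X" for x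
  proof -
    obtain p q where pq: "p * snd x - q * fst x = 1" using x by (auto simp: X_def case_prod_unfold)
    obtain K where K: "\<And>w. Im w \<ge> 1 / 5 \<Longrightarrow> norm (slash2 f (mat2 p q (fst x) (snd x)) w) \<le> K"
      using slash2_bounded[OF pq] by blast
    have "norm (slash2 f (mat2 p' q' (fst x) (snd x)) w) \<le> K"
      if "p' * snd x - q' * fst x = 1" "Im w \<ge> 1 / 5" for p' q' w
      using K[OF that(2)] slash2_cong_mod[OF pq that(1), of w] that(2) by simp
    then show ?thesis by blast
  qed
  then obtain K where K: "\<And>x p q w. x \<in> X \<Longrightarrow> p * snd x - q * fst x = 1 \<Longrightarrow> Im w \<ge> 1 / 5 \<Longrightarrow> norm (slash2 f (mat2 p q (fst x) (snd x)) w) \<le> K x"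
    by metis
  have fin: "finite (r ` X)"
    by (rule finite_subset[of _ "{0..<int N} \<times> {0..<int N}"]) (use N_pos in \<open>auto simp: r_def\<close>)
  define rep where "rep u = (SOME x. x \<in> X \<and> r x = u)" for u
  have rep: "rep (r x) \<in> X" "r (rep (r x)) = r x" if "x \<in> X" for x
    using someI[of "\<lambda>y. y \<in> X \<and> r y = r x" x] that by (auto simp: rep_def)
  define M where "M = Max (insert 0 ((\<lambda>u. K (rep u)) ` (r ` X)))"
  show ?thesis
  proof
    show "M \<ge> 0" unfolding M_def using fin by (intro Max_ge) auto
    fix p q c d :: int and w
    assume A: "p * d - q * c = 1" and w: "Im w \<ge> 1 / 5"
    have x: "(c, d) \<in> X" using A by (auto simp: X_def)
    obtain c' d' where cd: "rep (r (c, d)) = (c', d')" by fastforce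
    have X': "(c', d') \<in> X" using rep(1)[OF x] cd by simp
    then obtain p' q' where B: "p' * d' - q' * c' = 1" by (auto simp: X_def)
    have "c' mod int N = c mod int N" "d' mod int N = d mod int N"
      using rep(2)[OF x] unfolding cd by (simp_all add: r_def)
    then have "int N dvd c - c'" "int N dvd d - d'" by (simp_all add: mod_eq_dvd_iff[symmetric])
    then have "slash2 f (mat2 p q c d) w = slash2 f (mat2 p' q' c' d') w"
      using w by (intro slash2_cong_mod[OF B A]) auto
    also have "norm \<dots> \<le> K (c', d')" using K[OF X', of p' q' w] B w by simp
    also have "\<dots> \<le> M"
    proof -
      have "K (c', d') \<in> (\<lambda>u. K (rep u)) ` (r ` X)"
        by (rule image_eqI[of _ _ "r (c, d)"]) (use x cd in simp_all)
      then show ?thesis unfolding M_def using fin by (intro Max_ge) auto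
    qed
    finally show "norm (slash2 f (mat2 p q c d) w) \<le> M" .
  qed
qed

text \<open>By Dirichlet's approximation theorem some matrix of $SL_2(\mathbb{Z})$ with $c \neq 0$ moves a
  point with imaginary part $y \le 1$ to one with imaginary part at least $1/5$; its automorphy
  factor there has absolute value at least $y$.\<close>

lemma growth_near_real_axis:
  obtains K where "K \<ge> 0" "\<And>z. 0 < Im z \<Longrightarrow> Im z \<le> 1 \<Longrightarrow> norm (f z) \<le> K / (Im z)\<^sup>2"
proof -
  obtain K where K: "K \<ge> 0" "\<And>p q c d w. p * d - q * c = 1 \<Longrightarrow> Im w \<ge> 1 / 5 \<Longrightarrow> norm (slash2 f (mat2 p q c d) w) \<le> K"
    using slash2_uniformly_bounded by blast
  have "norm (f z) \<le> K / (Im z)\<^sup>2" if z: "0 < Im z" "Im z \<le> 1" for z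
  proof -
    define y where "y = Im z"
    \<comment> \<open>This M balances the two contributions to |cz - d|^2 \<le> 1/M^2 + M^2 y^2: the
      first is at most 4y and the second at most y. Their total 5y is the origin of the height
      1/5.\<close>
    define M where "M = nat \<lfloor>1 / sqrt y\<rfloor>"
    have y: "0 < y" "y \<le> 1" using z by (auto simp: y_def)
    have s1: "1 \<le> 1 / sqrt y" using y by simp
    have M: "M > 0" "real M \<le> 1 / sqrt y" "1 / sqrt y < real M + 1" using s1 unfolding M_def by linarith+
    obtain c0 d0 where cd0: "0 < c0" "c0 \<le> int M" "\<bar>of_int c0 * Re z - of_int d0\<bar> < 1 / real M"
      using Dirichlet_approx_simult[OF M(1), of 1 "\<lambda>_. Re z"] by (metis less_one power_one_right)
    \<comment> \<open>Dividing by the gcd keeps both inequalities and makes the row (c, -d)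
      completable to a matrix of determinant 1.\<close>
    define g where "g = gcd c0 d0"
    have g: "g > 0" using cd0(1) by (simp add: g_def)
    obtain c d where c: "c0 = c * g" and d: "d0 = d * g" and cop: "coprime c d"
      using gcd_coprime_exists[of c0 d0] g unfolding g_def by auto
    have cp: "c > 0" using cd0(1) g by (simp add: c zero_less_mult_iff)
    have "c * 1 \<le> c * g" using g cp by (intro mult_left_mono) auto
    then have cM: "c \<le> int M" using cd0(2) c by linarith
    have appr: "\<bar>of_int c * Re z - of_int d\<bar> < 1 / real M"
    proof -
      have "\<bar>of_int c * Re z - of_int d\<bar> * 1 \<le> \<bar>of_int c * Re z - of_int d\<bar> * real_of_int g"
        using g by (intro mult_left_mono) auto
      also have "\<dots> = \<bar>(of_int c * Re z - of_int d) * real_of_int g\<bar>" using g by (simp add: abs_mult)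
      also have "(of_int c * Re z - of_int d) * real_of_int g = of_int c0 * Re z - of_int d0"
        by (simp add: c d algebra_simps)
      finally show ?thesis using cd0(3) by simp
    qed
    obtain u v where uv: "u * c + v * d = 1" using bezout_int[of c d] cop by auto
    have A: "(- v) * (- d) - (- u) * c = 1" using uv by (simp add: algebra_simps)
    have B: "(- d) * (- v) - (- (- u)) * (- c) = 1" using uv by (simp add: algebra_simps)
    define w where "w = moebius_act (mat2 (- v) (- u) c (- d)) z"
    define j where "j = of_int c * z + of_int (- d)"
    have "(norm j)\<^sup>2 = (of_int c * Re z - of_int d)\<^sup>2 + (of_int c * y)\<^sup>2"
      by (simp add: cmod_power2 j_def y_def)
    also have "\<dots> \<le> (1 / real M)\<^sup>2 + (real M * y)\<^sup>2"
      using appr cM cp y by (intro add_mono abs_le_square_iff[THEN iffD1]) (auto simp: abs_mult intro!: mult_right_mono)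
    also have "\<dots> \<le> 4 * y + y"
    proof (rule add_mono)
      have "1 / sqrt y < 2 * real M" using M by linarith
      then have "1 / real M \<le> 2 * sqrt y" using M(1) y by (simp add: field_simps)
      then have "(1 / real M)\<^sup>2 \<le> (2 * sqrt y)\<^sup>2" by (intro power_mono) auto
      then show "(1 / real M)\<^sup>2 \<le> 4 * y" using y by (simp add: power_mult_distrib)
      have "real M * y \<le> 1 / sqrt y * y" using M y by (intro mult_right_mono) auto
      also have "\<dots> = sqrt y" using y by (simp add: real_div_sqrt)
      finally have "(real M * y)\<^sup>2 \<le> (sqrt y)\<^sup>2" using y by (intro power_mono) auto
      then show "(real M * y)\<^sup>2 \<le> y" using y by simp
    qed
    finally have j5: "(norm j)\<^sup>2 \<le> 5 * y" by simp
    have jy: "y \<le> norm j"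
    proof -
      have "1 * y \<le> of_int c * y" using cp y by (intro mult_right_mono) auto
      also have "\<dots> = \<bar>Im j\<bar>" using cp y by (simp add: j_def y_def abs_mult)
      also have "\<dots> \<le> norm j" by (rule abs_Im_le_cmod)
      finally show ?thesis by simp
    qed
    have "Im w = y / (norm j)\<^sup>2" unfolding w_def j_def y_def by (rule Im_moebius_act[OF A])
    moreover have "norm j > 0" using jy y by linarith
    then have "y / (norm j)\<^sup>2 \<ge> 1 / 5" using j5 by (simp add: pos_le_divide_eq)
    ultimately have w: "Im w \<ge> 1 / 5" by simp
    \<comment> \<open>The inverse matrix carries w back to z, and its automorphy factor at w is 1/j;
      hence its slash at w equals f(z) j^2 and the uniform bound applies to it.\<close>
    have I: "mat2 (- d) (- (- u)) (- c) (- v) ** mat2 (- v) (- u) c (- d) = mat2 1 0 0 1"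
      using uv unfolding mat2_mult mat2_eq_iff by (simp add: algebra_simps)
    have zz: "moebius_act (mat2 (- d) (- (- u)) (- c) (- v)) w = z"
      using moebius_act_mult(2)[OF B A z(1), folded w_def] unfolding I by (simp add: moebius_act_mat2)
    have aj: "aut_factor (mat2 (- d) (- (- u)) (- c) (- v)) w * j = 1"
      using moebius_act_mult(1)[OF B A z(1), folded w_def] unfolding I by (simp add: aut_factor_mat2 j_def)
    then have "j \<noteq> 0" by auto
    with aj have "aut_factor (mat2 (- d) (- (- u)) (- c) (- v)) w = 1 / j" by (simp add: field_simps)
    then have "slash2 f (mat2 (- d) (- (- u)) (- c) (- v)) w = f z * j\<^sup>2"
      unfolding slash2_def zz by (simp add: power_divide)
    then have "norm (f z) * (norm j)\<^sup>2 \<le> K"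
      using K(2)[OF B w] by (simp add: norm_mult norm_power)
    moreover have "norm (f z) * y\<^sup>2 \<le> norm (f z) * (norm j)\<^sup>2"
      using jy y by (intro mult_left_mono power_mono) auto
    ultimately have "norm (f z) * y\<^sup>2 \<le> K" by linarith
    then show ?thesis using y by (simp add: y_def field_simps)
  qed
  with K(1) show ?thesis using that by blast
qed

lemma expansion':
  assumes "y > 0"
  shows "((\<lambda>n. a n * of_real (exp (- (2 * pi * real n * y))) * ee (real n * x)) has_sum f (Complex x y)) {1..}"
proof -
  have "Complex x y \<in> upper_half_plane" using assms by (simp add: upper_half_plane_def)
  from expansion[OF this] show ?thesis
  proof (rule has_sum_cong[THEN iffD1, rotated])
    fix n :: nat
    have "2 * of_real pi * \<i> * of_nat n * Complex x y = of_real (- (2 * pi * real n * y)) + 2 * of_real pi * \<i> * of_real (real n * x)"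
      by (simp add: complex_eq_iff)
    then show "a n * exp (2 * of_real pi * \<i> * of_nat n * Complex x y) = a n * of_real (exp (- (2 * pi * real n * y))) * ee (real n * x)"
      by (simp only: exp_add exp_of_real ee_exp mult.assoc)
  qed
qed

lemma coeff_abs_summable:
  assumes "y > 0"
  shows "(\<lambda>n. norm (a n) * exp (- (2 * pi * real n * y))) summable_on {1..}"
proof -
  have "(\<lambda>n. norm (a n * of_real (exp (- (2 * pi * real n * y))) * ee (real n * 0))) summable_on {1..}"
    using has_sum_imp_summable[OF expansion'[OF assms, of 0]] by (simp only: summable_on_iff_abs_summable_on_complex)
  then show ?thesis by (simp add: norm_mult)
qed

lemma f_periodic: "y > 0 \<Longrightarrow> f (Complex (x + of_int k) y) = f (Complex x y)"
proof -
  assume y: "y > 0"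
  have e: "ee (real n * (x + of_int k)) = ee (real n * x)" for n
    using ee_add_int[of "real n * x" "int n * k"] by (simp add: algebra_simps)
  show ?thesis using expansion'[OF y, of "x + of_int k"] expansion'[OF y, of x] unfolding e by (rule has_sum_unique)
qed

text \<open>Comparison with height 1: for n \<ge> 1 and y \<ge> 1, exp(-2 pi n y) \<le> exp(-2 pi (y
  - 1)) exp(-2 pi n), and the expansion converges absolutely at y = 1, uniformly in x.\<close>

lemma exponential_decay:
  obtains D where "D \<ge> 0" "\<And>x y. y \<ge> 1 \<Longrightarrow> norm (f (Complex x y)) \<le> D * exp (- (2 * pi * y))"
proof
  define S where "S = (\<Sum>\<^sub>\<infinity>n\<in>{1..}. norm (a n) * exp (- (2 * pi * real n * 1)))"
  show "S * exp (2 * pi) \<ge> 0" unfolding S_def by (intro mult_nonneg_nonneg infsum_nonneg) auto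
  fix x y :: real assume y: "y \<ge> 1"
  have "norm (f (Complex x y)) \<le> exp (- (2 * pi * (y - 1))) * S"
  proof (rule norm_infsum_le[OF expansion'])
    show "((\<lambda>n. exp (- (2 * pi * (y - 1))) * (norm (a n) * exp (- (2 * pi * real n * 1)))) has_sum exp (- (2 * pi * (y - 1))) * S) {1..}"
      unfolding S_def by (intro has_sum_cmult_right has_sum_infsum coeff_abs_summable) auto
    fix n :: nat assume n: "n \<in> {1..}"
    have "1 * (y - 1) \<le> real n * (y - 1)" using n y by (intro mult_right_mono) auto
    then have "2 * pi * (1 * (y - 1)) \<le> 2 * pi * (real n * (y - 1))" by (intro mult_left_mono) auto
    then have "exp (- (2 * pi * real n * y)) \<le> exp (- (2 * pi * (y - 1))) * exp (- (2 * pi * real n * 1))"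
      unfolding mult_exp_exp exp_le_cancel_iff by (simp add: algebra_simps)
    then have "norm (a n) * exp (- (2 * pi * real n * y)) \<le> norm (a n) * (exp (- (2 * pi * (y - 1))) * exp (- (2 * pi * real n * 1)))"
      by (rule mult_left_mono) simp
    then show "norm (a n * of_real (exp (- (2 * pi * real n * y))) * ee (real n * x)) \<le> exp (- (2 * pi * (y - 1))) * (norm (a n) * exp (- (2 * pi * real n * 1)))"
      by (simp add: norm_mult mult_ac)
  qed (use y in simp)
  also have "exp (- (2 * pi * (y - 1))) * S = S * exp (2 * pi) * exp (- (2 * pi * y))"
  proof -
    have "exp (- (2 * pi * (y - 1))) = exp (2 * pi) * exp (- (2 * pi * y))"
      unfolding mult_exp_exp by (simp add: algebra_simps)
    then show ?thesis by simp
  qed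
  finally show "norm (f (Complex x y)) \<le> S * exp (2 * pi) * exp (- (2 * pi * y))" .
qed

lemma inverse_square_bound:
  obtains C where "C \<ge> 0" "\<And>x y. y > 0 \<Longrightarrow> norm (f (Complex x y)) \<le> C / y\<^sup>2"
proof -
  obtain K where K: "K \<ge> 0" "\<And>z. 0 < Im z \<Longrightarrow> Im z \<le> 1 \<Longrightarrow> norm (f z) \<le> K / (Im z)\<^sup>2"
    using growth_near_real_axis by blast
  obtain D where D: "D \<ge> 0" "\<And>x y. y \<ge> 1 \<Longrightarrow> norm (f (Complex x y)) \<le> D * exp (- (2 * pi * y))"
    using exponential_decay by blast
  have "norm (f (Complex x y)) \<le> max K D / y\<^sup>2" if y: "y > 0" for x y
  proof (cases "y \<le> 1")
    case True
    have "norm (f (Complex x y)) \<le> K / y\<^sup>2" using K(2)[of "Complex x y"] y True by simp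
    also have "\<dots> \<le> max K D / y\<^sup>2" by (intro divide_right_mono) auto
    finally show ?thesis .
  next
    case False
    have "y\<^sup>2 \<le> (exp y)\<^sup>2" using exp_ge_add_one_self[of y] y by (intro power_mono) linarith+
    also have "\<dots> = exp (2 * y)" by (simp add: power2_eq_square mult_exp_exp)
    also have "\<dots> \<le> exp (2 * pi * y)" using y pi_gt3 by simp
    finally have "exp (- (2 * pi * y)) \<le> 1 / y\<^sup>2" using y by (simp add: exp_minus field_simps)
    then have "norm (f (Complex x y)) \<le> D * (1 / y\<^sup>2)"
      using D(2)[of y x] D(1) False mult_left_mono[of "exp (- (2 * pi * y))" "1 / y\<^sup>2" D] by linarith
    also have "\<dots> \<le> max K D / y\<^sup>2" by (simp add: divide_right_mono)
    finally show ?thesis .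
  qed
  moreover have "max K D \<ge> 0" using K by simp
  ultimately show ?thesis using that by blast
qed

lemma line_continuous: "continuous_on {0<..} (\<lambda>y. f (Complex x y))"
proof (rule continuous_on_compose2[OF f_continuous])
  show "continuous_on {0<..} (Complex x)"
    unfolding complex_eq by (intro continuous_intros)
qed (auto simp: upper_half_plane_def)

text \<open>Extension by 0 makes the restriction of f to a vertical line a Borel function on all of
  the reals, whatever values f has outside the upper half-plane.\<close>

definition f_line :: "real \<Rightarrow> real \<Rightarrow> complex" where
  "f_line x y = (if y > 0 then f (Complex x y) else 0)"

lemma f_line_measurable [measurable]: "f_line x \<in> borel_measurable borel"
proof -
  have "(\<lambda>y. if y \<in> {0<..} then f (Complex x y) else 0) \<in> borel_measurable borel"
    by (rule borel_measurable_continuous_on_if) (auto intro: line_continuous)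
  then show ?thesis by (simp add: f_line_def[abs_def])
qed

text \<open>Hecke's argument: a(n) exp(-2 pi n y) is a Fourier coefficient of f at height y, hence
  O(y^(-2)). At y = 1/n the exponential is a constant.\<close>

lemma coefficient_bound:
  obtains C where "\<And>n. n \<ge> 1 \<Longrightarrow> norm (a n) \<le> C * real n powr 2"
proof -
  obtain C where C: "C \<ge> 0" "\<And>x y. y > 0 \<Longrightarrow> norm (f (Complex x y)) \<le> C / y\<^sup>2"
    using inverse_square_bound by blast
  have "norm (a n) \<le> (C * exp (2 * pi)) * real n powr 2" if n: "n \<ge> 1" for n
  proof -
    define y where "y = 1 / real n"
    have y: "y > 0" "real n * y = 1" using n by (auto simp: y_def)
    have e: "ee (real l * x) * ee (- (of_int (int n) * x)) = ee (of_int (int l - int n) * x)" for l x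
      by (simp add: ee_add[symmetric] algebra_simps)
    define h where "h l x = a l * of_real (exp (- (2 * pi * real l * y))) * ee (of_int (int l - int n) * x)" for l x
    have hs: "((\<lambda>l. h l x) has_sum f (Complex x y) * ee (- (of_int (int n) * x))) {1..}" for x
      using has_sum_cmult_left[OF expansion'[OF y(1), of x], of "ee (- (of_int (int n) * x))"]
      by (simp only: mult.assoc e h_def)
    have hi: "set_integrable lborel {0..<1} (h l)" for l
      unfolding h_def by (rule set_integrable_unit_interval[where B="norm (a l * of_real (exp (- (2 * pi * real l * y))))"]) (auto simp: norm_mult)
    have hn: "(LINT x:{0..<1}|lborel. norm (h l x)) = norm (a l) * exp (- (2 * pi * real l * y))" for l
      by (simp add: h_def norm_mult set_lebesgue_integral_def)
    note S = set_integral_has_sum[of "{1..}" lborel "{0..<1}" h "\<lambda>x. f (Complex x y) * ee (- (of_int (int n) * x))",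
        OF _ hi _ hs, unfolded hn, OF _ coeff_abs_summable[OF y(1)]]
    have "(LINT x:{0..<1}|lborel. h l x) = a l * of_real (exp (- (2 * pi * real l * y))) * (if l = n then 1 else 0)" for l
      unfolding h_def set_integral_mult_right unit_interval_ee_integral by simp
    with S(2) have "((\<lambda>l. a l * of_real (exp (- (2 * pi * real l * y))) * (if l = n then 1 else 0)) has_sum
      (LINT x:{0..<1}|lborel. f (Complex x y) * ee (- (of_int (int n) * x)))) {1..}" by simp
    moreover have "((\<lambda>l. a l * of_real (exp (- (2 * pi * real l * y))) * (if l = n then 1 else 0)) has_sum
      (a n * of_real (exp (- (2 * pi * real n * y))))) {1..}"
    proof (rule has_sum_cong_neutral[THEN iffD2])
      show "((\<lambda>l. a l * of_real (exp (- (2 * pi * real l * y))) * (if l = n then 1 else 0)) has_sum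
        (a n * of_real (exp (- (2 * pi * real n * y))))) {n}" by (rule has_sum_finiteI) auto
    qed (use n in auto)
    ultimately have "(LINT x:{0..<1}|lborel. f (Complex x y) * ee (- (of_int (int n) * x))) = a n * of_real (exp (- (2 * pi * real n * y)))"
      by (rule has_sum_unique)
    then have "norm (a n) * exp (- (2 * pi * real n * y)) = norm (LINT x:{0..<1}|lborel. f (Complex x y) * ee (- (of_int (int n) * x)))"
      by (simp add: norm_mult)
    also have "\<dots> \<le> (LINT x:{0..<1}|lborel. norm (f (Complex x y) * ee (- (of_int (int n) * x))))"
      using S(1) unfolding set_integrable_def set_lebesgue_integral_def
      using integral_norm_bound[of lborel "\<lambda>x. indicat_real {0..<1} x *\<^sub>R (f (Complex x y) * ee (- (of_int (int n) * x)))"] by simp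
    also have "\<dots> \<le> (LINT x:{0..<1::real}|lborel. C / y\<^sup>2)"
    proof (rule set_integral_mono)
      show "set_integrable lborel {0..<1} (\<lambda>x. norm (f (Complex x y) * ee (- (of_int (int n) * x))))"
        by (rule set_integrable_norm[OF S(1)]) auto
    qed (use C y in \<open>auto simp: norm_mult set_integrable_def\<close>)
    also have "\<dots> = C / y\<^sup>2" by (simp add: set_lebesgue_integral_def)
    finally have "norm (a n) * exp (- (2 * pi)) \<le> C / y\<^sup>2" using y by (simp add: mult.assoc)
    then have "norm (a n) \<le> C / y\<^sup>2 * exp (2 * pi)" by (simp add: exp_minus field_simps)
    also have "\<dots> = (C * exp (2 * pi)) * real n powr 2" using n by (simp add: y_def powr_numeral field_simps)
    finally show ?thesis .
  qed
  then show ?thesis using that by blast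
qed

end

section \<open>Lines above the cusps equivalent to infinity, and modular symbols\<close>

context cusp_form_expansion
begin

text \<open>On the line z = -d/c + iv the automorphy factor cz + d is the purely imaginary number
  icv, so the image is again a vertical line, above p/c, and the weight 2 factor is -(cv)^2.\<close>

lemma f_at_cusp:
  assumes A: "p * d - q * c = 1" and c: "c \<noteq> 0" "int N dvd c" and v: "v > 0"
  shows "f (Complex (of_int p / of_int c) (1 / ((of_int c)\<^sup>2 * v))) = - of_real ((of_int c * v)\<^sup>2) * f (Complex (- of_int d / of_int c) v)"
proof -
  define z where "z = Complex (- of_int d / of_int c) v"
  have j: "of_int c * z + of_int d = \<i> * of_real (of_int c * v)"
    using c by (simp add: z_def complex_eq_iff)
  have "moebius_act (mat2 p q c d) z = Complex (of_int p / of_int c) (1 / ((of_int c)\<^sup>2 * v))"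
  proof -
    have "(of_int p * z + of_int q) * of_int c = of_int p * (of_int c * z + of_int d) - of_int (p * d - q * c)"
      by (simp add: algebra_simps)
    then have "(of_int p * z + of_int q) * of_int c = of_int p * (\<i> * of_real (of_int c * v)) - 1" using A j by simp
    then have "of_int p * z + of_int q = (of_int p * (\<i> * of_real (of_int c * v)) - 1) / of_int c"
      using c by (simp add: field_simps)
    then show ?thesis
      unfolding moebius_act_mat2 j using c v by (simp add: complex_eq_iff Re_divide Im_divide power2_eq_square field_simps)
  qed
  moreover have "f (moebius_act (mat2 p q c d) z) = (\<i> * of_real (of_int c * v))\<^sup>2 * f z"
    unfolding j[symmetric] using A c v by (intro f_transform) (auto simp: z_def)
  ultimately show ?thesis by (simp add: power_mult_distrib z_def)
qed

text \<open>Near a cusp $-d/c$ with $N \mid c$ the transformation $v \mapsto 1/(c^2 v)$ turns the bound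
  $f(z) = O(\mathrm{Im}(z)^{-2})$ into the uniform bound $O(c^2)$.\<close>

lemma cusp_line_bound:
  obtains C where "C \<ge> 0"
    "\<And>c d v. c > 0 \<Longrightarrow> int N dvd c \<Longrightarrow> coprime c d \<Longrightarrow> v > 0 \<Longrightarrow>
       norm (f (Complex (- of_int d / of_int c) v)) \<le> C * (of_int c)\<^sup>2 * exp (- v)"
proof -
  obtain C where C: "C \<ge> 0" "\<And>x y. y > 0 \<Longrightarrow> norm (f (Complex x y)) \<le> C / y\<^sup>2"
    using inverse_square_bound by blast
  obtain D where D: "D \<ge> 0" "\<And>x y. y \<ge> 1 \<Longrightarrow> norm (f (Complex x y)) \<le> D * exp (- (2 * pi * y))"
    using exponential_decay by blast
  \<comment> \<open>The factor exp(-v), which costs only a constant e for v \<le> 1, makes the bound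
    integrable against \<open>v powr (\<sigma> - 1)\<close> for every \<sigma> > 0.\<close>
  have "norm (f (Complex (- of_int d / of_int c) v)) \<le> (C * exp 1 + D) * (of_int c)\<^sup>2 * exp (- v)"
    if c: "c > 0" "int N dvd c" "coprime c d" and v: "v > 0" for c d v
  proof -
    have c1: "1 \<le> (real_of_int c)\<^sup>2" using c(1) by simp
    obtain u w where uw: "u * c + w * d = 1" using bezout_int[of c d] c(3) by auto
    have A: "w * d - (- u) * c = 1" using uw by simp
    show ?thesis
    proof (cases "v \<le> 1")
      case True
      define k where "k = (real_of_int c)\<^sup>2 * v"
      have k: "k > 0" using c v by (simp add: k_def)
      have "(real_of_int c * v)\<^sup>2 * norm (f (Complex (- of_int d / of_int c) v)) = norm (f (Complex (of_int w / of_int c) (1 / k)))"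
        unfolding k_def using f_at_cusp[OF A _ c(2) v] c(1) by (simp add: norm_mult norm_power power_mult_distrib abs_mult)
      also have "\<dots> \<le> C / (1 / k)\<^sup>2" using k by (intro C) auto
      also have "\<dots> = C * (real_of_int c)\<^sup>2 * (real_of_int c * v)\<^sup>2" by (simp add: k_def power_divide power_mult_distrib power2_eq_square)
      finally have "norm (f (Complex (- of_int d / of_int c) v)) * (real_of_int c * v)\<^sup>2 \<le> C * (real_of_int c)\<^sup>2 * (real_of_int c * v)\<^sup>2"
        by (simp add: mult.commute)
      then have "norm (f (Complex (- of_int d / of_int c) v)) \<le> C * (real_of_int c)\<^sup>2"
        by (rule mult_right_le_imp_le) (use c v in auto)
      also have "\<dots> \<le> C * (real_of_int c)\<^sup>2 * (exp 1 * exp (- v))"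
      proof -
        have "1 \<le> exp 1 * exp (- v)" unfolding mult_exp_exp using True by simp
        from mult_left_mono[OF this, of "C * (real_of_int c)\<^sup>2"] show ?thesis using C(1) by simp
      qed
      also have "\<dots> \<le> (C * exp 1 + D) * (of_int c)\<^sup>2 * exp (- v)"
        using D(1) by (simp add: algebra_simps)
      finally show ?thesis .
    next
      case False
      have "norm (f (Complex (- of_int d / of_int c) v)) \<le> D * exp (- (2 * pi * v))" using False by (intro D) auto
      also have "\<dots> \<le> D * exp (- v)" using D(1) v pi_gt3 by (intro mult_left_mono) auto
      also have "\<dots> \<le> (D * (real_of_int c)\<^sup>2) * exp (- v)"
        using mult_left_mono[OF c1 D(1)] by (intro mult_right_mono) auto
      also have "\<dots> \<le> (C * exp 1 + D) * (of_int c)\<^sup>2 * exp (- v)"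
        using C(1) by (simp add: algebra_simps)
      finally show ?thesis .
    qed
  qed
  moreover have "C * exp 1 + D \<ge> 0" using C D by simp
  ultimately show ?thesis using that by blast
qed

lemma exp_powr_integrable:
  assumes "\<sigma> > 0"
  shows "set_integrable lborel {0<..} (\<lambda>v::real. exp (- v) * v powr (\<sigma> - 1))"
    and "(LINT v:{0<..}|lborel. exp (- v) * v powr (\<sigma> - 1)) = Gamma \<sigma>"
proof -
  have eq: "norm (of_real u powr (of_real \<sigma> - 1) * complex_of_real (exp (- (1 * u)))) = exp (- u) * u powr (\<sigma> - 1)" if "u \<in> {0<..}" for u
    using that by (simp add: norm_mult norm_of_real_powr)
  have "set_integrable lborel {0<..} (\<lambda>u. norm (of_real u powr (of_real \<sigma> - 1) * complex_of_real (exp (- (1 * u)))))"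
    using gamma_integral_scaled(1)[of 1 "of_real \<sigma>"] assms by (intro set_integrable_norm) auto
  then show "set_integrable lborel {0<..} (\<lambda>v::real. exp (- v) * v powr (\<sigma> - 1))"
    by (subst (asm) set_integrable_cong[OF refl refl eq]) auto
  have "(LINT v:{0<..}|lborel. exp (- v) * v powr (\<sigma> - 1)) = (LINT u:{0<..}|lborel. norm (of_real u powr (of_real \<sigma> - 1) * complex_of_real (exp (- (1 * u)))))"
    by (rule set_lebesgue_integral_cong) (use eq in auto)
  then show "(LINT v:{0<..}|lborel. exp (- v) * v powr (\<sigma> - 1)) = Gamma \<sigma>"
    using norm_gamma_integrand_integral[of 1 "of_real \<sigma>"] assms by simp
qed

definition line_mass :: "int \<Rightarrow> int \<Rightarrow> real \<Rightarrow> real" where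
  "line_mass c d \<sigma> = (LINT v:{0<..}|lborel. norm (f_line (- of_int d / of_int c) v) * v powr (\<sigma> - 1))"

text \<open>\<open>cusp_line_bound\<close> integrated against v^(\<sigma> - 1). The constant is
  quantified before c, d and \<sigma>, as summation over all cusps requires.\<close>

lemma cusp_line_integrable_aux:
  "\<exists>C\<ge>0. \<forall>c d \<sigma>. c > 0 \<and> int N dvd c \<and> coprime c d \<and> \<sigma> > 0 \<longrightarrow>
       set_integrable lborel {0<..} (\<lambda>v. norm (f_line (- of_int d / of_int c) v) * v powr (\<sigma> - 1)) \<and>
       line_mass c d \<sigma> \<le> C * (of_int c)\<^sup>2 * Gamma \<sigma>"
proof -
  obtain C where C: "C \<ge> 0"
    "\<And>c d v. c > 0 \<Longrightarrow> int N dvd c \<Longrightarrow> coprime c d \<Longrightarrow> v > 0 \<Longrightarrow>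
       norm (f (Complex (- of_int d / of_int c) v)) \<le> C * (of_int c)\<^sup>2 * exp (- v)"
    using cusp_line_bound by blast
  have *: "set_integrable lborel {0<..} (\<lambda>v. norm (f_line (- of_int d / of_int c) v) * v powr (\<sigma> - 1)) \<and>
       (LINT v:{0<..}|lborel. norm (f_line (- of_int d / of_int c) v) * v powr (\<sigma> - 1)) \<le> C * (of_int c)\<^sup>2 * Gamma \<sigma>"
    if c: "c > 0" "int N dvd c" "coprime c d" and \<sigma>: "\<sigma> > 0" for c d \<sigma>
  proof -
    have i: "set_integrable lborel {0<..} (\<lambda>v. C * (of_int c)\<^sup>2 * (exp (- v) * v powr (\<sigma> - 1)))"
      by (intro set_integrable_mult_right exp_powr_integrable \<sigma>)
    have b: "norm (norm (f_line (- of_int d / of_int c) v) * v powr (\<sigma> - 1)) \<le> C * (of_int c)\<^sup>2 * (exp (- v) * v powr (\<sigma> - 1))"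
      if "v \<in> {0<..}" for v
      using mult_right_mono[OF C(2)[OF c, of v], of "v powr (\<sigma> - 1)"] that by (simp add: f_line_def mult.assoc)
    have i': "set_integrable lborel {0<..} (\<lambda>v. norm (f_line (- of_int d / of_int c) v) * v powr (\<sigma> - 1))"
      by (rule set_integrable_dominated(1)[OF i _ _ b]) auto
    have "(LINT v:{0<..}|lborel. norm (f_line (- of_int d / of_int c) v) * v powr (\<sigma> - 1)) \<le>
        (LINT v:{0<..}|lborel. C * (of_int c)\<^sup>2 * (exp (- v) * v powr (\<sigma> - 1)))"
      by (rule set_integral_mono[OF i' i]) (use b in auto)
    also have "\<dots> = C * (of_int c)\<^sup>2 * Gamma \<sigma>" unfolding set_integral_mult_right exp_powr_integrable(2)[OF \<sigma>] ..
    finally show ?thesis using i' by simp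
  qed
  then show ?thesis unfolding line_mass_def using C(1) by blast
qed

lemma cusp_line_integrable:
  assumes "c > 0" "int N dvd c" "coprime c d" "\<sigma> > 0"
  shows "set_integrable lborel {0<..} (\<lambda>v. norm (f_line (- of_int d / of_int c) v) * v powr (\<sigma> - 1))"
  using cusp_line_integrable_aux assms by blast

lemma line_mass_bound:
  obtains C where "C \<ge> 0"
    "\<And>c d \<sigma>. c > 0 \<Longrightarrow> int N dvd c \<Longrightarrow> coprime c d \<Longrightarrow> \<sigma> > 0 \<Longrightarrow> line_mass c d \<sigma> \<le> C * (of_int c)\<^sup>2 * Gamma \<sigma>"
  using cusp_line_integrable_aux by blast

text \<open>The line lies above -d/c, the image of infinity under the inverse of the matrix, and not
  above p/c. In this form the modular symbol depends on the bottom row alone and is periodic in d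
  modulo c.\<close>

definition cusp_integral :: "int \<Rightarrow> int \<Rightarrow> complex" where
  "cusp_integral c d = (LINT v:{0<..}|lborel. f_line (- of_int d / of_int c) v)"

lemma cusp_line_integrable':
  assumes "c > 0" "int N dvd c" "coprime c d"
  shows "set_integrable lborel {0<..} (f_line (- of_int d / of_int c))"
proof -
  have "set_integrable lborel {0<..} (\<lambda>v. norm (f_line (- of_int d / of_int c) v) * v powr (1 - 1))"
    by (rule cusp_line_integrable[OF assms]) simp
  then show ?thesis
    by (rule set_integrable_dominated(1)) auto
qed

lemma cusp_integral_bound:
  obtains C where "C \<ge> 0"
    "\<And>c d. c > 0 \<Longrightarrow> int N dvd c \<Longrightarrow> coprime c d \<Longrightarrow> norm (cusp_integral c d) \<le> C * (of_int c)\<^sup>2"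
proof -
  obtain C where C: "C \<ge> 0"
    "\<And>c d \<sigma>. c > 0 \<Longrightarrow> int N dvd c \<Longrightarrow> coprime c d \<Longrightarrow> \<sigma> > 0 \<Longrightarrow> line_mass c d \<sigma> \<le> C * (of_int c)\<^sup>2 * Gamma \<sigma>"
    using line_mass_bound by blast
  have "norm (cusp_integral c d) \<le> C * (of_int c)\<^sup>2" if c: "c > 0" "int N dvd c" "coprime c d" for c d
  proof -
    have "norm (cusp_integral c d) \<le> (LINT v:{0<..}|lborel. norm (f_line (- of_int d / of_int c) v) * v powr (1 - 1))"
      unfolding cusp_integral_def using cusp_line_integrable[OF c, of 1] by (intro set_integrable_dominated(2)) auto
    also have "\<dots> \<le> C * (of_int c)\<^sup>2" using C(2)[OF c, of 1] by (simp add: line_mass_def)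
    finally show ?thesis .
  qed
  with C(1) that show ?thesis by blast
qed

lemma cusp_integral_periodic: "c > 0 \<Longrightarrow> cusp_integral c (d + c * k) = cusp_integral c d"
proof -
  assume c: "c > 0"
  have "f_line (- of_int (d + c * k) / of_int c) v = f_line (- of_int d / of_int c) v" for v
  proof -
    have "- of_int (d + c * k) / of_int c = - of_int d / of_int c + real_of_int (- k)" using c by (simp add: field_simps)
    with f_periodic[of v "- of_int d / of_int c" "- k"] show ?thesis
      unfolding f_line_def by (cases "v > 0") (simp_all only: if_True if_False)
  qed
  then show ?thesis by (simp add: cusp_integral_def)
qed

text \<open>The substitution y = 1/(c^2 v) carries the line above p/c to the line above -d/c. Its
  Jacobian 1/(c^2 v^2) cancels the factor (cv)^2 of weight 2, and the sign of -(cv)^2 cancels the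
  orientation sign in \<open>modular_symbol\<close>, leaving the factor i.\<close>

lemma modular_symbol_eq:
  assumes A: "p * d - q * c = 1" and c: "c > 0" "int N dvd c"
  shows "modular_symbol f (mat2 p q c d) = \<i> * cusp_integral c d"
proof -
  have cop: "coprime c d"
  proof (rule coprimeI)
    fix l assume "l dvd c" "l dvd d"
    then have "l dvd p * d - q * c" by simp
    then show "is_unit l" using A by simp
  qed
  define k where "k = (real_of_int c)\<^sup>2"
  have k: "k > 0" using c by (simp add: k_def)
  define g where "g v = 1 / (k * v)" for v :: real
  define g' where "g' v = - (1 / (k * v\<^sup>2))" for v :: real
  define F where "F = f_line (of_int p / of_int c)"
  define F1 where "F1 = f_line (- of_int d / of_int c)"
  \<comment> \<open>The identity is proved for v \<le> 0 too, where both sides are 0, so that it can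
    rewrite the integrand as a function on the whole line.\<close>
  have e: "of_real \<bar>g' v\<bar> * F (g v) = - F1 v" for v
  proof (cases "v > 0")
    case True
    have "F (g v) = - of_real ((of_int c * v)\<^sup>2) * F1 v"
      using f_at_cusp[OF A _ c(2) True] c(1) k True by (simp add: F_def F1_def f_line_def g_def k_def)
    moreover have "\<bar>g' v\<bar> * (of_int c * v)\<^sup>2 = 1" using True k c by (simp add: g'_def k_def power_mult_distrib)
    then have "complex_of_real \<bar>g' v\<bar> * of_real ((of_int c * v)\<^sup>2) = 1" by (metis of_real_1 of_real_mult)
    ultimately show ?thesis by (metis mult.assoc mult_minus_left mult_minus_right mult_1_left)
  next
    case False
    then have "g v \<le> 0" using k by (simp add: g_def divide_nonneg_nonpos mult_nonneg_nonpos)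
    with False show ?thesis by (simp add: F_def F1_def f_line_def)
  qed
  have im: "g ` {0<..} = {0<..}"
  proof (intro equalityI subsetI)
    fix u :: real assume "u \<in> {0<..}"
    then show "u \<in> g ` {0<..}" using k by (intro image_eqI[of _ _ "1 / (k * u)"]) (auto simp: g_def)
  qed (use k in \<open>auto simp: g_def\<close>)
  have der: "(g has_field_derivative g' v) (at v within {0<..})" if "v \<in> {0<..}" for v
    unfolding g_def g'_def using that k by (auto intro!: derivative_eq_intros simp: power2_eq_square field_simps)
  have inj: "inj_on g {0<..}" using k by (auto simp: inj_on_def g_def)
  have m: "F \<in> borel_measurable borel" "(\<lambda>v. of_real \<bar>g' v\<bar> * F (g v)) \<in> borel_measurable borel"
    unfolding e unfolding F_def F1_def by measurable
  have m1: "{0::real<..} \<in> sets borel" "g ` {0<..} \<in> sets borel" unfolding im by auto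
  note CV = set_integral_change_of_variables[OF m1 der inj m, unfolded im e]
  have i1: "set_integrable lborel {0<..} F1"
    unfolding F1_def by (rule cusp_line_integrable'[OF c cop])
  then have "set_integrable lborel {0<..} (\<lambda>v. - F1 v)" by (simp add: set_integrable_def)
  with CV have "(LINT v:{0<..}|lborel. - F1 v) = (LINT y:{0<..}|lborel. F y)" by simp
  then have I: "(LINT y:{0<..}|lborel. F y) = - cusp_integral c d"
    by (simp add: cusp_integral_def F1_def set_lebesgue_integral_def)
  have "modular_symbol f (mat2 p q c d) = - (LINT y:{0<..}|lborel. F y * \<i>)"
  proof -
    have "of_int p / of_int c + \<i> * of_real y = Complex (of_int p / of_int c) y" for y
      by (simp add: complex_eq_iff Re_divide Im_divide power2_eq_square)
    then show ?thesis
      unfolding modular_symbol_def using c(1)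
      by (auto simp: F_def f_line_def intro!: set_lebesgue_integral_cong)
  qed
  also have "(LINT y:{0<..}|lborel. F y * \<i>) = (LINT y:{0<..}|lborel. F y) * \<i>"
    by (rule set_integral_mult_left)
  finally show ?thesis using I by simp
qed

lemma modular_symbol_minus:
  "modular_symbol f (mat2 (- p) (- q) (- c) (- d)) = modular_symbol f (mat2 p q c d)"
  by (simp add: modular_symbol_def)

end

subsection \<open>Hecke eigenvalues\<close>

lemma has_sum_finite_sum:
  fixes g :: "'d \<Rightarrow> 'i \<Rightarrow> complex"
  assumes "finite D" and "\<And>d. d \<in> D \<Longrightarrow> (g d has_sum S d) A"
  shows "((\<lambda>x. \<Sum>d\<in>D. g d x) has_sum (\<Sum>d\<in>D. S d)) A"
  using assms by (induction D rule: finite_induct) (auto intro!: has_sum_add has_sum_0)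

lemma has_sum_product:
  fixes f :: "'i \<Rightarrow> complex" and g :: "'j \<Rightarrow> complex"
  assumes f: "(f has_sum S) A" and g: "(g has_sum T) B"
  shows "((\<lambda>(x, y). f x * g y) has_sum (S * T)) (A \<times> B)"
proof (rule has_sum_SigmaI)
  show "((\<lambda>y. case (x, y) of (x, y) \<Rightarrow> f x * g y) has_sum f x * T) B" for x
    using has_sum_cmult_right[OF g] by simp
  show "((\<lambda>x. f x * T) has_sum S * T) A" by (rule has_sum_cmult_left[OF f])
  have fn: "(\<lambda>x. norm (f x)) summable_on A" and gn: "(\<lambda>y. norm (g y)) summable_on B"
    using has_sum_imp_summable[OF f] has_sum_imp_summable[OF g] by (simp_all only: summable_on_iff_abs_summable_on_complex)
  have "(\<lambda>p. norm (f (fst p)) * norm (g (snd p))) summable_on A \<times> B"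
  proof (rule summable_on_SigmaI)
    show "((\<lambda>y. norm (f (fst (x, y))) * norm (g (snd (x, y)))) has_sum norm (f x) * infsum (\<lambda>y. norm (g y)) B) B" for x
      using has_sum_cmult_right[OF has_sum_infsum[OF gn]] by simp
    show "(\<lambda>x. norm (f x) * infsum (\<lambda>y. norm (g y)) B) summable_on A"
      by (rule summable_on_cmult_left[OF fn])
  qed auto
  then have "(\<lambda>p. norm (case p of (x, y) \<Rightarrow> f x * g y)) summable_on A \<times> B"
    by (simp add: case_prod_unfold norm_mult)
  then show "(\<lambda>(x, y). f x * g y) summable_on A \<times> B"
    by (simp only: summable_on_iff_abs_summable_on_complex)
qed

context cusp_form_expansion
begin

text \<open>For each divisor d of n the sum over b modulo d detects d | l and contributes a factor
  d; together with n / d^2 it gives the weight n/d.\<close>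

lemma hecke_op2_expansion:
  assumes n: "n \<ge> 1" and y: "y > 0"
  shows "((\<lambda>m. (\<Sum>d | d dvd n. if n div d dvd m then of_nat (n div d) * a (d * (m div (n div d))) else 0)
        * of_real (exp (- (2 * pi * real m * y))) * ee (real m * x)) has_sum hecke_op2 n f (Complex x y)) {1..}"
proof -
  have each: "((\<lambda>m. (if n div d dvd m then of_nat (n div d) * a (d * (m div (n div d))) else 0)
        * of_real (exp (- (2 * pi * real m * y))) * ee (real m * x)) has_sum
     of_nat n * ((\<Sum>b<d. f ((of_nat (n div d) * Complex x y + of_nat b) / of_nat d)) / of_nat d ^ 2)) {1..}"
    if d: "d dvd n" for d
  proof -
    define k where "k = n div d"
    have nk: "n = d * k" using d by (simp add: k_def)
    have p: "d > 0" "k > 0" using n nk by (auto simp: Suc_le_eq)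
    define u where "u l = of_real (exp (- (2 * pi * real l * (real k * y / real d)))) * ee (real l * (real k * x / real d))" for l :: nat
    have arg: "(of_nat k * Complex x y + of_nat b) / of_nat d = Complex (real k * x / real d + real b / real d) (real k * y / real d)" for b
      using p by (simp add: complex_eq_iff Re_divide_of_nat Im_divide_of_nat add_divide_distrib)
    have "((\<lambda>l. a l * u l * ee (of_int (int l * int b) / real d)) has_sum f ((of_nat k * Complex x y + of_nat b) / of_nat d)) {1..}" for b
    proof -
      have "((\<lambda>l. a l * of_real (exp (- (2 * pi * real l * (real k * y / real d)))) * ee (real l * (real k * x / real d + real b / real d)))
          has_sum f ((of_nat k * Complex x y + of_nat b) / of_nat d)) {1..}"
        unfolding arg using p y by (intro expansion') auto
      moreover have "ee (real l * (real k * x / real d + real b / real d)) = ee (real l * (real k * x / real d)) * ee (of_int (int l * int b) / real d)" for l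
        unfolding ee_add[symmetric] by (simp add: algebra_simps)
      ultimately show ?thesis by (simp only: u_def mult.assoc)
    qed
    then have "((\<lambda>l. \<Sum>b<d. a l * u l * ee (of_int (int l * int b) / real d)) has_sum (\<Sum>b<d. f ((of_nat k * Complex x y + of_nat b) / of_nat d))) {1..}"
      by (intro has_sum_finite_sum) auto
    moreover have "(\<Sum>b<d. a l * u l * ee (of_int (int l * int b) / real d)) = (if d dvd l then a l * u l * of_nat d else 0)" for l
    proof -
      have "(\<Sum>b<d. ee (of_int (int l * int b) / real d)) = (if d dvd l then of_nat d else 0)"
        using sum_ee_residues[OF p(1), of "int l"] by (simp add: sum_int_residues)
      then show ?thesis unfolding sum_distrib_left[symmetric] by simp
    qed
    ultimately have "((\<lambda>l. if d dvd l then a l * u l * of_nat d else 0) has_sum (\<Sum>b<d. f ((of_nat k * Complex x y + of_nat b) / of_nat d))) {1..}"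
      by simp
    then have "((\<lambda>l. a l * u l * of_nat d) has_sum (\<Sum>b<d. f ((of_nat k * Complex x y + of_nat b) / of_nat d))) {l. l \<ge> 1 \<and> d dvd l}"
      by (rule has_sum_cong_neutral[THEN iffD1, rotated -1]) auto
    \<comment> \<open>With k = n/d, the index l = d j appears with frequency l k / d = k j, so it
      contributes to the coefficient at m = k j.\<close>
    moreover have "bij_betw (\<lambda>m. d * (m div k)) {m. m \<ge> 1 \<and> k dvd m} {l. l \<ge> 1 \<and> d dvd l}"
    proof (rule bij_betwI[of _ _ _ "\<lambda>l. k * (l div d)"])
      show "(\<lambda>m. d * (m div k)) \<in> {m. 1 \<le> m \<and> k dvd m} \<rightarrow> {l. 1 \<le> l \<and> d dvd l}"
        using p by (auto elim!: dvdE simp: Suc_le_eq)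
      show "(\<lambda>l. k * (l div d)) \<in> {l. 1 \<le> l \<and> d dvd l} \<rightarrow> {m. 1 \<le> m \<and> k dvd m}"
        using p by (auto elim!: dvdE simp: Suc_le_eq)
    qed (use p in \<open>auto elim!: dvdE\<close>)
    ultimately have "((\<lambda>m. a (d * (m div k)) * u (d * (m div k)) * of_nat d) has_sum (\<Sum>b<d. f ((of_nat k * Complex x y + of_nat b) / of_nat d))) {m. m \<ge> 1 \<and> k dvd m}"
      using has_sum_reindex_bij_betw[of "\<lambda>m. d * (m div k)" _ _ "\<lambda>l. a l * u l * of_nat d"] by simp
    from has_sum_cmult_right[OF this, of "of_nat n / of_nat d ^ 2"]
    have "((\<lambda>m. of_nat n / of_nat d ^ 2 * (a (d * (m div k)) * u (d * (m div k)) * of_nat d)) has_sum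
        of_nat n * ((\<Sum>b<d. f ((of_nat k * Complex x y + of_nat b) / of_nat d)) / of_nat d ^ 2)) {m. m \<ge> 1 \<and> k dvd m}" by simp
    then have "((\<lambda>m. (if k dvd m then of_nat k * a (d * (m div k)) else 0)
        * of_real (exp (- (2 * pi * real m * y))) * ee (real m * x)) has_sum
        of_nat n * ((\<Sum>b<d. f ((of_nat k * Complex x y + of_nat b) / of_nat d)) / of_nat d ^ 2)) {1..}"
    proof (rule has_sum_cong_neutral[THEN iffD1, rotated -1])
      fix m assume m: "m \<in> {m. m \<ge> 1 \<and> k dvd m} \<inter> {1..}"
      then obtain j where j: "m = k * j" by (auto elim: dvdE)
      have e1: "u (d * (m div k)) = of_real (exp (- (2 * pi * real m * y))) * ee (real m * x)"
        using p by (simp add: u_def j field_simps)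
      have e2: "complex_of_nat n / of_nat d ^ 2 * of_nat d = of_nat k" using p by (simp add: nk power2_eq_square)
      have "of_nat n / of_nat d ^ 2 * (a (d * (m div k)) * u (d * (m div k)) * of_nat d) =
          (of_nat n / of_nat d ^ 2 * of_nat d) * a (d * (m div k)) * u (d * (m div k))" by (simp only: mult_ac)
      then show "of_nat n / of_nat d ^ 2 * (a (d * (m div k)) * u (d * (m div k)) * of_nat d) =
          (if k dvd m then of_nat k * a (d * (m div k)) else 0) * of_real (exp (- (2 * pi * real m * y))) * ee (real m * x)"
        using m unfolding e1 e2 by (simp add: mult.assoc)
    qed auto
    then show ?thesis by (simp only: k_def)
  qed
  have "((\<lambda>m. \<Sum>d | d dvd n. (if n div d dvd m then of_nat (n div d) * a (d * (m div (n div d))) else 0)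
        * of_real (exp (- (2 * pi * real m * y))) * ee (real m * x)) has_sum
     (\<Sum>d | d dvd n. of_nat n * ((\<Sum>b<d. f ((of_nat (n div d) * Complex x y + of_nat b) / of_nat d)) / of_nat d ^ 2))) {1..}"
    by (rule has_sum_finite_sum) (use each n in simp_all)
  then show ?thesis by (simp add: hecke_op2_def sum_distrib_left sum_distrib_right)
qed

text \<open>Compare q-coefficients in the eigenvalue equation at height 1. The coefficient at m = 1
  identifies the eigenvalue with a(n) because a(1) = 1; only n has to be prime to N, while m is
  arbitrary.\<close>

lemma hecke_relation:
  assumes hecke: "hecke_eigenform2 N f" and a1: "a 1 = 1" and n: "n \<ge> 1" "coprime n N" and m: "m \<ge> 1"
  shows "a n * a m = (\<Sum>k | k dvd n \<and> k dvd m. of_nat k * a ((n div k) * (m div k)))"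
proof -
  obtain c where c: "\<And>z. z \<in> upper_half_plane \<Longrightarrow> hecke_op2 n f z = c * f z"
    using hecke n unfolding hecke_eigenform2_def by blast
  define A where "A m = (\<Sum>d | d dvd n. if n div d dvd m then of_nat (n div d) * a (d * (m div (n div d))) else 0)" for m
  have Ac: "A m = c * a m" if m: "m \<ge> 1" for m
  proof -
    \<comment> \<open>The q-coefficients are transported to integer frequencies, where frequency 0
      is absent as the uniqueness lemma requires.\<close>
    define h where "h j = (A (nat j) - c * a (nat j)) * of_real (exp (- (2 * pi * real (nat j) * 1)))" for j
    have "((\<lambda>j. h j * ee (of_int j * x)) has_sum 0) (int ` {1..})" for x
    proof (rule has_sum_reindex[THEN iffD2])
      have "((\<lambda>m. A m * of_real (exp (- (2 * pi * real m * 1))) * ee (real m * x) - c * (a m * of_real (exp (- (2 * pi * real m * 1))) * ee (real m * x)))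
          has_sum (hecke_op2 n f (Complex x 1) - c * f (Complex x 1))) {1..}"
        unfolding A_def by (intro has_sum_diff hecke_op2_expansion has_sum_cmult_right expansion' n) auto
      moreover have "hecke_op2 n f (Complex x 1) - c * f (Complex x 1) = 0"
        using c[of "Complex x 1"] by (simp add: upper_half_plane_def)
      ultimately show "((\<lambda>j. h j * ee (of_int j * x)) \<circ> int has_sum 0) {1..}"
        by (simp add: h_def o_def algebra_simps)
    qed (auto simp: inj_on_def)
    moreover have "0 \<notin> int ` {1::nat..}" by (auto simp: image_iff)
    ultimately have "h (int m) = 0"
      by (rule trigonometric_series_unique(2)) (use m in auto)
    then show ?thesis by (simp add: h_def)
  qed
  have A: "A m = (\<Sum>k | k dvd n \<and> k dvd m. of_nat k * a ((n div k) * (m div k)))" for m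
  proof -
    have "A m = (\<Sum>d\<in>{d. d dvd n \<and> n div d dvd m}. of_nat (n div d) * a (d * (m div (n div d))))"
    proof -
      have "A m = (\<Sum>d\<in>{d \<in> {d. d dvd n}. n div d dvd m}. of_nat (n div d) * a (d * (m div (n div d))))"
        unfolding A_def by (rule sum.inter_filter[symmetric]) (use n in simp)
      then show ?thesis by simp
    qed
    also have "\<dots> = (\<Sum>k | k dvd n \<and> k dvd m. of_nat k * a ((n div k) * (m div k)))"
    proof -
      have "n div (n div d) = d" "n div d dvd n" if "d dvd n" for d
        using that n by (auto elim!: dvdE)
      then show ?thesis
        by (intro sum.reindex_bij_witness[of _ "\<lambda>k. n div k" "\<lambda>d. n div d"]) auto
    qed
    finally show ?thesis .
  qed
  have "A 1 = a n"
  proof -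
    have "{k. k dvd n \<and> k dvd (1::nat)} = {1}" by auto
    then show ?thesis by (simp add: A)
  qed
  then have "c = a n" using Ac[of 1] a1 by simp
  with Ac[OF m] A[of m] show ?thesis by simp
qed

end

section \<open>Rankin convolution of f with the twisted divisor function\<close>

locale hecke_setting = even_primitive_char N chi + cusp_form_expansion N f a
  for N :: nat and chi :: "int \<Rightarrow> complex" and f :: "complex \<Rightarrow> complex" and a :: "nat \<Rightarrow> complex"
begin

text \<open>Since |a(de)| is at most a constant times d^2 e^2, the double series is dominated by a
  product of two convergent zeta series when both exponents exceed 2 + 1.\<close>

lemma coeff_pairs_summable:
  assumes t: "Re t > 3" and u: "Re u > 3"
  shows "(\<lambda>(d, e). chi (int d) * of_nat d powr (- t) * of_nat e powr (- u) * a (d * e)) summable_on {1..} \<times> {1..}"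
proof -
  obtain C where C: "\<And>n. n \<ge> 1 \<Longrightarrow> norm (a n) \<le> C * real n powr 2" using coefficient_bound by blast
  have z: "(\<lambda>n::nat. complex_of_real (real n powr (- (Re w - 2)))) summable_on {1..}" if "Re w > 3" for w
    using zeta_real_summable[of "Re w - 2"] that by (intro summable_on_of_real) auto
  have "(\<lambda>(d, e). complex_of_real (real d powr (- (Re t - 2))) * complex_of_real (real e powr (- (Re u - 2)))) summable_on ({1..} \<times> {1..})"
    using has_sum_product[OF has_sum_infsum[OF z[OF t]] has_sum_infsum[OF z[OF u]]] by (rule has_sum_imp_summable)
  then have "(\<lambda>p. norm (case p of (d, e) \<Rightarrow> complex_of_real (real d powr (- (Re t - 2))) * complex_of_real (real e powr (- (Re u - 2))))) summable_on ({1..} \<times> {1..})"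
    by (simp only: summable_on_iff_abs_summable_on_complex)
  from summable_on_cmult_right[OF this, of C]
  have "(\<lambda>p. norm (case p of (d, e) \<Rightarrow> chi (int d) * of_nat d powr (- t) * of_nat e powr (- u) * a (d * e))) summable_on {1..} \<times> {1..}"
  proof (rule summable_on_comparison_test)
    fix p assume "p \<in> {1::nat..} \<times> {1::nat..}"
    then obtain d e :: nat where p: "p = (d, e)" "d \<ge> 1" "e \<ge> 1" by auto
    have "norm (chi (int d) * of_nat d powr (- t) * of_nat e powr (- u) * a (d * e)) \<le> 1 * real d powr (- Re t) * real e powr (- Re u) * (C * real (d * e) powr 2)"
      unfolding norm_mult using p C[of "d * e"] norm_chi_le[of "int d"] by (intro mult_mono) (auto simp: norm_of_nat_powr)
    also have "\<dots> = C * ((real d powr (- Re t) * real d powr 2) * (real e powr (- Re u) * real e powr 2))"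
      using p by (simp add: powr_mult)
    also have "\<dots> = C * (real d powr (- (Re t - 2)) * real e powr (- (Re u - 2)))"
      by (simp only: powr_add[symmetric]) simp
    finally show "norm (case p of (d, e) \<Rightarrow> chi (int d) * of_nat d powr (- t) * of_nat e powr (- u) * a (d * e)) \<le>
        C * norm (case p of (d, e) \<Rightarrow> complex_of_real (real d powr (- (Re t - 2))) * complex_of_real (real e powr (- (Re u - 2))))"
      by (simp add: p norm_mult)
  qed auto
  then show ?thesis by (simp only: summable_on_iff_abs_summable_on_complex)
qed

text \<open>Multiply the two series as a double sum over (D, E) and insert the Hecke relation. With
  D = kd and E = ke the common divisor k separates: it carries chi(k) k^(1-t-u), whose sum is the
  L-series, and the sum over (d, e) grouped by l = de is Y.\<close>

lemma rankin_identity: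
  assumes hecke: "hecke_eigenform2 N f" and a1: "a 1 = 1" and t: "Re t > 3" and u: "Re u > 3"
    and A1: "((\<lambda>n. a n * chi (int n) * of_nat n powr (- t)) has_sum A1) {1..}"
    and A2: "((\<lambda>n. a n * of_nat n powr (- u)) has_sum A2) {1..}"
    and Y: "((\<lambda>l. a l * (\<Sum>d | d dvd l. chi (int d) * of_nat d powr (- t) * of_nat (l div d) powr (- u))) has_sum Y) {1..}"
  shows "L_char N chi (t + u - 1) * Y = A1 * A2"
proof -
  define T where "T = (\<lambda>(d, e). chi (int d) * of_nat d powr (- t) * of_nat e powr (- u) * a (d * e))"
  obtain Y' where Y': "(T has_sum Y') ({1..} \<times> {1..})"
    using coeff_pairs_summable[OF t u] unfolding T_def by (auto simp: summable_on_def)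
  have "Y' = Y"
  proof -
    have bij: "bij_betw (\<lambda>(l, d). (d, l div d)) (Sigma {1::nat..} (\<lambda>l. {d. d dvd l})) ({1..} \<times> {1..})"
      by (rule bij_betwI[of _ _ _ "\<lambda>(d, e). (d * e, d)"]) (auto elim!: dvdE simp: Suc_le_eq)
    have "((\<lambda>p. T (case p of (l, d) \<Rightarrow> (d, l div d))) has_sum Y') (Sigma {1::nat..} (\<lambda>l. {d. d dvd l}))"
      using Y' has_sum_reindex_bij_betw[OF bij, of T] by (simp add: case_prod_unfold)
    then have "((\<lambda>l. \<Sum>d | d dvd l. T (d, l div d)) has_sum Y') {1..}"
      by (rule has_sum_Sigma') (auto intro!: has_sum_finiteI simp: Suc_le_eq)
    moreover have "(\<Sum>d | d dvd l. T (d, l div d)) = a l * (\<Sum>d | d dvd l. chi (int d) * of_nat d powr (- t) * of_nat (l div d) powr (- u))" for l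
      unfolding sum_distrib_left by (rule sum.cong) (auto simp: T_def)
    ultimately have "((\<lambda>l. a l * (\<Sum>d | d dvd l. chi (int d) * of_nat d powr (- t) * of_nat (l div d) powr (- u))) has_sum Y') {1..}" by simp
    then show ?thesis using Y by (rule has_sum_unique)
  qed
  have L: "((\<lambda>k. chi (int k) * of_nat k powr (- (t + u - 1))) has_sum L_char N chi (t + u - 1)) {1..}"
  proof (rule has_sum_cong_neutral[THEN iffD1, OF _ _ _ L_char_has_sum(2)])
    show "chi (int k) * of_nat k powr (- (t + u - 1)) = 0" if "k \<in> {1..} - {n. n \<ge> 1 \<and> coprime n N}" for k
      using that chi_nonzero_iff[of "int k"] by auto
  qed (use t u in auto)
  define Z where "Z = (\<lambda>(k, (d, e)). chi (int k) * of_nat k powr (- (t + u - 1)) * T (d, e))"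
  have Z: "(Z has_sum (L_char N chi (t + u - 1) * Y)) ({1..} \<times> ({1..} \<times> {1..}))"
    using has_sum_product[OF L Y'] \<open>Y' = Y\<close> by (simp add: Z_def case_prod_unfold)
  \<comment> \<open>A pair (D, E) with a chosen common divisor k is the same datum as an arbitrary
    triple (k, d, e); the absolutely convergent triple sum can be regrouped either way.\<close>
  have bij: "bij_betw (\<lambda>((D, E), k). (k, (D div k, E div k))) (Sigma ({1..} \<times> {1..}) (\<lambda>(D, E). {k. k dvd D \<and> k dvd E})) ({1::nat..} \<times> ({1::nat..} \<times> {1::nat..}))"
    by (rule bij_betwI[of _ _ _ "\<lambda>(k, (d, e)). ((k * d, k * e), k)"]) (auto elim!: dvdE simp: Suc_le_eq)
  have "((\<lambda>p. Z (case p of ((D, E), k) \<Rightarrow> (k, (D div k, E div k)))) has_sum (L_char N chi (t + u - 1) * Y))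
     (Sigma ({1..} \<times> {1..}) (\<lambda>(D, E). {k. k dvd D \<and> k dvd E}))"
    using Z has_sum_reindex_bij_betw[OF bij, of Z] by (simp add: case_prod_unfold)
  then have "((\<lambda>q. \<Sum>k | k dvd fst q \<and> k dvd snd q. Z (k, (fst q div k, snd q div k))) has_sum (L_char N chi (t + u - 1) * Y)) ({1..} \<times> {1..})"
    by (rule has_sum_Sigma') (auto intro!: has_sum_finiteI simp: Suc_le_eq)
  moreover have "((\<lambda>(D, E). (a D * chi (int D) * of_nat D powr (- t)) * (a E * of_nat E powr (- u))) has_sum (A1 * A2)) ({1..} \<times> {1..})"
    by (rule has_sum_product[OF A1 A2])
  then have "((\<lambda>q. \<Sum>k | k dvd fst q \<and> k dvd snd q. Z (k, (fst q div k, snd q div k))) has_sum (A1 * A2)) ({1..} \<times> {1..})"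
  proof (rule has_sum_cong[THEN iffD1, rotated])
    fix q assume "q \<in> {1::nat..} \<times> {1::nat..}"
    then obtain D E where q: "q = (D, E)" "D \<ge> 1" "E \<ge> 1" by auto
    have each: "Z (k, (D div k, E div k)) = (chi (int D) * of_nat D powr (- t) * of_nat E powr (- u)) * (of_nat k * a ((D div k) * (E div k)))"
      if k: "k dvd D" "k dvd E" for k
    proof -
      obtain d e where de: "D = k * d" "E = k * e" using k by (auto elim!: dvdE)
      have p: "k > 0" "d > 0" "e > 0" using q de by (auto simp: Suc_le_eq)
      have "complex_of_nat k powr (- (t + u - 1)) = of_nat k powr (- t) * of_nat k powr (- u) * of_nat k"
        using p powr_add[of "complex_of_nat k" "- t - u" 1] powr_add[of "complex_of_nat k" "- t" "- u"] by (simp add: algebra_simps)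
      moreover have "complex_of_nat (k * d) powr (- t) = of_nat k powr (- t) * of_nat d powr (- t)"
        using powr_times_real[of "of_nat k" "of_nat d" "- t"] p by simp
      moreover have "complex_of_nat (k * e) powr (- u) = of_nat k powr (- u) * of_nat e powr (- u)"
        using powr_times_real[of "of_nat k" "of_nat e" "- u"] p by simp
      moreover have "D div k = d" "E div k = e" using p de by auto
      moreover have "chi (int (k * d)) = chi (int k) * chi (int d)" by (simp add: chi_mult)
      ultimately show ?thesis unfolding Z_def T_def prod.case de by (simp only: mult_ac)
    qed
    have "(\<Sum>k | k dvd D \<and> k dvd E. Z (k, (D div k, E div k))) =
        (chi (int D) * of_nat D powr (- t) * of_nat E powr (- u)) * (\<Sum>k | k dvd D \<and> k dvd E. of_nat k * a ((D div k) * (E div k)))"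
      unfolding sum_distrib_left using each by (intro sum.cong) auto
    \<comment> \<open>The Hecke relation is available for D prime to N; for all other D the factor
      chi(D) annihilates both sides.\<close>
    also have "\<dots> = (a D * chi (int D) * of_nat D powr (- t)) * (a E * of_nat E powr (- u))"
    proof (cases "coprime D N")
      case True
      then show ?thesis using hecke_relation[OF hecke a1 q(2) True q(3)] by (simp add: mult_ac)
    next
      case False
      then have "chi (int D) = 0" using chi_nonzero_iff[of "int D"] by auto
      then show ?thesis by simp
    qed
    finally show "(case q of (D, E) \<Rightarrow> (a D * chi (int D) * of_nat D powr (- t)) * (a E * of_nat E powr (- u))) =
        (\<Sum>k | k dvd fst q \<and> k dvd snd q. Z (k, (fst q div k, snd q div k)))" by (simp add: q)
  qed
  ultimately show ?thesis by (rule has_sum_unique)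
qed

end

subsection \<open>The Fourier expansion of the Eisenstein series\<close>

definition row_class :: "nat \<Rightarrow> int \<Rightarrow> int \<Rightarrow> (int ^ 2 ^ 2) set" where
  "row_class N c d = {\<delta> \<in> Gamma0 N. (\<delta> $ 2 $ 1 = c \<and> \<delta> $ 2 $ 2 = d) \<or> (\<delta> $ 2 $ 1 = - c \<and> \<delta> $ 2 $ 2 = - d)}"

text \<open>If two bottom rows agree up to a sign e, the quotient of the matrices is upper
  triangular with diagonal entries e, hence in \<open>Gamma_inf N\<close>. The sign is there because
  -I fixes infinity.\<close>

lemma left_coset_eq_row_class:
  assumes g: "\<gamma> \<in> Gamma0 N"
  shows "left_coset_rel N `` {\<gamma>} = row_class N (\<gamma> $ 2 $ 1) (\<gamma> $ 2 $ 2)"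
proof -
  obtain p q c d where \<gamma>: "\<gamma> = mat2 p q c d" "p * d - q * c = 1" "int N dvd c"
    using g by (rule Gamma0_cases)
  show ?thesis
  proof (intro equalityI subsetI)
    fix \<delta> assume "\<delta> \<in> left_coset_rel N `` {\<gamma>}"
    then obtain \<tau> where \<delta>: "\<delta> \<in> Gamma0 N" "\<tau> \<in> Gamma_inf N" "\<delta> = \<tau> ** \<gamma>"
      by (auto simp: left_coset_rel_def)
    then have "\<tau> \<in> Gamma0 N" "\<tau> $ 2 $ 1 = 0" by (auto simp: Gamma_inf_def)
    then obtain e b e' where \<tau>: "\<tau> = mat2 e b 0 e'" "e * e' = 1"
      by (metis Gamma0_cases diff_zero mat2_nth(3) mult_zero_right)
    have "e' = 1 \<or> e' = - 1" using \<tau>(2) by (metis mult.commute zmult_eq_1_iff)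
    then show "\<delta> \<in> row_class N (\<gamma> $ 2 $ 1) (\<gamma> $ 2 $ 2)"
      using \<delta> by (auto simp: row_class_def \<gamma> \<tau> mat2_mult)
  next
    fix \<delta> assume d: "\<delta> \<in> row_class N (\<gamma> $ 2 $ 1) (\<gamma> $ 2 $ 2)"
    then have dG: "\<delta> \<in> Gamma0 N" by (simp add: row_class_def)
    obtain p' q' c' d' where \<delta>: "\<delta> = mat2 p' q' c' d'" "p' * d' - q' * c' = 1" "int N dvd c'"
      using dG by (rule Gamma0_cases)
    obtain e where e: "e = 1 \<or> e = - 1" "c' = e * c" "d' = e * d"
    proof -
      have "(c' = c \<and> d' = d) \<or> (c' = - c \<and> d' = - d)" using d by (auto simp: row_class_def \<gamma> \<delta>)
      then show ?thesis using that[of 1] that[of "- 1"] by auto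
    qed
    have ee: "e * e = 1" using e(1) by auto
    define \<tau> where "\<tau> = mat2 (p' * d - q' * c) (q' * p - p' * q) 0 e"
    have "(p' * d - q' * c) * e = 1" using \<delta>(2) by (simp add: e algebra_simps)
    then have "\<tau> \<in> Gamma_inf N" by (simp add: \<tau>_def Gamma_inf_def mat2_in_Gamma0_iff)
    moreover have "\<delta> = \<tau> ** \<gamma>"
    proof -
      have "(p' * d - q' * c) * p + (q' * p - p' * q) * c = p' * (p * d - q * c)"
        "(p' * d - q' * c) * q + (q' * p - p' * q) * d = q' * (p * d - q * c)"
        by (simp_all add: algebra_simps)
      then show ?thesis unfolding \<tau>_def \<gamma>(1) \<delta>(1) mat2_mult mat2_eq_iff \<gamma>(2) by (simp add: e)
    qed
    ultimately show "\<delta> \<in> left_coset_rel N `` {\<gamma>}" using g dG by (auto simp: left_coset_rel_def)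
  qed
qed

lemma row_class_nonempty:
  assumes "coprime c d" "int N dvd c"
  obtains p q where "p * d - q * c = 1" "mat2 p q c d \<in> Gamma0 N" "mat2 p q c d \<in> row_class N c d"
proof -
  obtain u v where "u * c + v * d = 1" using bezout_int[of c d] assms by auto
  then have "v * d - (- u) * c = 1" by simp
  with assms show ?thesis using that[of v "- u"] by (simp add: mat2_in_Gamma0_iff row_class_def)
qed

lemma Gamma0_coprime_row:
  fixes \<gamma> :: "int ^ 2 ^ 2"
  assumes "\<gamma> \<in> Gamma0 N"
  shows "coprime (\<gamma> $ 2 $ 1) (\<gamma> $ 2 $ 2)" "int N dvd \<gamma> $ 2 $ 1"
proof -
  obtain p q c d where \<gamma>: "\<gamma> = mat2 p q c d" "p * d - q * c = 1" "int N dvd c"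
    using assms by (rule Gamma0_cases)
  have "coprime c d"
  proof (rule coprimeI)
    fix l assume "l dvd c" "l dvd d"
    then have "l dvd p * d - q * c" by simp
    then show "is_unit l" using \<gamma> by simp
  qed
  then show "coprime (\<gamma> $ 2 $ 1) (\<gamma> $ 2 $ 2)" "int N dvd \<gamma> $ 2 $ 1" using \<gamma> by auto
qed

lemma row_class_uminus: "row_class N (- c) (- d) = row_class N c d"
  by (auto simp: row_class_def)

text \<open>Normalise c > 0 by the sign and divide d by c with remainder. The omitted class is the
  one with c = 0, where the modular symbol vanishes.\<close>

lemma bij_cusp_pairs_row_classes:
  assumes N: "N > 0"
  shows "bij_betw (\<lambda>((c, d), m). row_class N (int c) (d + int c * m)) (cusp_pairs N \<times> UNIV)
     ({C \<in> Gamma0 N // left_coset_rel N. C \<noteq> row_class N 0 1})"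
proof (rule bij_betwI')
  fix x y assume x: "x \<in> cusp_pairs N \<times> (UNIV :: int set)" and y: "y \<in> cusp_pairs N \<times> (UNIV :: int set)"
  obtain c d m where xx: "x = ((c, d), m)" by (cases x) auto
  obtain c' d' m' where yy: "y = ((c', d'), m')" by (cases y) auto
  have hx: "c > 0" "int N dvd int c" "coprime (int c) d" "0 \<le> d" "d < int c" using x by (auto simp: xx cusp_pairs_def)
  have hy: "c' > 0" "int N dvd int c'" "coprime (int c') d'" "0 \<le> d'" "d' < int c'" using y by (auto simp: yy cusp_pairs_def)
  show "(((\<lambda>((c, d), m). row_class N (int c) (d + int c * m)) x) = ((\<lambda>((c, d), m). row_class N (int c) (d + int c * m)) y)) = (x = y)"
  proof
    assume "((\<lambda>((c, d), m). row_class N (int c) (d + int c * m)) x) = ((\<lambda>((c, d), m). row_class N (int c) (d + int c * m)) y)"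
    then have e: "row_class N (int c) (d + int c * m) = row_class N (int c') (d' + int c' * m')" by (simp add: xx yy)
    have "coprime (int c) (d + int c * m)" using hx(3) by (metis coprime_iff_gcd_eq_1 gcd_add_mult mult.commute add.commute)
    then obtain p q where "mat2 p q (int c) (d + int c * m) \<in> row_class N (int c) (d + int c * m)"
      using row_class_nonempty hx(2) by blast
    then have "mat2 p q (int c) (d + int c * m) \<in> row_class N (int c') (d' + int c' * m')" using e by simp
    then have cc: "c = c'" and dd: "d + int c * m = d' + int c' * m'" using hx(1) hy(1) by (auto simp: row_class_def)
    have "d = (d + int c * m) mod int c" using hx by simp
    also have "\<dots> = d'" unfolding dd using hy cc by simp
    finally have "d = d'" .
    with dd cc hx(1) show "x = y" by (simp add: xx yy)
  qed simp
next
  fix x assume x: "x \<in> cusp_pairs N \<times> (UNIV :: int set)"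
  obtain c d m where xx: "x = ((c, d), m)" by (cases x) auto
  have hx: "c > 0" "int N dvd int c" "coprime (int c) d" using x by (auto simp: xx cusp_pairs_def)
  have "coprime (int c) (d + int c * m)" using hx(3) by (metis coprime_iff_gcd_eq_1 gcd_add_mult mult.commute add.commute)
  then obtain p q where pq: "mat2 p q (int c) (d + int c * m) \<in> Gamma0 N" "mat2 p q (int c) (d + int c * m) \<in> row_class N (int c) (d + int c * m)"
    using row_class_nonempty hx(2) by blast
  have "row_class N (int c) (d + int c * m) \<in> Gamma0 N // left_coset_rel N"
    using left_coset_eq_row_class[OF pq(1)] pq(1) by (metis mat2_nth(3,4) quotientI)
  moreover have "row_class N (int c) (d + int c * m) \<noteq> row_class N 0 1"
  proof
    assume "row_class N (int c) (d + int c * m) = row_class N 0 1"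
    then have "mat2 p q (int c) (d + int c * m) \<in> row_class N 0 1" using pq(2) by simp
    then show False using hx(1) by (auto simp: row_class_def)
  qed
  ultimately show "((\<lambda>((c, d), m). row_class N (int c) (d + int c * m)) x) \<in> {C \<in> Gamma0 N // left_coset_rel N. C \<noteq> row_class N 0 1}"
    by (simp add: xx)
next
  fix C assume "C \<in> {C \<in> Gamma0 N // left_coset_rel N. C \<noteq> row_class N 0 1}"
  then obtain \<gamma> :: "int ^ 2 ^ 2" where \<gamma>: "\<gamma> \<in> Gamma0 N" "C = row_class N (\<gamma> $ 2 $ 1) (\<gamma> $ 2 $ 2)" and C: "C \<noteq> row_class N 0 1"
    by (auto simp: quotient_def left_coset_eq_row_class)
  define c where "c = \<bar>\<gamma> $ 2 $ 1\<bar>"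
  define d where "d = (if \<gamma> $ 2 $ 1 < 0 then - (\<gamma> $ 2 $ 2) else \<gamma> $ 2 $ 2)"
  have Ccd: "C = row_class N c d" unfolding \<gamma>(2) c_def d_def using row_class_uminus by auto
  have cop: "coprime c d" "int N dvd c" using Gamma0_coprime_row[OF \<gamma>(1)] by (auto simp: c_def d_def)
  have "c \<noteq> 0"
  proof
    assume "c = 0"
    then have "d = 1 \<or> d = - 1" using cop(1) by (auto simp: zdvd1_eq)
    then show False using C Ccd \<open>c = 0\<close> row_class_uminus[of N 0 1] by auto
  qed
  then have c0: "c > 0" by (simp add: c_def)
  have cd: "coprime c (d mod c)" using cop(1) c0 by (metis coprime_mod_right_iff less_irrefl)
  have "N dvd nat c" using cop(2) c0 by (metis int_dvd_int_iff int_nat_eq less_imp_le)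
  then have "((nat c, d mod c), d div c) \<in> cusp_pairs N \<times> (UNIV :: int set)"
    using c0 cd by (auto simp: cusp_pairs_def)
  then show "\<exists>x\<in>cusp_pairs N \<times> (UNIV :: int set). C = ((\<lambda>((c, d), m). row_class N (int c) (d + int c * m)) x)"
    by (rule bexI[rotated]) (use c0 in \<open>simp add: Ccd\<close>)
qed

context hecke_setting
begin

definition eis_coeff :: "nat \<Rightarrow> int \<Rightarrow> complex" where
  "eis_coeff c d = cnj (chi d) * (\<i> * cusp_integral (int c) d)"

text \<open>The chosen representative may have bottom row (c, d') or (-c, -d'), but no factor sees
  the sign: chi is even, and neither the modular symbol nor |cz + d'| changes. The shift by c m is
  invisible to chi because N | c, and to \<open>cusp_integral\<close> by periodicity, so m enters
  only through |cz + d'|^2 = c^2 ((x + d/c + m)^2 + y^2).\<close>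

lemma eisenstein_summand:
  assumes c: "c > 0" "N dvd c" "coprime (int c) d" and z: "Im z > 0"
  shows "(let \<gamma> = (SOME \<gamma>. \<gamma> \<in> row_class N (int c) (d + int c * m))
        in cnj (char_mat chi \<gamma>) * modular_symbol f \<gamma> * of_real (Im (moebius_act \<gamma> z)) powr s)
    = eis_coeff c d * of_nat c powr (- (2 * s)) * (of_real (Im z) powr s *
        of_real ((Re z + of_int d / of_nat c + of_int m)\<^sup>2 + (Im z)\<^sup>2) powr (- s))"
proof -
  define d' where "d' = d + int c * m"
  have cN: "int N dvd int c" using c(2) by simp
  have cop: "coprime (int c) d'" using c(3) unfolding d'_def by (metis coprime_iff_gcd_eq_1 gcd_add_mult mult.commute add.commute)
  define \<gamma> where "\<gamma> = (SOME \<gamma>. \<gamma> \<in> row_class N (int c) d')"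
  have "\<gamma> \<in> row_class N (int c) d'"
    unfolding \<gamma>_def using row_class_nonempty[OF cop cN] by (metis someI)
  then have g: "\<gamma> \<in> Gamma0 N" "(\<gamma> $ 2 $ 1 = int c \<and> \<gamma> $ 2 $ 2 = d') \<or> (\<gamma> $ 2 $ 1 = - int c \<and> \<gamma> $ 2 $ 2 = - d')"
    by (auto simp: row_class_def)
  obtain p q c1 d1 where \<gamma>: "\<gamma> = mat2 p q c1 d1" "p * d1 - q * c1 = 1" "int N dvd c1"
    using g(1) by (rule Gamma0_cases)
  have row: "(c1 = int c \<and> d1 = d') \<or> (c1 = - int c \<and> d1 = - d')" using g(2) by (simp add: \<gamma>(1))
  have chid: "char_mat chi \<gamma> = chi d"
  proof -
    obtain k where "int c = int N * k" using cN by (elim dvdE)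
    then have "chi d' = chi d" using chi_add_mult[of d "k * m"] by (simp add: d'_def mult.assoc)
    then show ?thesis using row by (auto simp: char_mat_def \<gamma>(1) chi_minus)
  qed
  have sym: "modular_symbol f \<gamma> = \<i> * cusp_integral (int c) d"
  proof -
    have ci: "cusp_integral (int c) d' = cusp_integral (int c) d"
      unfolding d'_def using c(1) by (intro cusp_integral_periodic) auto
    from row show ?thesis
    proof
      assume "c1 = int c \<and> d1 = d'"
      then show ?thesis using modular_symbol_eq[of p d1 q c1] \<gamma> c(1) ci by simp
    next
      assume r: "c1 = - int c \<and> d1 = - d'"
      then have "modular_symbol f \<gamma> = modular_symbol f (mat2 (- p) (- q) (int c) d')"
        using modular_symbol_minus[of "- p" "- q" "int c" d'] \<gamma>(1) by simp
      also have "\<dots> = \<i> * cusp_integral (int c) d'"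
        using r \<gamma>(2) c(1) cN by (intro modular_symbol_eq) auto
      finally show ?thesis by (simp add: ci)
    qed
  qed
  define Q where "Q = (Re z + of_int d / of_nat c + of_int m)\<^sup>2 + (Im z)\<^sup>2"
  have Q: "Q > 0" using z by (simp add: Q_def add_nonneg_pos)
  have "Im (moebius_act \<gamma> z) = Im z / (norm (of_int (int c) * z + of_int d'))\<^sup>2"
  proof -
    have "norm (of_int c1 * z + of_int d1) = norm (of_int (int c) * z + of_int d')"
    proof -
      have "of_int c1 * z + of_int d1 = of_int (int c) * z + of_int d' \<or> of_int c1 * z + of_int d1 = - (of_int (int c) * z + of_int d')"
        using row by auto
      then show ?thesis by (metis norm_minus_cancel)
    qed
    then show ?thesis using Im_moebius_act[OF \<gamma>(2), of z] \<gamma>(1) by simp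
  qed
  also have "(norm (of_int (int c) * z + of_int d'))\<^sup>2 = (real c)\<^sup>2 * Q"
    using c(1) by (simp add: cmod_power2 Q_def d'_def power_mult_distrib[symmetric] distrib_left) (simp add: power2_eq_square field_simps)
  finally have im: "Im (moebius_act \<gamma> z) = Im z * (inverse ((real c)\<^sup>2) * inverse Q)" by (simp add: field_simps)
  have pw: "of_real (u * v) powr s = of_real u powr s * complex_of_real v powr s" if "u > 0" "v > 0" for u v
    using that by (simp add: powr_times_real)
  have ip: "complex_of_real (inverse u) powr s = of_real u powr (- s)" if "u > 0" for u
  proof -
    have "complex_of_real (inverse u) powr s * of_real u powr s = 1" using pw[of "inverse u" u] that by simp
    then show ?thesis using that by (simp add: powr_minus field_simps)
  qed
  have "of_real (Im (moebius_act \<gamma> z)) powr s = of_real (Im z) powr s * (of_real ((real c)\<^sup>2) powr (- s) * of_real Q powr (- s))"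
  proof -
    have p: "inverse ((real c)\<^sup>2) > 0" "inverse Q > 0" using c(1) Q by auto
    have "of_real (Im z * (inverse ((real c)\<^sup>2) * inverse Q)) powr s = of_real (Im z) powr s * of_real (inverse ((real c)\<^sup>2) * inverse Q) powr s"
      by (rule pw) (use z p in auto)
    also have "complex_of_real (inverse ((real c)\<^sup>2) * inverse Q) powr s = of_real (inverse ((real c)\<^sup>2)) powr s * of_real (inverse Q) powr s"
      by (rule pw) (use p in auto)
    also have "complex_of_real (inverse ((real c)\<^sup>2)) powr s = of_real ((real c)\<^sup>2) powr (- s)" by (rule ip) (use c in auto)
    also have "complex_of_real (inverse Q) powr s = of_real Q powr (- s)" by (rule ip) (use Q in auto)
    finally show ?thesis unfolding im .
  qed
  also have "complex_of_real ((real c)\<^sup>2) powr (- s) = of_nat c powr (- (2 * s))"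
  proof -
    have "complex_of_real ((real c)\<^sup>2) powr (- s) = of_nat c powr (- s) * of_nat c powr (- s)"
      using powr_times_real[of "of_nat c" "of_nat c" "- s"] by (simp add: power2_eq_square)
    also have "\<dots> = of_nat c powr (- (2 * s))" using c(1) by (simp flip: powr_add)
    finally show ?thesis .
  qed
  finally show ?thesis
    unfolding d'_def[symmetric] \<gamma>_def[symmetric] Let_def chid sym eis_coeff_def Q_def by (simp add: mult_ac)
qed

lemma eis_coeff_bound:
  obtains C where "C \<ge> 0" "\<And>c d. (c, d) \<in> cusp_pairs N \<Longrightarrow> norm (eis_coeff c d) \<le> C * (real c)\<^sup>2"
proof -
  obtain C where C: "C \<ge> 0" "\<And>c d. c > 0 \<Longrightarrow> int N dvd c \<Longrightarrow> coprime c d \<Longrightarrow> norm (cusp_integral c d) \<le> C * (of_int c)\<^sup>2"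
    using cusp_integral_bound by blast
  have "norm (eis_coeff c d) \<le> C * (real c)\<^sup>2" if "(c, d) \<in> cusp_pairs N" for c d
  proof -
    have "norm (eis_coeff c d) \<le> 1 * norm (cusp_integral (int c) d)"
      unfolding eis_coeff_def norm_mult using norm_chi_le[of d] by (intro mult_mono) auto
    also have "\<dots> \<le> C * (real c)\<^sup>2" using C(2)[of "int c" d] that by (simp add: cusp_pairs_def)
    finally show ?thesis .
  qed
  with C(1) that show ?thesis by blast
qed

text \<open>Modular symbols grow at most like c^2, so the exponent left is 2 Re(s) - 2, which has to
  exceed 2 because there are up to c residues d for each c.\<close>

lemma eis_terms_summable:
  assumes s: "Re s > 2"
  shows "(\<lambda>(c, d). norm (eis_coeff c d * of_nat c powr (- (2 * s)))) summable_on cusp_pairs N"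
proof -
  obtain C where C: "C \<ge> 0" "\<And>c d. (c, d) \<in> cusp_pairs N \<Longrightarrow> norm (eis_coeff c d) \<le> C * (real c)\<^sup>2"
    using eis_coeff_bound by blast
  show ?thesis
  proof (rule summable_on_comparison_test)
    show "(\<lambda>p. C * (case p of (c, d) \<Rightarrow> real c powr (- (2 * Re s - 2)))) summable_on cusp_pairs N"
      using s by (intro summable_on_cmult_right cusp_pairs_summable) auto
    fix p assume p: "p \<in> cusp_pairs N"
    obtain c d where cd: "p = (c, d)" by (cases p)
    have c: "c > 0" using p by (auto simp: cd cusp_pairs_def)
    have "norm (eis_coeff c d * of_nat c powr (- (2 * s))) \<le> C * (real c)\<^sup>2 * real c powr (- (2 * Re s))"
      using C(2)[of c d] p c by (simp add: norm_mult norm_of_nat_powr cd mult_right_mono)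
    also have "(real c)\<^sup>2 = real c powr 2" using c by (simp add: powr_numeral)
    also have "C * real c powr 2 * real c powr (- (2 * Re s)) = C * real c powr (- (2 * Re s - 2))"
      by (simp only: mult.assoc powr_add[symmetric]) simp
    finally show "(case p of (c, d) \<Rightarrow> norm (eis_coeff c d * of_nat c powr (- (2 * s)))) \<le> C * (case p of (c, d) \<Rightarrow> real c powr (- (2 * Re s - 2)))"
      by (simp add: cd)
  qed auto
qed

definition eis_fourier :: "complex \<Rightarrow> int \<Rightarrow> complex" where
  "eis_fourier s n = (\<Sum>\<^sub>\<infinity>(c, d)\<in>cusp_pairs N. eis_coeff c d * of_nat c powr (- (2 * s)) * ee (of_int (n * d) / of_nat c))"

text \<open>Poisson summation in m is applied at x + d/c for each cusp, and the sums over cusps and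
  frequencies are interchanged. Absolute convergence of the double sum over (cusp, m) needs a bound
  on the inner sum that is uniform in the point x + d/c.\<close>

lemma eisenstein_fourier_has_sum:
  assumes s: "Re s > 2" and z: "z \<in> upper_half_plane"
  shows "((\<lambda>n. of_real (Im z) powr s * (fourier_kernel s (Im z) (of_int n) * ee (of_int n * Re z)) * eis_fourier s n)
     has_sum eisenstein_star N f chi z s) UNIV"
proof -
  define x where "x = Re z"
  define y where "y = Im z"
  have y: "y > 0" using z by (simp add: y_def upper_half_plane_def)
  have s1: "Re s \<ge> 1" using s by simp
  define K where "K = (\<lambda>(c, d). eis_coeff c d * of_nat c powr (- (2 * s)))"
  define Y where "Y = complex_of_real y powr s"
  define X where "X = (\<lambda>(c, d :: int). x + of_int d / of_nat c)" 
  define g where "g \<xi> m = complex_of_real ((\<xi> + of_int m)\<^sup>2 + y\<^sup>2) powr (- s)" for \<xi> :: real and m :: int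
  define \<sigma> where "\<sigma> = Re s"
  have Ks: "(\<lambda>p. norm (K p)) summable_on cusp_pairs N"
    using eis_terms_summable[OF s] by (simp add: K_def case_prod_unfold)
  define M where "M = (\<Sum>\<^sub>\<infinity>n::int. norm (fourier_kernel (of_real \<sigma>) y (of_int n)))"
  have P: "(\<lambda>m. g \<xi> m) summable_on UNIV" "((\<lambda>n. fourier_kernel s y (of_int n) * ee (of_int n * \<xi>)) has_sum (\<Sum>\<^sub>\<infinity>m. g \<xi> m)) UNIV" for \<xi>
    using kernel_poisson[OF y s1, of \<xi>] by (simp_all add: g_def)
  have gn: "(\<lambda>m. norm (g \<xi> m)) summable_on UNIV" for \<xi>
    using P(1) by (simp only: summable_on_iff_abs_summable_on_complex)
  \<comment> \<open>The uniform bound comes from Poisson summation at the real exponent \<sigma>: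
    the norms of the terms are the kernel for \<sigma>, and on the frequency side the point enters
    only through phases of modulus 1.\<close>
  have gM: "infsum (\<lambda>m. norm (g \<xi> m)) UNIV \<le> M" for \<xi>
  proof -
    have e: "complex_of_real ((\<xi> + of_int m)\<^sup>2 + y\<^sup>2) powr (- of_real \<sigma>) = of_real (norm (g \<xi> m))" for m
    proof -
      have p: "(\<xi> + of_int m)\<^sup>2 + y\<^sup>2 > 0" using y by (simp add: add_nonneg_pos)
      have "norm (g \<xi> m) = ((\<xi> + of_int m)\<^sup>2 + y\<^sup>2) powr (- \<sigma>)"
        unfolding g_def \<sigma>_def using p by (simp only: norm_of_real_powr uminus_complex.sel)
      then show ?thesis using p powr_of_real[of "(\<xi> + of_int m)\<^sup>2 + y\<^sup>2" "- \<sigma>"] by simp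
    qed
    have r: "Re (complex_of_real \<sigma>) \<ge> 1" using s1 by (simp add: \<sigma>_def)
    have "(\<lambda>n::int. norm (fourier_kernel (of_real \<sigma>) y (of_int n))) summable_on UNIV"
      using fourier_kernel_summable[OF y r] by (simp only: summable_on_iff_abs_summable_on_complex)
    then have "norm (\<Sum>\<^sub>\<infinity>m. complex_of_real (norm (g \<xi> m))) \<le> M"
      unfolding M_def
      by (intro norm_infsum_le[OF kernel_poisson(2)[OF y r, of \<xi>, unfolded e] has_sum_infsum]) (auto simp: norm_mult)
    moreover have "(\<Sum>\<^sub>\<infinity>m. complex_of_real (norm (g \<xi> m))) = of_real (infsum (\<lambda>m. norm (g \<xi> m)) UNIV)"
      by (rule infsumI) (intro has_sum_of_real has_sum_infsum gn)
    ultimately show ?thesis by simp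
  qed
  have M0: "M \<ge> 0" unfolding M_def by (intro infsum_nonneg) auto
  have sumA: "(\<lambda>(p, m). K p * (Y * g (X p) m)) summable_on cusp_pairs N \<times> UNIV"
  proof -
    have "(\<lambda>q. norm (K (fst q)) * (norm Y * norm (g (X (fst q)) (snd q)))) summable_on cusp_pairs N \<times> UNIV"
    proof (rule summable_on_SigmaI)
      show "((\<lambda>m. norm (K (fst (p, m))) * (norm Y * norm (g (X (fst (p, m))) (snd (p, m))))) has_sum
          norm (K p) * (norm Y * infsum (\<lambda>m. norm (g (X p) m)) UNIV)) UNIV" for p
        unfolding fst_conv snd_conv by (intro has_sum_cmult_right has_sum_infsum gn)
      show "(\<lambda>p. norm (K p) * (norm Y * infsum (\<lambda>m. norm (g (X p) m)) UNIV)) summable_on cusp_pairs N"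
      proof (rule summable_on_comparison_test)
        show "(\<lambda>p. norm (K p) * (norm Y * M)) summable_on cusp_pairs N"
          by (intro summable_on_cmult_left Ks)
        show "norm (K p) * (norm Y * infsum (\<lambda>m. norm (g (X p) m)) UNIV) \<le> norm (K p) * (norm Y * M)" for p
          by (intro mult_left_mono gM) auto
        show "0 \<le> norm (K p) * (norm Y * infsum (\<lambda>m. norm (g (X p) m)) UNIV)" for p
          by (intro mult_nonneg_nonneg infsum_nonneg) auto
      qed
    qed auto
    then have "(\<lambda>q. norm (case q of (p, m) \<Rightarrow> K p * (Y * g (X p) m))) summable_on cusp_pairs N \<times> UNIV"
      by (simp add: case_prod_unfold norm_mult)
    then show ?thesis by (simp only: summable_on_iff_abs_summable_on_complex)
  qed
  define E where "E = eisenstein_star N f chi z s"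
  have E1: "((\<lambda>(p, m). K p * (Y * g (X p) m)) has_sum E) (cusp_pairs N \<times> UNIV)"
  proof -
    define T where "T C = (let \<gamma> = (SOME \<gamma>. \<gamma> \<in> C) in cnj (char_mat chi \<gamma>) * modular_symbol f \<gamma> * of_real (Im (moebius_act \<gamma> z)) powr s)" for C
    \<comment> \<open>The coset of the stabiliser itself contributes 0, so the sum over all cosets
      equals the sum over the nontrivial ones.\<close>
    have T0: "T (row_class N 0 1) = 0"
    proof -
      have "coprime (0::int) 1" "int N dvd 0" by auto
      then obtain p q where "mat2 p q 0 1 \<in> row_class N 0 1" using row_class_nonempty by blast
      then have "(SOME \<gamma>. \<gamma> \<in> row_class N 0 1) \<in> row_class N 0 1" by (rule someI)
      then have "modular_symbol f (SOME \<gamma>. \<gamma> \<in> row_class N 0 1) = 0"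
        by (auto simp: row_class_def modular_symbol_def)
      then show ?thesis by (simp add: T_def)
    qed
    have TE: "T (case q of ((c, d), m) \<Rightarrow> row_class N (int c) (d + int c * m)) = (case q of (p, m) \<Rightarrow> K p * (Y * g (X p) m))"
      if "q \<in> cusp_pairs N \<times> UNIV" for q
    proof -
      obtain c d m where q: "q = ((c, d), m)" by (cases q) auto
      have "c > 0" "N dvd c" "coprime (int c) d" using that by (auto simp: q cusp_pairs_def)
      from eisenstein_summand[OF this y[unfolded y_def], of m s]
      show ?thesis by (simp add: q T_def K_def Y_def X_def g_def x_def y_def)
    qed
    have N0: "N > 0" using N_gt_1 by simp
    have "((\<lambda>q. T (case q of ((c, d), m) \<Rightarrow> row_class N (int c) (d + int c * m))) has_sum infsum (\<lambda>(p, m). K p * (Y * g (X p) m)) (cusp_pairs N \<times> UNIV)) (cusp_pairs N \<times> UNIV)"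
      using has_sum_infsum[OF sumA] by (rule has_sum_cong[THEN iffD1, rotated]) (simp add: TE)
    then have "(T has_sum infsum (\<lambda>(p, m). K p * (Y * g (X p) m)) (cusp_pairs N \<times> UNIV)) {C \<in> Gamma0 N // left_coset_rel N. C \<noteq> row_class N 0 1}"
      using has_sum_reindex_bij_betw[OF bij_cusp_pairs_row_classes[OF N0], of T] by (simp add: case_prod_unfold)
    then have "(T has_sum infsum (\<lambda>(p, m). K p * (Y * g (X p) m)) (cusp_pairs N \<times> UNIV)) (Gamma0 N // left_coset_rel N)"
      by (rule has_sum_cong_neutral[THEN iffD1, rotated -1]) (auto simp: T0)
    then have "E = infsum (\<lambda>(p, m). K p * (Y * g (X p) m)) (cusp_pairs N \<times> UNIV)"
      unfolding E_def eisenstein_star_def T_def[symmetric] by (rule infsumI)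
    then show ?thesis using has_sum_infsum[OF sumA] by simp
  qed
  have E2: "((\<lambda>p. K p * (Y * (\<Sum>\<^sub>\<infinity>m. g (X p) m))) has_sum E) (cusp_pairs N)"
    using E1 by (rule has_sum_Sigma') (auto intro!: has_sum_cmult_right has_sum_infsum P)
  define F where "F = (\<lambda>(p, n). K p * (Y * (fourier_kernel s y (of_int n) * ee (of_int n * X p))))"
  have fk: "(\<lambda>n::int. norm (fourier_kernel s y (of_int n))) summable_on UNIV"
    using fourier_kernel_summable[OF y s1] by (simp only: summable_on_iff_abs_summable_on_complex)
  have sumF: "F summable_on cusp_pairs N \<times> UNIV"
  proof -
    have "(\<lambda>q. norm (K (fst q)) * (norm Y * norm (fourier_kernel s y (of_int (snd q))))) summable_on cusp_pairs N \<times> UNIV"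
    proof (rule summable_on_SigmaI)
      show "((\<lambda>n. norm (K (fst (p, n))) * (norm Y * norm (fourier_kernel s y (of_int (snd (p, n)))))) has_sum
          norm (K p) * (norm Y * infsum (\<lambda>n::int. norm (fourier_kernel s y (of_int n))) UNIV)) UNIV" for p
        unfolding fst_conv snd_conv by (intro has_sum_cmult_right has_sum_infsum fk)
      show "(\<lambda>p. norm (K p) * (norm Y * infsum (\<lambda>n::int. norm (fourier_kernel s y (of_int n))) UNIV)) summable_on cusp_pairs N"
        by (intro summable_on_cmult_left Ks)
    qed auto
    then have "(\<lambda>q. norm (F q)) summable_on cusp_pairs N \<times> UNIV"
      by (simp add: case_prod_unfold norm_mult F_def)
    then show ?thesis by (simp only: summable_on_iff_abs_summable_on_complex)
  qed
  \<comment> \<open>Summing \<open>F\<close> over frequencies at a fixed cusp gives back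
    \<open>E2\<close>; exchanging the two indices then groups the same double sum by
    frequency.\<close>
  have "(F has_sum E) (cusp_pairs N \<times> UNIV)"
  proof (rule has_sum_SigmaI[OF _ E2 sumF])
    show "((\<lambda>n. F (p, n)) has_sum K p * (Y * (\<Sum>\<^sub>\<infinity>m. g (X p) m))) UNIV" for p
      unfolding F_def prod.case by (intro has_sum_cmult_right P)
  qed
  then have "((\<lambda>(n, p). F (p, n)) has_sum E) (UNIV \<times> cusp_pairs N)"
    by (subst (asm) has_sum_swap) (simp add: case_prod_unfold)
  then have "((\<lambda>n. Y * (fourier_kernel s y (of_int n) * ee (of_int n * x)) * eis_fourier s n) has_sum E) UNIV"
  proof (rule has_sum_Sigma')
    fix n :: int
    define h where "h = (\<lambda>(c, d). eis_coeff c d * of_nat c powr (- (2 * s)) * ee (of_int (n * d) / of_nat c))"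
    have "(\<lambda>p. norm (h p)) summable_on cusp_pairs N"
      using eis_terms_summable[OF s] by (simp add: h_def case_prod_unfold norm_mult)
    then have "h summable_on cusp_pairs N" by (simp only: summable_on_iff_abs_summable_on_complex)
    then have "(h has_sum eis_fourier s n) (cusp_pairs N)"
      unfolding eis_fourier_def h_def by (rule has_sum_infsum)
    from has_sum_cmult_right[OF this, of "Y * (fourier_kernel s y (of_int n) * ee (of_int n * x))"]
    have "((\<lambda>p. Y * (fourier_kernel s y (of_int n) * ee (of_int n * x)) * h p) has_sum
        Y * (fourier_kernel s y (of_int n) * ee (of_int n * x)) * eis_fourier s n) (cusp_pairs N)" .
    moreover have "Y * (fourier_kernel s y (of_int n) * ee (of_int n * x)) * h p = (case (n, p) of (n, p) \<Rightarrow> F (p, n))" for p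
    proof -
      obtain c d where p: "p = (c, d)" by (cases p)
      have "ee (of_int n * X p) = ee (of_int n * x) * ee (of_int (n * d) / of_nat c)"
        unfolding ee_add[symmetric] by (simp add: p X_def ring_distribs)
      then show ?thesis by (simp add: F_def h_def K_def p mult_ac)
    qed
    ultimately show "((\<lambda>p. case (n, p) of (n, p) \<Rightarrow> F (p, n)) has_sum Y * (fourier_kernel s y (of_int n) * ee (of_int n * x)) * eis_fourier s n) (cusp_pairs N)"
      by simp
  qed
  then show ?thesis by (simp add: Y_def x_def y_def E_def)
qed

lemma eisenstein_fourier_expansion:
  assumes s: "Re s > 2"
  shows "is_fourier_expansion N f chi s
    (of_real (sqrt pi) * Gamma (s - 1 / 2) / Gamma s * eis_fourier s 0,
     \<lambda>n. if n = 0 then 0 else of_real pi powr s * of_real \<bar>of_int n\<bar> powr (s - 1) / Gamma s * eis_fourier s n)"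
  unfolding is_fourier_expansion_def prod.case
proof (intro conjI ballI)
  fix z assume z: "z \<in> upper_half_plane"
  have y: "Im z > 0" using z by (simp add: upper_half_plane_def)
  have s1: "Re s \<ge> 1" using s by simp
  have Gs: "Gamma s \<noteq> 0" using s by (intro Gamma_complex_nonzero) auto
  define h where "h n = of_real (Im z) powr s * (fourier_kernel s (Im z) (of_int n) * ee (of_int n * Re z)) * eis_fourier s n" for n
  have h: "(h has_sum eisenstein_star N f chi z s) UNIV"
    unfolding h_def by (rule eisenstein_fourier_has_sum[OF s z])
  \<comment> \<open>The power y^s (y^2)^(1/2 - s) collapses to y^(1-s), which is why this frequency
    is the separate term in the definition of the expansion.\<close>
  have h0: "h 0 = of_real (sqrt pi) * Gamma (s - 1 / 2) / Gamma s * eis_fourier s 0 * of_real (Im z) powr (1 - s)"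
  proof -
    have "complex_of_real ((Im z)\<^sup>2) powr (1 / 2 - s) = of_real (Im z) powr (1 / 2 - s) * of_real (Im z) powr (1 / 2 - s)"
      using powr_times_real[of "of_real (Im z)" "of_real (Im z)" "1 / 2 - s"] y by (simp add: power2_eq_square)
    also have "\<dots> = of_real (Im z) powr (1 - 2 * s)" using y by (simp flip: powr_add)
    finally have "of_real (Im z) powr s * complex_of_real ((Im z)\<^sup>2) powr (1 / 2 - s) = of_real (Im z) powr (1 - s)"
      using y by (simp flip: powr_add)
    moreover have "fourier_kernel s (Im z) 0 = of_real (sqrt pi) * Gamma (s - 1 / 2) / Gamma s * of_real ((Im z)\<^sup>2) powr (1 / 2 - s)"
      using fourier_kernel_0[OF y s1] Gs by (simp add: field_simps)
    ultimately show ?thesis by (simp add: h_def mult_ac)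
  qed
  have "(h has_sum (eisenstein_star N f chi z s - h 0)) (UNIV - {0})"
    using has_sum_Diff[OF h has_sum_finite[of "{0}" h]] by simp
  then have "(h has_sum (eisenstein_star N f chi z s - of_real (sqrt pi) * Gamma (s - 1 / 2) / Gamma s * eis_fourier s 0 * of_real (Im z) powr (1 - s))) {n. n \<noteq> 0}"
    unfolding h0 by (simp add: Collect_neg_eq Compl_eq_Diff_UNIV)
  then show "((\<lambda>n. (if n = 0 then 0 else of_real pi powr s * of_real \<bar>of_int n\<bar> powr (s - 1) / Gamma s * eis_fourier s n) * whittaker_W s n z) has_sum
     (eisenstein_star N f chi z s - of_real (sqrt pi) * Gamma (s - 1 / 2) / Gamma s * eis_fourier s 0 * of_real (Im z) powr (1 - s))) {n. n \<noteq> 0}"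
    by (rule has_sum_cong[THEN iffD1, rotated])
       (use fourier_kernel_whittaker[OF y s1] in \<open>simp add: h_def mult_ac\<close>)
qed simp

text \<open>The definite description is resolved by the expansion just found together with its
  uniqueness; \<open>eis_fourier\<close> is the arithmetic part of the coefficients, stripped of
  Gamma factors and powers.\<close>

lemma phi_star_eq:
  assumes s: "Re s > 2"
  shows "phi_star_const N f chi s = of_real (sqrt pi) * Gamma (s - 1 / 2) / Gamma s * eis_fourier s 0"
    and "n \<noteq> 0 \<Longrightarrow> phi_star N f chi n s = of_real pi powr s * of_real \<bar>of_int n\<bar> powr (s - 1) / Gamma s * eis_fourier s n"
proof -
  have "(THE p. is_fourier_expansion N f chi s p) = (of_real (sqrt pi) * Gamma (s - 1 / 2) / Gamma s * eis_fourier s 0,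
     \<lambda>n. if n = 0 then 0 else of_real pi powr s * of_real \<bar>of_int n\<bar> powr (s - 1) / Gamma s * eis_fourier s n)"
  proof (rule the_equality[where P = "is_fourier_expansion N f chi s", OF eisenstein_fourier_expansion[OF s]])
    fix p assume p: "is_fourier_expansion N f chi s p"
    show "p = (of_real (sqrt pi) * Gamma (s - 1 / 2) / Gamma s * eis_fourier s 0,
     \<lambda>n. if n = 0 then 0 else of_real pi powr s * of_real \<bar>of_int n\<bar> powr (s - 1) / Gamma s * eis_fourier s n)"
      by (rule fourier_expansion_unique[OF _ p eisenstein_fourier_expansion[OF s]]) (use s in simp)
  qed
  then show "phi_star_const N f chi s = of_real (sqrt pi) * Gamma (s - 1 / 2) / Gamma s * eis_fourier s 0"
    "n \<noteq> 0 \<Longrightarrow> phi_star N f chi n s = of_real pi powr s * of_real \<bar>of_int n\<bar> powr (s - 1) / Gamma s * eis_fourier s n"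
    by (simp_all add: phi_star_const_def phi_star_def)
qed

end

subsection \<open>Comparison with the shifted convolution series\<close>

text \<open>Holomorphy in the half-plane of absolute convergence is obtained from the Mellin
  representation as well: \<Phi> is the exponential series with the same coefficients. It is applied
  to L(f, t) and L(chi, t).\<close>

lemma dirichlet_series_holomorphic:
  fixes b :: "nat \<Rightarrow> complex"
  assumes b: "\<And>l. l \<ge> 1 \<Longrightarrow> norm (b l) \<le> C * real l powr k" and k: "k \<ge> 0"
  obtains F where "F holomorphic_on {t. Re t > k + 1}"
    "\<And>t. Re t > k + 1 \<Longrightarrow> ((\<lambda>l. b l * of_nat l powr (- t)) has_sum F t) {1..}"
proof -
  have C0: "C \<ge> 0" using order_trans[OF norm_ge_zero b[of 1]] by simp
  define \<Phi> where "\<Phi> y = (if y > 0 then \<Sum>\<^sub>\<infinity>l\<in>{1..}. b l * of_real (exp (- (2 * pi * real l * y))) else 0)" for y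
  have \<Phi>: "((\<lambda>l. b l * of_real (exp (- (2 * pi * real l * y)))) has_sum \<Phi> y) {1..}" if y: "y > 0" for y
  proof -
    \<comment> \<open>From exp(-x) \<le> m!/x^m the terms are O(l^(k - m)), and m \<ge> k + 2 makes
      them O(l^(-2)).\<close>
    obtain m :: nat where m: "k + 2 \<le> real m" using real_arch_simple by blast
    define D where "D = fact m / (2 * pi * y) ^ m"
    have D0: "D \<ge> 0" using y by (simp add: D_def)
    have "(\<lambda>l. norm (b l * of_real (exp (- (2 * pi * real l * y))))) summable_on {1..}"
    proof (rule summable_on_comparison_test)
      show "(\<lambda>l. C * D * real l powr (- 2)) summable_on {1..}"
        by (intro summable_on_cmult_right zeta_real_summable) simp
      fix l :: nat assume l: "l \<in> {1..}"
      define x where "x = 2 * pi * real l * y"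
      have x: "x > 0" using l y by (simp add: x_def)
      have "x ^ m / fact m \<le> exp x"
        using sum_le_suminf[OF summable_exp, of "{m}" x] x by (simp add: exp_def divide_inverse mult.commute)
      then have "exp (- x) \<le> fact m / x ^ m" using x by (simp add: exp_minus field_simps)
      also have "\<dots> = D * real l powr (- real m)"
        using l y by (simp add: D_def x_def power_mult_distrib powr_minus powr_realpow field_simps)
      finally have e: "exp (- x) \<le> D * real l powr (- real m)" .
      have "norm (b l * of_real (exp (- x))) \<le> (C * real l powr k) * (D * real l powr (- real m))"
        unfolding norm_mult using b[of l] l e C0 by (intro mult_mono) auto
      also have "\<dots> = C * D * (real l powr (k - real m))"
        by (simp add: powr_diff powr_minus field_simps)
      also have "\<dots> \<le> C * D * real l powr (- 2)"
        using l m C0 D0 by (intro mult_left_mono powr_mono) auto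
      finally show "norm (b l * of_real (exp (- (2 * pi * real l * y)))) \<le> C * D * real l powr (- 2)"
        by (simp add: x_def)
    qed auto
    then have "(\<lambda>l. b l * of_real (exp (- (2 * pi * real l * y)))) summable_on {1..}"
      by (simp only: summable_on_iff_abs_summable_on_complex)
    then show ?thesis using y by (simp add: \<Phi>_def has_sum_infsum)
  qed
  have i: "set_integrable lborel {0<..} (\<lambda>y. \<Phi> y * of_real y powr (t - 1))" if "Re t > k + 1" for t
    by (rule mellin_dirichlet_series(2)[OF b _ that \<Phi>]) (use that k in auto)
  \<comment> \<open>Measurability of \<Phi> is recovered from integrability of its Mellin integrand
    at one exponent by multiplying the nonvanishing power of y back.\<close>
  have [measurable]: "\<Phi> \<in> borel_measurable borel"
  proof -
    let ?t = "of_real (k + 2) :: complex"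
    have [measurable]: "(\<lambda>y. indicat_real {0<..} y *\<^sub>R (\<Phi> y * of_real y powr (?t - 1))) \<in> borel_measurable borel"
      using borel_measurable_integrable[OF i[of ?t, unfolded set_integrable_def]] by simp
    have "(\<lambda>y. (indicat_real {0<..} y *\<^sub>R (\<Phi> y * of_real y powr (?t - 1))) * of_real y powr (1 - ?t)) \<in> borel_measurable borel"
      by measurable
    also have "(\<lambda>y. (indicat_real {0<..} y *\<^sub>R (\<Phi> y * of_real y powr (?t - 1))) * of_real y powr (1 - ?t)) = \<Phi>"
    proof (rule ext)
      fix y :: real
      have "complex_of_real y powr (?t - 1) * of_real y powr (1 - ?t) = 1" if "y > 0"
        using that by (simp only: powr_add[symmetric]) simp
      then show "(indicat_real {0<..} y *\<^sub>R (\<Phi> y * of_real y powr (?t - 1))) * of_real y powr (1 - ?t) = \<Phi> y"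
        by (cases "y > 0") (simp_all only: mult.assoc indicator_simps greaterThan_iff scaleR_one mult_1_right, simp add: \<Phi>_def)
    qed
    finally show ?thesis .
  qed
  have ni: "set_integrable lborel {0<..} (\<lambda>y. norm (\<Phi> y) * y powr (\<sigma> - 1))" if "\<sigma> > k + 1" for \<sigma>
  proof -
    have "set_integrable lborel {0<..} (\<lambda>y. norm (\<Phi> y * of_real y powr (of_real \<sigma> - 1)))"
      using i[of "of_real \<sigma>"] that by (intro set_integrable_norm) auto
    then show ?thesis
      by (rule set_integrable_dominated(1)) (auto simp: norm_mult norm_of_real_powr)
  qed
  define F where "F t = of_real (2 * pi) powr t / Gamma t * (LINT y:{0<..}|lborel. \<Phi> y * of_real y powr (t - 1))" for t
  have "k + 1 \<ge> 0" using k by simp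
  note M = continued_dirichlet_series_mellin[OF b this _ \<Phi> ni, folded F_def]
  show ?thesis
    by (rule that[of F]) (use M(1,2) k in auto)
qed

section \<open>Sums of f over the lines above all cusps, and their Mellin transforms\<close>

context hecke_setting
begin

text \<open>The function \<Psi>_n of the overview, extended by 0 to y \<le> 0 through
  \<open>f_line\<close>.\<close>

definition twisted_line_sum :: "complex \<Rightarrow> int \<Rightarrow> real \<Rightarrow> complex" where
  "twisted_line_sum s n y = (\<Sum>\<^sub>\<infinity>(c, d)\<in>cusp_pairs N. of_nat c powr (- (2 * s)) * cnj (chi d) * ee (of_int (n * d) / of_nat c)
      * f_line (- of_int d / of_nat c) y)"

lemma pair_weight_norm:
  assumes "(c, d) \<in> cusp_pairs N"
  shows "norm (of_nat c powr (- w) * cnj (chi d) * ee x) \<le> real c powr (- Re w)"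
  using assms by (intro pair_term_norm_le) (auto simp: cusp_pairs_def)

lemma twisted_line_sum_has_sum:
  assumes s: "Re s > 2"
  shows "((\<lambda>(c, d). of_nat c powr (- (2 * s)) * cnj (chi d) * ee (of_int (n * d) / of_nat c)
      * f_line (- of_int d / of_nat c) y) has_sum twisted_line_sum s n y) (cusp_pairs N)"
proof -
  obtain C where C: "C \<ge> 0"
    "\<And>c d v. c > 0 \<Longrightarrow> int N dvd c \<Longrightarrow> coprime c d \<Longrightarrow> v > 0 \<Longrightarrow>
       norm (f (Complex (- of_int d / of_int c) v)) \<le> C * (of_int c)\<^sup>2 * exp (- v)"
    using cusp_line_bound by blast
  define h where "h = (\<lambda>(c, d). of_nat c powr (- (2 * s)) * cnj (chi d) * ee (of_int (n * d) / of_nat c)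
      * f_line (- of_int d / of_nat c) y)"
  have "(\<lambda>p. norm (h p)) summable_on cusp_pairs N"
  proof (rule summable_on_comparison_test)
    show "(\<lambda>p. (C * exp (- y)) * (case p of (c, d) \<Rightarrow> real c powr (- (2 * Re s - 2)))) summable_on cusp_pairs N"
      using s by (intro summable_on_cmult_right cusp_pairs_summable) auto
    fix p assume p: "p \<in> cusp_pairs N"
    obtain c d where cd: "p = (c, d)" by (cases p)
    have c: "c > 0" "int N dvd int c" "coprime (int c) d" using p by (auto simp: cd cusp_pairs_def)
    have fl: "norm (f_line (- of_int d / of_nat c) y) \<le> C * (real c)\<^sup>2 * exp (- y)"
      using C(2)[of "int c" d y] c C(1) by (simp add: f_line_def)
    have "norm (h p) \<le> real c powr (- Re (2 * s)) * (C * (real c)\<^sup>2 * exp (- y))"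
      unfolding h_def cd prod.case norm_mult[of _ "f_line _ _"]
      using p fl by (intro mult_mono pair_weight_norm) (auto simp: cd)
    also have "(real c)\<^sup>2 = real c powr 2" using c by (simp add: powr_numeral)
    also have "real c powr (- Re (2 * s)) * (C * real c powr 2 * exp (- y)) = (C * exp (- y)) * (real c powr (- Re (2 * s)) * real c powr 2)"
      by (simp only: mult_ac)
    also have "real c powr (- Re (2 * s)) * real c powr 2 = real c powr (- (2 * Re s - 2))"
      by (simp only: powr_add[symmetric]) simp
    finally show "norm (h p) \<le> (C * exp (- y)) * (case p of (c, d) \<Rightarrow> real c powr (- (2 * Re s - 2)))" by (simp add: cd)
  qed (use C in auto)
  then have "h summable_on cusp_pairs N" by (simp only: summable_on_iff_abs_summable_on_complex)
  then show ?thesis unfolding twisted_line_sum_def h_def by (rule has_sum_infsum)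
qed

text \<open>The phase e(nd/c) and the phase e(-ld/c) of the l-th q-coefficient at -d/c combine to
  e(-(l - n)d/c), so for each l the sum over cusps is a Ramanujan series at l - n. This is where the
  shift comes from.\<close>

lemma twisted_line_sum_q_expansion:
  assumes s: "Re s > 2" and y: "y > 0"
  shows "((\<lambda>l. a l * ramanujan_series (2 * s) (int l - n) * of_real (exp (- (2 * pi * real l * y)))) has_sum twisted_line_sum s n y) {1..}"
proof -
  have s2: "Re (2 * s) > 2" using s by simp
  define k where "k = (\<lambda>(c, d). of_nat c powr (- (2 * s)) * cnj (chi d) * ee (of_int (n * d) / of_nat c))"
  define q where "q l = a l * of_real (exp (- (2 * pi * real l * y)))" for l
  define X where "X = (\<lambda>(c, d :: int). - real_of_int d / real c)" 
  define G where "G = (\<lambda>(p, l). k p * (q l * ee (real l * X p)))"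
  have kn: "(\<lambda>p. norm (k p)) summable_on cusp_pairs N"
    using pair_series_summable[OF s2 cusp_pairs_subset, of "\<lambda>c d. of_int (n * d) / of_nat c"]
    by (simp add: k_def summable_on_iff_abs_summable_on_complex)
  have qn: "(\<lambda>l. norm (q l)) summable_on {1..}"
    using coeff_abs_summable[OF y] by (simp add: q_def norm_mult)
  have sG: "G summable_on cusp_pairs N \<times> {1..}"
  proof -
    have "(\<lambda>z. norm (k (fst z)) * norm (q (snd z))) summable_on cusp_pairs N \<times> {1..}"
    proof (rule summable_on_SigmaI)
      show "((\<lambda>l. norm (k (fst (p, l))) * norm (q (snd (p, l)))) has_sum norm (k p) * infsum (\<lambda>l. norm (q l)) {1..}) {1..}" for p
        unfolding fst_conv snd_conv by (intro has_sum_cmult_right has_sum_infsum qn)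
      show "(\<lambda>p. norm (k p) * infsum (\<lambda>l. norm (q l)) {1..}) summable_on cusp_pairs N"
        by (intro summable_on_cmult_left kn)
    qed auto
    then have "(\<lambda>z. norm (G z)) summable_on cusp_pairs N \<times> {1..}"
      by (simp add: G_def case_prod_unfold norm_mult)
    then show ?thesis by (simp only: summable_on_iff_abs_summable_on_complex)
  qed
  have "(G has_sum twisted_line_sum s n y) (cusp_pairs N \<times> {1..})"
  proof (rule has_sum_SigmaI[OF _ twisted_line_sum_has_sum[OF s] sG])
    fix p assume "p \<in> cusp_pairs N"
    obtain c d where p: "p = (c, d)" by (cases p)
    have "((\<lambda>l. k p * (q l * ee (real l * X p))) has_sum k p * f (Complex (X p) y)) {1..}"
      using expansion'[OF y, of "X p"] by (intro has_sum_cmult_right) (simp add: q_def)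
    then show "((\<lambda>l. G (p, l)) has_sum (case p of (c, d) \<Rightarrow> of_nat c powr (- (2 * s)) * cnj (chi d) * ee (of_int (n * d) / of_nat c)
      * f_line (- of_int d / of_nat c) y)) {1..}"
      using y by (simp add: G_def p k_def X_def f_line_def)
  qed
  then have "((\<lambda>(l, p). G (p, l)) has_sum twisted_line_sum s n y) ({1..} \<times> cusp_pairs N)"
    by (subst (asm) has_sum_swap) (simp add: case_prod_unfold)
  then show ?thesis
  proof (rule has_sum_Sigma')
    fix l :: nat
    define r where "r = (\<lambda>(c, d). of_nat c powr (- (2 * s)) * cnj (chi d) * ee (- (of_int ((int l - n) * d) / of_nat c)))"
    have "(r has_sum ramanujan_series (2 * s) (int l - n)) (cusp_pairs N)"
      unfolding r_def ramanujan_series_def by (intro has_sum_infsum pair_series_summable s2 cusp_pairs_subset)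
    from has_sum_cmult_right[OF this, of "q l"]
    have "((\<lambda>p. q l * r p) has_sum a l * ramanujan_series (2 * s) (int l - n) * of_real (exp (- (2 * pi * real l * y)))) (cusp_pairs N)"
      by (simp add: q_def mult_ac)
    moreover have "q l * r p = (case (l, p) of (l, p) \<Rightarrow> G (p, l))" for p
    proof -
      obtain c d where p: "p = (c, d)" by (cases p)
      have "ee (- (of_int ((int l - n) * d) / of_nat c)) = ee (of_int (n * d) / of_nat c) * ee (real l * X p)"
        unfolding ee_add[symmetric] by (rule arg_cong[of _ _ ee]) (simp add: p X_def diff_divide_distrib algebra_simps)
      then show ?thesis by (simp add: G_def r_def k_def p mult_ac)
    qed
    ultimately show "((\<lambda>p. case (l, p) of (l, p) \<Rightarrow> G (p, l)) has_sum a l * ramanujan_series (2 * s) (int l - n) * of_real (exp (- (2 * pi * real l * y)))) (cusp_pairs N)"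
      by simp
  qed
qed

text \<open>The bound C c^2 Gamma(\<sigma>) for each line is summable against c^(-2 Re s), whatever
  \<sigma> > 0 is. Convergence down to \<sigma> = 0 is what continues the Dirichlet series beyond
  its coefficient bound.\<close>

lemma twisted_line_sum_integral:
  assumes s: "Re s > 2" and \<sigma>: "\<sigma> > 0"
  shows "set_integrable lborel {0<..} (\<lambda>y. twisted_line_sum s n y * of_real (y powr (\<sigma> - 1)))"
    and "((\<lambda>(c, d). of_nat c powr (- (2 * s)) * cnj (chi d) * ee (of_int (n * d) / of_nat c)
       * (LINT y:{0<..}|lborel. f_line (- of_int d / of_nat c) y * of_real (y powr (\<sigma> - 1)))) has_sum
        (LINT y:{0<..}|lborel. twisted_line_sum s n y * of_real (y powr (\<sigma> - 1)))) (cusp_pairs N)"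
proof -
  obtain C where C: "C \<ge> 0"
    "\<And>c d \<sigma>. c > 0 \<Longrightarrow> int N dvd c \<Longrightarrow> coprime c d \<Longrightarrow> \<sigma> > 0 \<Longrightarrow> line_mass c d \<sigma> \<le> C * (of_int c)\<^sup>2 * Gamma \<sigma>"
    using line_mass_bound by blast
  define k where "k = (\<lambda>(c, d). of_nat c powr (- (2 * s)) * cnj (chi d) * ee (of_int (n * d) / of_nat c))"
  define X where "X = (\<lambda>(c, d :: int). - real_of_int d / real c)" 
  define h where "h p y = k p * (f_line (X p) y * of_real (y powr (\<sigma> - 1)))" for p y
  have pw: "((\<lambda>p. h p y) has_sum twisted_line_sum s n y * of_real (y powr (\<sigma> - 1))) (cusp_pairs N)" for y
    using has_sum_cmult_left[OF twisted_line_sum_has_sum[OF s, of n y], of "of_real (y powr (\<sigma> - 1))"]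
    by (simp add: h_def k_def X_def case_prod_unfold mult.assoc)
  have cp: "c > 0" "int N dvd int c" "coprime (int c) d" if "(c, d) \<in> cusp_pairs N" for c d
    using that by (auto simp: cusp_pairs_def)
  have fi: "set_integrable lborel {0<..} (\<lambda>y. norm (f_line (X p) y) * y powr (\<sigma> - 1))" if "p \<in> cusp_pairs N" for p
    using cusp_line_integrable[OF _ _ _ \<sigma>, of "int (fst p)" "snd p"] cp[of "fst p" "snd p"] that
    by (simp add: X_def case_prod_unfold)
  have ki: "set_integrable lborel {0<..} (\<lambda>y. f_line (X p) y * of_real (y powr (\<sigma> - 1)))" if "p \<in> cusp_pairs N" for p
    by (rule set_integrable_dominated(1)[OF fi[OF that]]) (auto simp: norm_mult)
  have hi: "set_integrable lborel {0<..} (h p)" if "p \<in> cusp_pairs N" for p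
    unfolding h_def by (intro set_integrable_mult_right ki that)
  have hs: "(\<lambda>p. LINT y:{0<..}|lborel. norm (h p y)) summable_on cusp_pairs N"
  proof (rule summable_on_comparison_test)
    show "(\<lambda>p. (C * Gamma \<sigma>) * (case p of (c, d) \<Rightarrow> real c powr (- (2 * Re s - 2)))) summable_on cusp_pairs N"
      using s by (intro summable_on_cmult_right cusp_pairs_summable) auto
    show "0 \<le> (LINT y:{0<..}|lborel. norm (h p y))" for p
      by (auto simp: set_lebesgue_integral_def intro!: integral_nonneg_AE)
    fix p assume p: "p \<in> cusp_pairs N"
    obtain c d where cd: "p = (c, d)" by (cases p)
    note c = cp[OF p[unfolded cd]]
    have "(LINT y:{0<..}|lborel. norm (h p y)) = norm (k p) * line_mass (int c) d \<sigma>"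
      by (simp add: h_def norm_mult line_mass_def X_def cd)
    also have "\<dots> \<le> real c powr (- Re (2 * s)) * (C * (real c)\<^sup>2 * Gamma \<sigma>)"
    proof (rule mult_mono)
      show "norm (k p) \<le> real c powr (- Re (2 * s))"
        unfolding k_def cd prod.case using p by (intro pair_weight_norm) (simp add: cd)
      show "line_mass (int c) d \<sigma> \<le> C * (real c)\<^sup>2 * Gamma \<sigma>"
        using C(2)[OF _ c(2,3) \<sigma>] c(1) by simp
      show "0 \<le> line_mass (int c) d \<sigma>"
        by (auto simp: line_mass_def set_lebesgue_integral_def intro!: integral_nonneg_AE)
    qed auto
    also have "(real c)\<^sup>2 = real c powr 2" using c by (simp add: powr_numeral)
    also have "real c powr (- Re (2 * s)) * (C * real c powr 2 * Gamma \<sigma>) = (C * Gamma \<sigma>) * (real c powr (- Re (2 * s)) * real c powr 2)"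
      by (simp only: mult_ac)
    also have "real c powr (- Re (2 * s)) * real c powr 2 = real c powr (- (2 * Re s - 2))"
      by (simp only: powr_add[symmetric]) simp
    finally show "(LINT y:{0<..}|lborel. norm (h p y)) \<le> (C * Gamma \<sigma>) * (case p of (c, d) \<Rightarrow> real c powr (- (2 * Re s - 2)))"
      by (simp add: cd)
  qed
  note R = set_integral_has_sum[OF countable_cusp_pairs hi hs pw]
  show "set_integrable lborel {0<..} (\<lambda>y. twisted_line_sum s n y * of_real (y powr (\<sigma> - 1)))" using R(1) by simp
  have "(LINT y:{0<..}|lborel. h p y) = (case p of (c, d) \<Rightarrow> of_nat c powr (- (2 * s)) * cnj (chi d) * ee (of_int (n * d) / of_nat c)
       * (LINT y:{0<..}|lborel. f_line (- of_int d / of_nat c) y * of_real (y powr (\<sigma> - 1))))" for p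
    unfolding h_def set_integral_mult_right by (simp add: k_def X_def case_prod_unfold)
  with R(2) show "((\<lambda>(c, d). of_nat c powr (- (2 * s)) * cnj (chi d) * ee (of_int (n * d) / of_nat c)
       * (LINT y:{0<..}|lborel. f_line (- of_int d / of_nat c) y * of_real (y powr (\<sigma> - 1)))) has_sum
        (LINT y:{0<..}|lborel. twisted_line_sum s n y * of_real (y powr (\<sigma> - 1)))) (cusp_pairs N)"
    by simp
qed

lemma twisted_line_sum_norm_integrable:
  assumes "Re s > 2" "\<sigma> > 0"
  shows "set_integrable lborel {0<..} (\<lambda>y. norm (twisted_line_sum s n y) * y powr (\<sigma> - 1))"
  using set_integrable_norm[OF twisted_line_sum_integral(1)[OF assms, of n]] by (simp add: norm_mult)

lemma twisted_line_sum_measurable: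
  assumes "Re s > 2"
  shows "twisted_line_sum s n \<in> borel_measurable borel"
proof -
  have "twisted_line_sum s n y = 0" if "y \<le> 0" for y
    using that unfolding twisted_line_sum_def f_line_def by (intro infsum_0) auto
  then have "(\<lambda>y. indicat_real {0<..} y *\<^sub>R (twisted_line_sum s n y * of_real (y powr (1 - 1)))) = twisted_line_sum s n"
    by (auto simp: fun_eq_iff indicator_def)
  then show ?thesis
    using borel_measurable_integrable[OF twisted_line_sum_integral(1)[OF assms zero_less_one, of n, unfolded set_integrable_def]] by simp
qed

text \<open>Termwise integration at \<sigma> = 1. The trivial power \<open>1 - 1\<close> is kept so
  that the right side is literally the Mellin integral at t = 1.\<close>

lemma eis_fourier_integral:
  assumes s: "Re s > 2"
  shows "eis_fourier s n = \<i> * (LINT y:{0<..}|lborel. twisted_line_sum s n y * of_real y powr (1 - 1))"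
proof -
  have pw: "(LINT y:{0<..}|lborel. g y * complex_of_real (y powr (1 - 1))) = (LINT y:{0<..}|lborel. g y)"
    "(LINT y:{0<..}|lborel. g y * complex_of_real y powr (1 - 1)) = (LINT y:{0<..}|lborel. g y)" for g
    by (auto intro!: set_lebesgue_integral_cong)
  have "((\<lambda>(c, d). of_nat c powr (- (2 * s)) * cnj (chi d) * ee (of_int (n * d) / of_nat c)
       * cusp_integral (int c) d) has_sum (LINT y:{0<..}|lborel. twisted_line_sum s n y)) (cusp_pairs N)"
    using twisted_line_sum_integral(2)[OF s zero_less_one, of n] unfolding pw by (simp add: cusp_integral_def)
  from has_sum_cmult_right[OF this, of \<i>]
  have "((\<lambda>(c, d). eis_coeff c d * of_nat c powr (- (2 * s)) * ee (of_int (n * d) / of_nat c)) has_sum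
      \<i> * (LINT y:{0<..}|lborel. twisted_line_sum s n y)) (cusp_pairs N)"
    by (simp add: eis_coeff_def case_prod_unfold mult_ac)
  then show ?thesis unfolding pw eis_fourier_def by (rule infsumI)
qed

definition shifted_coeff :: "complex \<Rightarrow> int \<Rightarrow> nat \<Rightarrow> complex" where
  "shifted_coeff s n l = a l * sigma_char chi (2 * s - 1) (nat \<bar>int l - n\<bar>) / of_nat (nat \<bar>int l - n\<bar>) powr (2 * s - 1)"

text \<open>The constant that solves \<open>L_char_times_ramanujan_series\<close> for the divisor
  function, turning the coefficients of \<open>twisted_line_sum\<close> into those of the shifted
  series.\<close>

definition shifted_factor :: "complex \<Rightarrow> complex" where
  "shifted_factor s = of_nat N powr (2 * s) * L_char N (conj_char chi) (2 * s) / gauss_sum N (conj_char chi)"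

definition shifted_continuation :: "complex \<Rightarrow> int \<Rightarrow> complex \<Rightarrow> complex" where
  "shifted_continuation s n t = shifted_factor s *
     (of_real (2 * pi) powr t / Gamma t * (LINT y:{0<..}|lborel. twisted_line_sum s n y * of_real y powr (t - 1)))"

lemma shifted_coeff_eq:
  assumes s: "Re s > 2" and l: "int l \<noteq> n"
  shows "shifted_coeff s n l = shifted_factor s * (a l * ramanujan_series (2 * s) (int l - n))"
proof -
  define m where "m = nat \<bar>int l - n\<bar>"
  have m: "m > 0" using l by (simp add: m_def)
  have N0: "N > 0" using N_gt_1 by simp
  have w: "Re (2 * s) > 2" using s by simp
  have L: "L_char N (conj_char chi) (2 * s) * ramanujan_series (2 * s) (int l - n) =
      of_nat N powr (- (2 * s)) * gauss_sum N (conj_char chi) * of_nat m powr (1 - 2 * s) * sigma_char chi (2 * s - 1) m"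
    using L_char_times_ramanujan_series[OF w, of "int l - n"] l by (simp add: m_def)
  have e: "complex_of_nat m powr (1 - 2 * s) = 1 / of_nat m powr (2 * s - 1)"
    using m powr_minus[of "complex_of_nat m" "2 * s - 1"] by (simp add: inverse_eq_divide)
  have NN: "complex_of_nat N powr (2 * s) * of_nat N powr (- (2 * s)) = 1"
    using N0 by (simp only: powr_add[symmetric]) simp
  have "shifted_factor s * (a l * ramanujan_series (2 * s) (int l - n)) =
      of_nat N powr (2 * s) / gauss_sum N (conj_char chi) * a l * (L_char N (conj_char chi) (2 * s) * ramanujan_series (2 * s) (int l - n))"
    by (simp add: shifted_factor_def mult_ac)
  also have "\<dots> = (of_nat N powr (2 * s) * of_nat N powr (- (2 * s))) * (gauss_sum N (conj_char chi) / gauss_sum N (conj_char chi)) *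
      (a l * sigma_char chi (2 * s - 1) m * (1 / of_nat m powr (2 * s - 1)))"
    unfolding L e by (simp add: mult_ac)
  also have "\<dots> = shifted_coeff s n l"
    unfolding NN using gauss_sum_nonzero by (simp add: shifted_coeff_def m_def)
  finally show ?thesis by simp
qed

text \<open>The coefficients are O(l^2), which gives the series for Re t > 2 + 1, while the Mellin
  integral is holomorphic for Re t > 0.\<close>

lemma shifted_continuation_props:
  assumes s: "Re s > 2"
  shows "shifted_continuation s n holomorphic_on {t. Re t > 0}"
    and "\<And>t. Re t > 3 \<Longrightarrow> ((\<lambda>l. shifted_coeff s n l * of_nat l powr (- t)) has_sum shifted_continuation s n t) {l. l \<ge> 1 \<and> int l - n \<noteq> 0}"
proof -
  have w: "Re (2 * s) > 2" using s by simp
  obtain C where C: "\<And>n. n \<ge> 1 \<Longrightarrow> norm (a n) \<le> C * real n powr 2" using coefficient_bound by blast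
  define B where "B = (\<Sum>\<^sub>\<infinity>(c, d)\<in>cusp_pairs N. real c powr (- Re (2 * s)))"
  have b: "norm (a l * ramanujan_series (2 * s) (int l - n)) \<le> (C * B) * real l powr 2" if "l \<ge> 1" for l
  proof -
    have "norm (a l * ramanujan_series (2 * s) (int l - n)) \<le> (C * real l powr 2) * B"
      unfolding norm_mult B_def using C[OF that] norm_ramanujan_series_le[OF w] order_trans[OF norm_ge_zero C[OF that]]
      by (intro mult_mono) auto
    then show ?thesis by (simp add: mult_ac)
  qed
  note M = continued_dirichlet_series_mellin[where \<alpha> = 0, OF b order_refl twisted_line_sum_measurable[OF s] twisted_line_sum_q_expansion[OF s] twisted_line_sum_norm_integrable[OF s]]
  show "shifted_continuation s n holomorphic_on {t. Re t > 0}"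
    unfolding shifted_continuation_def[abs_def] by (intro holomorphic_on_mult holomorphic_on_const M(1))
  show "((\<lambda>l. shifted_coeff s n l * of_nat l powr (- t)) has_sum shifted_continuation s n t) {l. l \<ge> 1 \<and> int l - n \<noteq> 0}"
    if t: "Re t > 3" for t
  proof -
    have "((\<lambda>l. shifted_factor s * (a l * ramanujan_series (2 * s) (int l - n) * of_nat l powr (- t))) has_sum shifted_continuation s n t) {1..}"
      unfolding shifted_continuation_def using t by (intro has_sum_cmult_right M(2)) auto
    then show ?thesis
    proof (rule has_sum_cong_neutral[THEN iffD1, rotated -1])
      \<comment> \<open>The Mellin transform runs over all l \<ge> 1, the shifted series omits l =
        n. The two agree because the Ramanujan series at 0 vanishes: its product with a nonzero
        L-value is 0.\<close>
      fix l assume "l \<in> {1..} - {l. l \<ge> 1 \<and> int l - n \<noteq> 0}"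
      then have "int l - n = 0" by auto
      then have "ramanujan_series (2 * s) (int l - n) = 0"
        using L_char_times_ramanujan_series[OF w, of 0] L_char_nonzero(2)[of "2 * s"] s by simp
      then show "shifted_factor s * (a l * ramanujan_series (2 * s) (int l - n) * of_nat l powr (- t)) = 0" by simp
    next
      fix l assume "l \<in> {1..} \<inter> {l. l \<ge> 1 \<and> int l - n \<noteq> 0}"
      then have "int l \<noteq> n" by auto
      then show "shifted_factor s * (a l * ramanujan_series (2 * s) (int l - n) * of_nat l powr (- t)) = shifted_coeff s n l * of_nat l powr (- t)"
        by (simp add: shifted_coeff_eq[OF s])
    qed auto
  qed
qed

lemma shifted_continuation_1:
  assumes s: "Re s > 2"
  shows "shifted_continuation s n 1 = shifted_factor s * (2 * of_real pi / \<i> * eis_fourier s n)"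
proof -
  define I where "I = (LINT y:{0<..}|lborel. twisted_line_sum s n y * of_real y powr (1 - 1))"
  have "eis_fourier s n = \<i> * I" unfolding I_def by (rule eis_fourier_integral[OF s])
  moreover have "shifted_continuation s n 1 = shifted_factor s * (of_real (2 * pi) powr 1 / Gamma 1 * I)"
    unfolding shifted_continuation_def I_def ..
  moreover have "complex_of_real (2 * pi) powr 1 / Gamma 1 = 2 * of_real pi" by simp
  moreover have "2 * of_real pi / \<i> * (\<i> * I) = 2 * of_real pi * I" by (simp add: field_simps)
  ultimately show ?thesis by (simp only:)
qed

lemma L_shifted_eq:
  assumes s: "Re s > 2"
  shows "L_shifted a n chi s = shifted_factor s * (2 * of_real pi / \<i> * eis_fourier s n)"
proof -
  have "L_shifted a n chi s = continued_dirichlet_series {l. l \<ge> 1 \<and> int l - n \<noteq> 0} (shifted_coeff s n) 1"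
    by (simp add: L_shifted_def shifted_coeff_def[abs_def] Let_def)
  also have "\<dots> = shifted_continuation s n 1"
    by (rule continued_dirichlet_series_eqI[OF _ shifted_continuation_props[OF s]]) simp_all
  finally show ?thesis by (simp only: shifted_continuation_1[OF s])
qed

text \<open>Gauss sums express chi(l) through the phases e(-ld/N), so the twisted series belongs to
  a finite combination of f on the lines above -d/N. Those with d prime to N lie above cusps
  equivalent to infinity, where the Mellin integral converges for Re t > 0; the others carry the
  coefficient 0.\<close>

lemma twist_continuation:
  obtains F where "F holomorphic_on {t. Re t > 0}"
    "\<And>t. Re t > 3 \<Longrightarrow> ((\<lambda>l. a l * chi (int l) * of_nat l powr (- t)) has_sum F t) {1..}"
proof -
  let ?W = "gauss_sum N (conj_char chi)"
  have N0: "N > 0" using N_gt_1 by simp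
  obtain C where C: "\<And>n. n \<ge> 1 \<Longrightarrow> norm (a n) \<le> C * real n powr 2" using coefficient_bound by blast
  have b: "norm (a l * chi (int l)) \<le> C * real l powr 2" if "l \<ge> 1" for l
  proof -
    have "norm (a l * chi (int l)) \<le> norm (a l) * 1"
      unfolding norm_mult using norm_chi_le by (intro mult_left_mono) auto
    then show ?thesis using C[OF that] by simp
  qed
  define \<Psi> where "\<Psi> y = (\<Sum>d\<in>{0..<int N}. (1 / ?W * cnj (chi d)) * f_line (- of_int d / of_nat N) y)" for y
  have m: "\<Psi> \<in> borel_measurable borel" unfolding \<Psi>_def by measurable
  have \<Psi>: "((\<lambda>l. a l * chi (int l) * of_real (exp (- (2 * pi * real l * y)))) has_sum \<Psi> y) {1..}" if y: "y > 0" for y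
  proof -
    have "((\<lambda>l. \<Sum>d\<in>{0..<int N}. (1 / ?W * cnj (chi d)) * (a l * of_real (exp (- (2 * pi * real l * y))) * ee (real l * (- of_int d / of_nat N)))) has_sum \<Psi> y) {1..}"
      unfolding \<Psi>_def
    proof (rule has_sum_finite_sum)
      show "((\<lambda>l. (1 / ?W * cnj (chi d)) * (a l * of_real (exp (- (2 * pi * real l * y))) * ee (real l * (- of_int d / of_nat N)))) has_sum
          (1 / ?W * cnj (chi d)) * f_line (- of_int d / of_nat N) y) {1..}" for d
        using expansion'[OF y, of "- of_int d / of_nat N"] y by (intro has_sum_cmult_right) (simp add: f_line_def)
    qed simp
    moreover have "(\<Sum>d\<in>{0..<int N}. (1 / ?W * cnj (chi d)) * (a l * of_real (exp (- (2 * pi * real l * y))) * ee (real l * (- of_int d / of_nat N))))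
        = a l * chi (int l) * of_real (exp (- (2 * pi * real l * y)))" for l
    proof -
      have "ee (real l * (- of_int d / of_nat N)) = ee (- (of_int (int l * d) / of_nat N))" for d by simp
      then have "(\<Sum>d\<in>{0..<int N}. (1 / ?W * cnj (chi d)) * (a l * of_real (exp (- (2 * pi * real l * y))) * ee (real l * (- of_int d / of_nat N))))
          = a l * of_real (exp (- (2 * pi * real l * y))) / ?W * twisted_gauss (int l)"
        unfolding twisted_gauss_def sum_distrib_left by (intro sum.cong) (simp_all only: mult_ac divide_inverse mult_1_left)
      also have "\<dots> = a l * chi (int l) * of_real (exp (- (2 * pi * real l * y)))"
        unfolding twisted_gauss_eq using gauss_sum_nonzero by simp
      finally show ?thesis .
    qed
    ultimately show ?thesis by simp
  qed
  have i: "set_integrable lborel {0<..} (\<lambda>y. norm (\<Psi> y) * y powr (\<sigma> - 1))" if \<sigma>: "\<sigma> > 0" for \<sigma>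
  proof -
    have "set_integrable lborel {0<..} (\<lambda>y. norm (1 / ?W * cnj (chi d)) * (norm (f_line (- of_int d / of_nat N) y) * y powr (\<sigma> - 1)))" for d
    proof (cases "coprime (int N) d")
      case True
      from cusp_line_integrable[OF _ _ this \<sigma>] N0 show ?thesis by (intro set_integrable_mult_right) simp
    next
      case False
      then have "chi d = 0" using chi_nonzero_iff[of d] by (simp add: coprime_commute)
      then show ?thesis by (simp add: set_integrable_def)
    qed
    then have "set_integrable lborel {0<..} (\<lambda>y. \<Sum>d\<in>{0..<int N}. norm (1 / ?W * cnj (chi d)) * (norm (f_line (- of_int d / of_nat N) y) * y powr (\<sigma> - 1)))"
      unfolding set_integrable_def scaleR_sum_right by (intro Bochner_Integration.integrable_sum)
    then show ?thesis
    proof (rule set_integrable_dominated(1))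
      show "norm (norm (\<Psi> y) * y powr (\<sigma> - 1)) \<le> (\<Sum>d\<in>{0..<int N}. norm (1 / ?W * cnj (chi d)) * (norm (f_line (- of_int d / of_nat N) y) * y powr (\<sigma> - 1)))"
        if "y \<in> {0<..}" for y
      proof -
        have "norm (\<Psi> y) \<le> (\<Sum>d\<in>{0..<int N}. norm (1 / ?W * cnj (chi d)) * norm (f_line (- of_int d / of_nat N) y))"
          unfolding \<Psi>_def by (rule order_trans[OF norm_sum]) (simp only: norm_mult order_refl)
        from mult_right_mono[OF this, of "y powr (\<sigma> - 1)"] show ?thesis
          by (simp add: sum_distrib_right mult.assoc)
      qed
    qed (use m in auto)
  qed
  note M = continued_dirichlet_series_mellin[where \<alpha> = 0, OF b order_refl m \<Psi> i]
  show ?thesis by (rule that[OF M(1) M(2)]) auto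
qed

text \<open>For Re t > 3 this is \<open>rankin_identity\<close> with u = t + 2s - 1, whose
  L-argument is 2t + 2s - 2. Since Re s > 2, the arguments t + 2s - 1 and 2t + 2s - 2 stay in
  half-planes of absolute convergence for all Re t > 0, so genuine continuation concerns only the
  shifted series and L(f \<otimes> chi, t).\<close>

lemma rankin_identity_continued:
  assumes s: "Re s > 2" and hecke: "hecke_eigenform2 N f" and a1: "a 1 = 1"
  shows "L_char N chi (2 * s) * shifted_continuation s 0 1 = L_form_twist a chi 1 * L_form a (2 * s)"
proof -
  obtain F1 where F1: "F1 holomorphic_on {t. Re t > 0}"
    "\<And>t. Re t > 3 \<Longrightarrow> ((\<lambda>l. a l * chi (int l) * of_nat l powr (- t)) has_sum F1 t) {1..}"
    using twist_continuation by blast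
  obtain C where C: "\<And>n. n \<ge> 1 \<Longrightarrow> norm (a n) \<le> C * real n powr 2" using coefficient_bound by blast
  obtain F2 where F2: "F2 holomorphic_on {t. Re t > 2 + 1}"
    "\<And>t. Re t > 2 + 1 \<Longrightarrow> ((\<lambda>l. a l * of_nat l powr (- t)) has_sum F2 t) {1..}"
    using dirichlet_series_holomorphic[of a C 2] C by auto
  have "norm (chi (int l)) \<le> 1 * real l powr 0" if "l \<ge> 1" for l using norm_chi_le[of "int l"] that by simp
  then obtain FX where FX: "FX holomorphic_on {t. Re t > 0 + 1}"
    "\<And>t. Re t > 0 + 1 \<Longrightarrow> ((\<lambda>l. chi (int l) * of_nat l powr (- t)) has_sum FX t) {1..}"
    using dirichlet_series_holomorphic[of "\<lambda>l. chi (int l)" 1 0] by auto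
  have FXL: "FX t = L_char N chi t" if "Re t > 1" for t
  proof -
    have "((\<lambda>l. chi (int l) * of_nat l powr (- t)) has_sum FX t) {n. n \<ge> 1 \<and> coprime n N}"
    proof (rule has_sum_cong_neutral[THEN iffD1, OF _ _ _ FX(2)])
      show "chi (int l) * of_nat l powr (- t) = 0" if "l \<in> {1..} - {n. n \<ge> 1 \<and> coprime n N}" for l
        using that chi_nonzero_iff[of "int l"] by auto
    qed (use that in auto)
    then show ?thesis using L_char_has_sum(2)[OF that] by (rule has_sum_unique)
  qed
  have twist: "L_form_twist a chi 1 = F1 1"
    unfolding L_form_twist_def by (rule continued_dirichlet_series_eqI[OF _ F1]) auto
  have form: "L_form a (2 * s) = F2 (2 * s)"
    unfolding L_form_def by (rule continued_dirichlet_series_eqI[OF _ F2]) (use s in auto)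
  note F0 = shifted_continuation_props[OF s, where n = 0]
  \<comment> \<open>Both sides are written through explicit holomorphic functions on Re t > 0; at t
    = 1 the arguments become 2s in both \<open>FX\<close> and \<open>F2\<close>.\<close>
  have "FX (2 * 1 + 2 * s - 2) * shifted_continuation s 0 1 = F1 1 * F2 (1 + 2 * s - 1)"
  proof (rule analytic_continuation_open[of "{t. Re t > 3}" "{t. Re t > 0}" "\<lambda>t. FX (2 * t + 2 * s - 2) * shifted_continuation s 0 t" "\<lambda>t. F1 t * F2 (t + 2 * s - 1)"])
    show "open {t. Re t > 3}" "open {t. Re t > 0}" by (simp_all add: open_halfspace_Re_gt)
    have "(4 :: complex) \<in> {t. Re t > 3}" by simp
    then show "{t. Re t > 3} \<noteq> {}" by blast
    show "connected {t. Re t > 0}" by (intro convex_connected convex_halfspace_Re_gt)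
    show "{t. Re t > 3} \<subseteq> {t. Re t > 0}" by auto
    have "(FX \<circ> (\<lambda>t. 2 * t + 2 * s - 2)) holomorphic_on {t. Re t > 0}"
      by (rule holomorphic_on_compose_gen[OF _ FX(1)]) (use s in \<open>auto intro!: holomorphic_intros\<close>)
    then show "(\<lambda>t. FX (2 * t + 2 * s - 2) * shifted_continuation s 0 t) holomorphic_on {t. Re t > 0}"
      by (intro holomorphic_on_mult F0(1)) (simp add: o_def)
    have "(F2 \<circ> (\<lambda>t. t + 2 * s - 1)) holomorphic_on {t. Re t > 0}"
      by (rule holomorphic_on_compose_gen[OF _ F2(1)]) (use s in \<open>auto intro!: holomorphic_intros\<close>)
    then show "(\<lambda>t. F1 t * F2 (t + 2 * s - 1)) holomorphic_on {t. Re t > 0}"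
      by (intro holomorphic_on_mult F1(1)) (simp add: o_def)
    show "FX (2 * t + 2 * s - 2) * shifted_continuation s 0 t = F1 t * F2 (t + 2 * s - 1)" if "t \<in> {t. Re t > 3}" for t
    proof -
      have t: "Re t > 3" using that by simp
      have u: "Re (t + 2 * s - 1) > 3" using t s by simp
      have "((\<lambda>l. shifted_coeff s 0 l * of_nat l powr (- t)) has_sum shifted_continuation s 0 t) {1..}"
        using F0(2)[OF t] by (rule has_sum_cong_neutral[THEN iffD1, rotated -1]) auto
      then have Y: "((\<lambda>l. a l * (\<Sum>d | d dvd l. chi (int d) * of_nat d powr (- t) * of_nat (l div d) powr (- (t + 2 * s - 1)))) has_sum shifted_continuation s 0 t) {1..}"
      proof (rule has_sum_cong[THEN iffD1, rotated])
        fix l :: nat assume "l \<in> {1..}"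
        then have l: "l > 0" by auto
        \<comment> \<open>For l = de one has d^(-t) e^(-(t + 2s - 1)) = l^(-t) l^(-(2s - 1)) d^(2s -
          1), which turns the convolution of the two power weights into the twisted divisor
          function.\<close>
        have "chi (int d) * of_nat d powr (- t) * of_nat (l div d) powr (- (t + 2 * s - 1)) =
            of_nat l powr (- t) / of_nat l powr (2 * s - 1) * (chi (int d) * of_nat d powr (2 * s - 1))" if dl: "d dvd l" for d
        proof -
          obtain e where e: "l = d * e" using dl by (elim dvdE)
          have p: "d > 0" "e > 0" using l e by auto
          have de: "complex_of_nat l powr z = of_nat d powr z * of_nat e powr z" for z
            using powr_times_real[of "of_nat d" "of_nat e" z] by (simp add: e)
          have "complex_of_nat e powr (- (t + 2 * s - 1)) = of_nat e powr (- t) / of_nat e powr (2 * s - 1)"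
            using powr_diff[of "complex_of_nat e" "- t" "2 * s - 1"] p by (simp add: algebra_simps)
          moreover have "l div d = e" using p e by simp
          ultimately show ?thesis unfolding de using p by (simp add: field_simps)
        qed
        then have "(\<Sum>d | d dvd l. chi (int d) * of_nat d powr (- t) * of_nat (l div d) powr (- (t + 2 * s - 1))) =
            of_nat l powr (- t) / of_nat l powr (2 * s - 1) * sigma_char chi (2 * s - 1) l"
          unfolding sigma_char_def sum_distrib_left by (intro sum.cong) auto
        then show "shifted_coeff s 0 l * of_nat l powr (- t) =
            a l * (\<Sum>d | d dvd l. chi (int d) * of_nat d powr (- t) * of_nat (l div d) powr (- (t + 2 * s - 1)))"
          by (simp add: shifted_coeff_def)
      qed
      have "L_char N chi (t + (t + 2 * s - 1) - 1) * shifted_continuation s 0 t = F1 t * F2 (t + 2 * s - 1)"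
        by (rule rankin_identity[OF hecke a1 t u F1(2)[OF t] F2(2) Y]) (use u in simp)
      moreover have "L_char N chi (t + (t + 2 * s - 1) - 1) = FX (2 * t + 2 * s - 2)"
        using FXL[of "2 * t + 2 * s - 2"] t s by (simp add: algebra_simps)
      ultimately show ?thesis by simp
    qed
    show "1 \<in> {t. Re t > 0}" by simp
  qed
  moreover have "FX (2 * s) = L_char N chi (2 * s)" using s by (intro FXL) simp
  ultimately show ?thesis by (simp add: twist form)
qed

end

text \<open>Scaling f explains where \<open>a 1 = 1\<close> stands: both sides of the first identity
  are linear in the coefficients, whereas in the second the left side is linear and the right side
  quadratic, so that one refers to the normalised form.\<close>

theorem theorem2p4:
  fixes N :: nat and f :: "complex \<Rightarrow> complex" and a :: "nat \<Rightarrow> complex"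
    and chi :: "int \<Rightarrow> complex" and s :: complex
  assumes "N > 1"
    and "cusp_form2 N f"
    and "\<And>z. z \<in> upper_half_plane \<Longrightarrow>
           ((\<lambda>n. a n * exp (2 * of_real pi * \<i> * of_nat n * z)) has_sum f z) {1..}"
    and "hecke_eigenform2 N f"
    and "primitive_dirichlet_char N chi"
    and "chi (- 1) = 1"
    and "Re s > 2"
  shows "(\<forall>n::int. n \<noteq> 0 \<longrightarrow>
            L_shifted a n chi s =
              2 * Gamma s * of_nat N powr (2 * s) * L_char N (conj_char chi) (2 * s)
                / (\<i> * gauss_sum N (conj_char chi) * of_real (pi * real_of_int \<bar>n\<bar>) powr (s - 1))
              * phi_star N f chi n s)
       \<and> (a 1 = 1 \<longrightarrow>
            phi_star_const N f chi s =
              \<i> * gauss_sum N (conj_char chi) * Gamma (s - 1 / 2)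
                / (2 * of_real (sqrt pi) * of_nat N powr (2 * s) * Gamma s)
              * (L_form_twist a chi 1 * L_form a (2 * s)
                  / (L_char N (conj_char chi) (2 * s) * L_char N chi (2 * s))))"
proof -
  interpret hecke_setting N chi f a
    using assms by unfold_locales auto
  note s = assms(7)
  let ?W = "gauss_sum N (conj_char chi)" and ?L = "L_char N (conj_char chi) (2 * s)"
  have nz: "?W \<noteq> 0" "?L \<noteq> 0" "L_char N chi (2 * s) \<noteq> 0" "Gamma s \<noteq> 0" "complex_of_nat N powr (2 * s) \<noteq> 0"
    using gauss_sum_nonzero L_char_nonzero[of "2 * s"] s Gamma_complex_nonzero[of s] assms(1) by auto
  show ?thesis
  proof (intro conjI allI impI)
    fix n :: int assume n: "n \<noteq> 0"
    define k where "k = \<bar>real_of_int n\<bar>"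
    have k: "k > 0" using n by (simp add: k_def)
    have pk: "complex_of_real (pi * k) powr (s - 1) = of_real pi powr (s - 1) * of_real k powr (s - 1)"
      using k powr_times_real[of "of_real pi" "of_real k" "s - 1"] by simp
    have ps: "complex_of_real pi powr s = of_real pi powr (s - 1) * of_real pi"
      using powr_add[of "complex_of_real pi" "s - 1" 1] by simp
    have kn: "complex_of_real k powr (s - 1) \<noteq> 0" "complex_of_real pi powr (s - 1) \<noteq> 0" using k by auto
    have phi: "phi_star N f chi n s = of_real pi powr (s - 1) * of_real pi * of_real k powr (s - 1) / Gamma s * eis_fourier s n"
      using phi_star_eq(2)[OF s n] unfolding ps k_def by simp
    have "L_shifted a n chi s = 2 * Gamma s * of_nat N powr (2 * s) * ?L / (\<i> * ?W * of_real (pi * k) powr (s - 1)) * phi_star N f chi n s"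
      unfolding L_shifted_eq[OF s] phi pk shifted_factor_def using nz kn by (simp add: field_simps)
    then show "L_shifted a n chi s = 2 * Gamma s * of_nat N powr (2 * s) * ?L / (\<i> * ?W * of_real (pi * real_of_int \<bar>n\<bar>) powr (s - 1)) * phi_star N f chi n s"
      by (simp add: k_def)
  next
    assume a1: "a 1 = 1"
    have "L_form_twist a chi 1 * L_form a (2 * s) = L_char N chi (2 * s) * (shifted_factor s * (2 * of_real pi / \<i> * eis_fourier s 0))"
      using rankin_identity_continued[OF s assms(4) a1] shifted_continuation_1[OF s, of 0] by simp
    \<comment> \<open>The factor sqrt(pi) of the constant term meets 1/(2 pi) from the value of the
      Mellin transform at t = 1, which leaves the 2 sqrt(pi) in the denominator.\<close>
    moreover have "complex_of_real pi = of_real (sqrt pi) * of_real (sqrt pi)" by (simp flip: of_real_mult)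
    moreover have "complex_of_real (sqrt pi) \<noteq> 0" by simp
    ultimately show "phi_star_const N f chi s = \<i> * ?W * Gamma (s - 1 / 2) / (2 * of_real (sqrt pi) * of_nat N powr (2 * s) * Gamma s)
        * (L_form_twist a chi 1 * L_form a (2 * s) / (?L * L_char N chi (2 * s)))"
      unfolding phi_star_eq(1)[OF s] shifted_factor_def using nz by (simp add: field_simps)
  qed
qed

end
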